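(* The speed $p\mapsto v(p)$ of the mutually excited random walk is a continuous function on the interval $\left[\frac12,1\right)$.
   Context: The mutually excited random walk (MERW) with parameter $p$ is a pair of $\mathbb{Z}$-valued processes $(X_n,Y_n)_{n\ge 0}$ with $X_0=Y_0=0$. Let $\mathcal{F}_n=\sigma(X_0,\dots,X_n,Y_0,\dots,Y_n)$. Set $w(0)=w(1)=\frac12$ and $w(j)=p$ for all integers $j\ge 2$. Conditionally on $\mathcal{F}_n$, the steps $X_{n+1}-X_n$ and $Y_{n+1}-Y_n$ are independent, take values in $\{-1,+1\}$, and satisfy $$\mathbf{P}[X_{n+1}=X_n+1\mid\mathcal{F}_n]=w\big(\#\{0\le m\le n:Y_m=X_n\}\big),\qquad \mathbf{P}[Y_{n+1}=Y_n+1\mid\mathcal{F}_n]=w\big(\#\{0\le m\le n:X_m=Y_n\}\big).$$ For $\frac12\le p<1$, $v(p)$ denotes the deterministic almost sure limit $v(p)=\lim_{n\to\infty}X_n/n=\lim_{n\to\infty}Y_n/n$ (at $p=\frac12$ both walks are simple symmetric random walks and $v(\frac12)=0$). *)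

theory Defs
  imports "HOL-Probability.Probability"
begin

definition merw_weight :: "real \<Rightarrow> nat \<Rightarrow> real" where
  "merw_weight p j = (if j \<le> 1 then 1/2 else p)"

definition visits :: "(nat \<Rightarrow> 'a \<Rightarrow> int) \<Rightarrow> nat \<Rightarrow> int \<Rightarrow> 'a \<Rightarrow> nat" where
  "visits Z n x \<omega> = card {m. m \<le> n \<and> Z m \<omega> = x}"

definition history ::
  "'a measure \<Rightarrow> (nat \<Rightarrow> 'a \<Rightarrow> int) \<Rightarrow> (nat \<Rightarrow> 'a \<Rightarrow> int) \<Rightarrow> nat \<Rightarrow> 'a measure" where
  "history M X Y n = sigma (space M)
     ({X m -` A \<inter> space M | m A. m \<le> n} \<union> {Y m -` A \<inter> space M | m A. m \<le> n})"

text \<open>A version of the conditional probability of the event \<open>{\<omega>. E \<omega>}\<close> given the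
  sub-sigma-algebra \<open>F\<close>; like every conditional expectation it is meaningful only up to null sets.\<close>

definition cond_probability :: "'a measure \<Rightarrow> 'a measure \<Rightarrow> ('a \<Rightarrow> bool) \<Rightarrow> 'a \<Rightarrow> real" where
  "cond_probability M F E = real_cond_exp M F (indicator {\<omega> \<in> space M. E \<omega>})"

definition cond_indep_int ::
  "'a measure \<Rightarrow> 'a measure \<Rightarrow> ('a \<Rightarrow> int) \<Rightarrow> ('a \<Rightarrow> int) \<Rightarrow> bool" where
  "cond_indep_int M F U V \<longleftrightarrow> (\<forall>A B. AE \<omega> in M.
     cond_probability M F (\<lambda>\<eta>. U \<eta> \<in> A \<and> V \<eta> \<in> B) \<omega> =
     cond_probability M F (\<lambda>\<eta>. U \<eta> \<in> A) \<omega> * cond_probability M F (\<lambda>\<eta>. V \<eta> \<in> B) \<omega>)"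

locale mutually_excited_random_walk = prob_space M
  for M :: "'a measure" +
  fixes p :: real and X Y :: "nat \<Rightarrow> 'a \<Rightarrow> int"
  assumes measurable_X: "X n \<in> measurable M (count_space UNIV)"
    and measurable_Y: "Y n \<in> measurable M (count_space UNIV)"
    and start: "AE \<omega> in M. X 0 \<omega> = 0 \<and> Y 0 \<omega> = 0"
    and steps: "AE \<omega> in M. X (Suc n) \<omega> - X n \<omega> \<in> {-1, 1} \<and> Y (Suc n) \<omega> - Y n \<omega> \<in> {-1, 1}"
    and indep_steps: "cond_indep_int M (history M X Y n)
          (\<lambda>\<omega>. X (Suc n) \<omega> - X n \<omega>) (\<lambda>\<omega>. Y (Suc n) \<omega> - Y n \<omega>)"
    and step_X: "AE \<omega> in M.
          cond_probability M (history M X Y n) (\<lambda>\<eta>. X (Suc n) \<eta> = X n \<eta> + 1) \<omega>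
            = merw_weight p (visits Y n (X n \<omega>) \<omega>)"
    and step_Y: "AE \<omega> in M.
          cond_probability M (history M X Y n) (\<lambda>\<eta>. Y (Suc n) \<eta> = Y n \<eta> + 1) \<omega>
            = merw_weight p (visits X n (Y n \<omega>) \<omega>)"

end

theory Submission
  imports Defs "HOL-Real_Asymp.Real_Asymp"
begin

text \<open>A history is a pair of step lists, so expectations at a fixed time are finite sums, polynomial
  in the parameter, and any finite stretch of the process has a law depending continuously on it.
  The difficulty is to make this uniform in time. Cut the time axis at \<^emph>\<open>fresh\<close> times, when both
  walkers step onto a level that neither has visited. A run is the stretch after a fresh time until
  one walker drops below its starting level or the age reaches \<open>N\<close>; its law does not depend on the
  past. The total drift up to time \<open>n\<close> is, up to the time spent between runs, the number of runs
  times the mean drift of one run at a fixed horizon, which is continuous in the parameter.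

  The time between runs is a small fraction of \<open>n\<close> for large \<open>N\<close>, uniformly for parameters in
  \<open>[p0, p1]\<close> with \<open>1/2 < p0 \<le> p1 < 1\<close>. Indeed, let the walker with the lower maximum move below the
  maximum of the other one. There the environment is frozen, with drift except on the levels that
  the other walker first left upwards, and the expected time to catch up is an explicit
  sum \<open>Phi\<close> of crossing times. On average it decreases by at least one per step, except when the other walker reaches a
  new level or the roles are exchanged. Third moments of the crossing times control the first
  loss. The second is controlled by the squared deficit \<open>(maximum - position)\<^sup>2\<close>, which has mean
  increment at most one. The same estimates bound from below the
  probability that neither walker ever becomes negative. Hence a run lasts for a time of order \<open>N\<close>
  on average, so there are only \<open>O(n / N)\<close> runs, and the process may be killed below \<open>0\<close>.

  At \<open>p = 1/2\<close> continuity follows from \<open>0 \<le> v(p) \<le> 2 p - 1\<close>.\<close>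

text \<open>Third moments are dictated by summability. The crossing time of a level at distance
  \<open>d\<close> below a maximum is split at a threshold proportional to \<open>M + d\<close>; the
  part above it is at most a constant times the cube over \<open>(M + d)^2\<close>. These weights
  have sum at most \<open>2 / (M + 1)\<close>, so a new level costs a bounded amount however long
  the past, and little if the offset \<open>M\<close> is large. With squares in place of cubes the
  weights would be \<open>1 / (M + d)\<close>, whose sums grow with the level.

  The passage from a fixed horizon to the speed rests on self-similarity. A run is a copy of the
  process killed below \<open>0\<close>, watched up to age \<open>N\<close>, so one and the same
  killed sum, centred at the speed at \<open>p\<close>, occurs at horizon \<open>n\<close> and at
  horizon \<open>N\<close>. At \<open>p\<close> its average tends to \<open>0\<close>, hence is
  small at some large fixed \<open>N\<close>; continuity at this \<open>N\<close> extends that to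
  nearby \<open>q\<close>; the number of runs carries it to horizon \<open>n\<close>. There the
  average tends to the difference of the speeds times the probability of survival, and the uniform
  lower bound for survival is used once more to divide by it.\<close>

text \<open>Steps are listed newest first. The value \<open>first_up xs z\<close> tells whether the first step out of
  level \<open>z\<close> was upwards; it is \<open>False\<close> while that step has not been made, and always at \<open>z \<le> 0\<close>.
  If \<open>1 \<le> z\<close>, \<open>z < mx xs\<close> and \<open>first_up xs z\<close> fails, then \<open>z\<close> was visited at least twice.\<close>

primrec pos :: "bool list \<Rightarrow> int" where
  "pos [] = 0"
| "pos (b # xs) = pos xs + (if b then 1 else -1)"

primrec mx :: "bool list \<Rightarrow> int" where
  "mx [] = 0"
| "mx (b # xs) = (if b \<and> pos xs = mx xs then mx xs + 1 else mx xs)"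

primrec new_max :: "bool list \<Rightarrow> bool" where
  "new_max [] = False"
| "new_max (b # xs) = (b \<and> pos xs = mx xs)"

primrec visit_count :: "bool list \<Rightarrow> int \<Rightarrow> nat" where
  "visit_count [] z = (if z = 0 then 1 else 0)"
| "visit_count (b # xs) z = visit_count xs z + (if pos (b # xs) = z then 1 else 0)"

primrec first_up :: "bool list \<Rightarrow> int \<Rightarrow> bool" where
  "first_up [] = (\<lambda>_. False)"
| "first_up (b # xs) = (if new_max xs then (first_up xs)(mx xs := b) else first_up xs)"

primrec nonneg_path :: "bool list \<Rightarrow> bool" where
  "nonneg_path [] = True"
| "nonneg_path (b # xs) = (nonneg_path xs \<and> 0 \<le> pos (b # xs))"

section \<open>Maxima, new levels and visit counts of a step list\<close>

lemma pos_le_mx: "pos xs \<le> mx xs"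
  by (induction xs) auto

lemma mx_nonneg: "0 \<le> mx xs"
  by (induction xs) auto

lemma new_max_imp: "new_max xs \<Longrightarrow> pos xs = mx xs \<and> 1 \<le> mx xs"
  using mx_nonneg by (cases xs) (auto simp: add.commute)

lemma mx_Cons_new_max: "mx (b # xs) = mx xs + of_bool (new_max (b # xs))"
  by simp

lemma nonneg_path_pos: "nonneg_path xs \<Longrightarrow> 0 \<le> pos xs"
  by (cases xs) auto

lemma mx_le_length: "mx xs \<le> int (length xs)"
  by (induction xs) auto

lemma visit_count_above: "mx xs < z \<Longrightarrow> visit_count xs z = 0"
proof (induction xs)
  case (Cons b xs)
  then show ?case using pos_le_mx[of xs] by (auto split: if_splits)
qed auto

lemma visit_count_pos: "0 \<le> z \<Longrightarrow> z \<le> mx xs \<Longrightarrow> 1 \<le> visit_count xs z"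
proof (induction xs)
  case (Cons b xs)
  show ?case
  proof (cases "z \<le> mx xs")
    case True
    then show ?thesis using Cons by auto
  next
    case False
    then show ?thesis using Cons.prems pos_le_mx[of xs] by (auto split: if_splits)
  qed
qed auto

lemma visit_count_new_max: "new_max xs \<Longrightarrow> visit_count xs (mx xs) = 1"
proof (cases xs)
  case (Cons b ys)
  assume "new_max xs"
  then show ?thesis using Cons visit_count_above[of ys "mx ys + 1"] by auto
qed auto

lemma visit_count_back: "\<not> new_max xs \<Longrightarrow> pos xs = mx xs \<Longrightarrow> 1 \<le> mx xs \<Longrightarrow> 2 \<le> visit_count xs (mx xs)"
proof (cases xs)
  case (Cons b ys)
  assume a: "\<not> new_max xs" "pos xs = mx xs" "1 \<le> mx xs"
  then have "mx xs = mx ys" using Cons by auto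
  then show ?thesis using a Cons visit_count_pos[of "mx ys" ys] by auto
qed auto

text \<open>A walker that first left \<open>z\<close> downwards and later exceeded \<open>z\<close>
  must have come back to \<open>z\<close> in between. This is how a first step down becomes a drift
  for the other walker.\<close>

lemma visit_count_excited: "1 \<le> z \<Longrightarrow> z < mx xs \<Longrightarrow> \<not> first_up xs z \<Longrightarrow> 2 \<le> visit_count xs z"
proof (induction xs)
  case (Cons b xs)
  show ?case
  proof (cases "z < mx xs")
    case True
    then show ?thesis using Cons by (auto split: if_splits)
  next
    case False
    then have z: "z = mx xs" "b" "pos xs = mx xs" using Cons.prems by (auto split: if_splits)
    then have "\<not> new_max xs" using Cons.prems by auto
    then have "2 \<le> visit_count xs z" using visit_count_back[of xs] z Cons.prems by auto
    then show ?thesis by simp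
  qed
qed auto

section \<open>One-step and many-step expectations over pairs of histories\<close>

definition up_prob :: "real \<Rightarrow> bool list \<Rightarrow> bool list \<Rightarrow> real" where
  "up_prob q xs ys = merw_weight q (visit_count ys (pos xs))"

definition stepE :: "real \<Rightarrow> (bool list \<Rightarrow> bool list \<Rightarrow> real) \<Rightarrow> bool list \<Rightarrow> bool list \<Rightarrow> real" where
  "stepE q F xs ys =
     up_prob q xs ys * (up_prob q ys xs * F (True # xs) (True # ys)
                   + (1 - up_prob q ys xs) * F (True # xs) (False # ys))
   + (1 - up_prob q xs ys) * (up_prob q ys xs * F (False # xs) (True # ys)
                   + (1 - up_prob q ys xs) * F (False # xs) (False # ys))"

lemma up_prob_cases: "up_prob q xs ys = 1/2 \<or> up_prob q xs ys = q"
  by (auto simp: up_prob_def merw_weight_def)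

lemma up_prob_above: "mx ys < pos xs \<Longrightarrow> up_prob q xs ys = 1/2"
  by (simp add: up_prob_def merw_weight_def visit_count_above)

lemma up_prob_excited: "1 \<le> pos xs \<Longrightarrow> pos xs < mx ys \<Longrightarrow> \<not> first_up ys (pos xs) \<Longrightarrow> up_prob q xs ys = q"
  using visit_count_excited[of "pos xs" ys] by (simp add: up_prob_def merw_weight_def)

lemma stepE_swap: "stepE q F xs ys = stepE q (\<lambda>b a. F a b) ys xs"
  by (simp add: stepE_def algebra_simps)

lemma stepE_add: "stepE q (\<lambda>a b. F a b + G a b) xs ys = stepE q F xs ys + stepE q G xs ys"
  by (simp add: stepE_def algebra_simps)

lemma stepE_diff: "stepE q (\<lambda>a b. F a b - G a b) xs ys = stepE q F xs ys - stepE q G xs ys"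
  by (simp add: stepE_def algebra_simps)

lemma stepE_cmult: "stepE q (\<lambda>a b. c * F a b) xs ys = c * stepE q F xs ys"
  by (simp add: stepE_def algebra_simps)

lemma stepE_multc: "stepE q (\<lambda>a b. F a b * c) xs ys = stepE q F xs ys * c"
  by (simp add: stepE_def algebra_simps)

lemma stepE_divc: "stepE q (\<lambda>a b. F a b / c) xs ys = stepE q F xs ys / c"
  using stepE_multc[of q F "1 / c" xs ys] by simp

lemma stepE_const [simp]: "stepE q (\<lambda>a b. c) xs ys = c"
  by (simp add: stepE_def algebra_simps)

lemma stepE_sum: "stepE q (\<lambda>a b. \<Sum>i\<in>I. F i a b) xs ys = (\<Sum>i\<in>I. stepE q (F i) xs ys)"
proof (induction I rule: infinite_finite_induct)
  case (insert x I)
  then show ?case by (simp add: stepE_add)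
qed auto

lemma stepE_fst: "stepE q (\<lambda>a b. f a) xs ys = up_prob q xs ys * f (True # xs) + (1 - up_prob q xs ys) * f (False # xs)"
  by (simp add: stepE_def algebra_simps)

lemma stepE_snd: "stepE q (\<lambda>a b. f b) xs ys = up_prob q ys xs * f (True # ys) + (1 - up_prob q ys xs) * f (False # ys)"
  by (subst stepE_swap) (rule stepE_fst)

lemma stepE_cong:
  assumes "\<And>a b. F (a # xs) (b # ys) = G (a # xs) (b # ys)"
  shows "stepE q F xs ys = stepE q G xs ys"
  by (simp add: stepE_def assms)

lemma stepE_mono:
  assumes q: "0 \<le> q" "q \<le> 1"
    and "\<And>a b. F (a # xs) (b # ys) \<le> G (a # xs) (b # ys)"
  shows "stepE q F xs ys \<le> stepE q G xs ys"
proof -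
  have "0 \<le> up_prob q xs ys" "0 \<le> 1 - up_prob q xs ys" "0 \<le> up_prob q ys xs" "0 \<le> 1 - up_prob q ys xs"
    using up_prob_cases[of q xs ys] up_prob_cases[of q ys xs] q by auto
  then show ?thesis unfolding stepE_def using assms(3)
    by (intro add_mono mult_left_mono) auto
qed

text \<open>A pair of histories is a complete state of the process, so the Markov property is plain
  iteration and every expectation may start from an arbitrary past.\<close>

abbreviation pathE :: "real \<Rightarrow> nat \<Rightarrow> (bool list \<Rightarrow> bool list \<Rightarrow> real) \<Rightarrow> bool list \<Rightarrow> bool list \<Rightarrow> real" where
  "pathE q n F \<equiv> (stepE q ^^ n) F"

abbreviation sumE :: "real \<Rightarrow> nat \<Rightarrow> (bool list \<Rightarrow> bool list \<Rightarrow> real) \<Rightarrow> bool list \<Rightarrow> bool list \<Rightarrow> real" where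
  "sumE q n F xs ys \<equiv> (\<Sum>t<n. pathE q t F xs ys)"

lemma pathE_stepE: "pathE q n (stepE q F) = pathE q (Suc n) F"
  by (metis comp_apply funpow_Suc_right)

lemma pathE_pathE: "pathE q m (pathE q n F) = pathE q (m + n) F"
  by (simp add: funpow_add)

lemma pathE_add: "pathE q n (\<lambda>a b. F a b + G a b) xs ys = pathE q n F xs ys + pathE q n G xs ys"
proof (induction n arbitrary: xs ys)
  case (Suc n)
  have "pathE q n (\<lambda>a b. F a b + G a b) = (\<lambda>a b. pathE q n F a b + pathE q n G a b)"
    using Suc by blast
  then show ?case by (simp add: stepE_add)
qed auto

lemma pathE_cmult: "pathE q n (\<lambda>a b. c * F a b) xs ys = c * pathE q n F xs ys"
proof (induction n arbitrary: xs ys)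
  case (Suc n)
  have "pathE q n (\<lambda>a b. c * F a b) = (\<lambda>a b. c * pathE q n F a b)"
    using Suc by blast
  then show ?case by (simp add: stepE_cmult)
qed auto

lemma pathE_diff: "pathE q n (\<lambda>a b. F a b - G a b) xs ys = pathE q n F xs ys - pathE q n G xs ys"
  using pathE_add[of n q F "\<lambda>a b. (-1) * G a b" xs ys] pathE_cmult[of n q "-1" G xs ys] by simp

lemma pathE_const [simp]: "pathE q n (\<lambda>a b. c) xs ys = c"
proof (induction n arbitrary: xs ys)
  case (Suc n)
  have "pathE q n (\<lambda>a b. c) = (\<lambda>a b. c)" using Suc by blast
  then show ?case by simp
qed auto

lemma pathE_sum: "pathE q n (\<lambda>a b. \<Sum>i\<in>I. F i a b) xs ys = (\<Sum>i\<in>I. pathE q n (F i) xs ys)"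
proof (induction I rule: infinite_finite_induct)
  case (insert x I)
  then show ?case by (simp add: pathE_add)
qed auto

lemma pathE_mono:
  assumes q: "0 \<le> q" "q \<le> 1" and "\<And>a b. F a b \<le> G a b"
  shows "pathE q n F xs ys \<le> pathE q n G xs ys"
  by (induction n arbitrary: xs ys) (auto intro!: stepE_mono assms)

lemma pathE_nonneg:
  assumes q: "0 \<le> q" "q \<le> 1" and "\<And>a b. 0 \<le> F a b"
  shows "0 \<le> pathE q n F xs ys"
  using pathE_mono[OF q assms(3), where n=n and xs=xs and ys=ys] by simp

lemma pathE_swap: "pathE q n F xs ys = pathE q n (\<lambda>b a. F a b) ys xs"
proof (induction n arbitrary: xs ys)
  case (Suc n)
  have "(\<lambda>b a. pathE q n F a b) = pathE q n (\<lambda>b a. F a b)" using Suc by blast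
  then show ?case using stepE_swap[of q "pathE q n F" xs ys] by simp
qed simp

text \<open>Discrete Dynkin formula: \<open>V\<close> is an account whose mean change per step is at
  most \<open>d - c\<close>. Most estimates below consist in finding the right account.\<close>

lemma pathE_telescope:
  assumes q: "0 \<le> q" "q \<le> 1"
    and step: "\<And>a b. stepE q V a b + c a b \<le> V a b + d a b"
  shows "sumE q n c xs ys + pathE q n V xs ys \<le> V xs ys + sumE q n d xs ys"
proof (induction n)
  case (Suc n)
  have "pathE q n (stepE q V) xs ys + pathE q n c xs ys \<le> pathE q n V xs ys + pathE q n d xs ys"
    using pathE_mono[OF q step, where n=n and xs=xs and ys=ys] by (simp only: pathE_add)
  then show ?case using Suc by (simp add: pathE_stepE)
qed auto

lemma pathE_telescope_le:
  assumes q: "0 \<le> q" "q \<le> 1"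
    and step: "\<And>a b. stepE q V a b + c a b \<le> V a b + d a b"
    and "\<And>a b. 0 \<le> V a b"
  shows "sumE q n c xs ys \<le> V xs ys + sumE q n d xs ys"
  using pathE_telescope[OF q step, where n=n and xs=xs and ys=ys]
    pathE_nonneg[OF q, of V n xs ys] assms(4) by fastforce

lemma pathE_mono_len:
  assumes q: "0 \<le> q" "q \<le> 1"
    and "\<And>u w. length u = n \<Longrightarrow> length w = n \<Longrightarrow> F (u @ xs) (w @ ys) \<le> G (u @ xs) (w @ ys)"
  shows "pathE q n F xs ys \<le> pathE q n G xs ys"
  using assms(3)
proof (induction n arbitrary: xs ys)
  case (Suc n)
  have "pathE q n F (a # xs) (b # ys) \<le> pathE q n G (a # xs) (b # ys)" for a b
    using Suc.prems[of "u @ [a]" "w @ [b]" for u w] by (intro Suc.IH) simp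
  then show ?case using stepE_mono[OF q, of "pathE q n F" xs ys "pathE q n G"] by simp
qed simp

lemma mx_append_le: "mx (u @ xs) \<le> mx xs + int (length u)"
  by (induction u) auto

lemma pathE_path:
  assumes "\<And>a b. 0 \<le> F a b" and q: "1/2 \<le> q" "q \<le> p1" "p1 < 1"
    and "length u = n" "length w = n"
  shows "((1 - p1)\<^sup>2) ^ n * F (u @ xs) (w @ ys) \<le> pathE q n F xs ys"
  using assms(5,6)
proof (induction n arbitrary: u w xs ys)
  case (Suc n)
  \<comment> \<open>Lists are newest first, so the step made first is the last entry.\<close>
  obtain u' a where u: "u = u' @ [a]" using Suc.prems by (cases u rule: rev_cases) auto
  obtain w' b where w: "w = w' @ [b]" using Suc.prems by (cases w rule: rev_cases) auto
  define c where "c = ((1 - p1)\<^sup>2) ^ n * F (u @ xs) (w @ ys)"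
  have c0: "0 \<le> c" using assms(1) by (simp add: c_def)
  have c: "c \<le> pathE q n F (a # xs) (b # ys)"
    using Suc.IH[of u' w' "a # xs" "b # ys"] Suc.prems by (simp add: c_def u w)
  have nonneg_path: "0 \<le> pathE q n F x y" for x y using q assms(1) by (intro pathE_nonneg) auto
  have *: "(1 - p1)\<^sup>2 * c \<le> stepE q (\<lambda>x y. of_bool (x = a # xs \<and> y = b # ys) * c) xs ys"
  proof -
    let ?A = "up_prob q xs ys" and ?B = "up_prob q ys xs"
    have "1 - p1 \<le> ?A" "1 - p1 \<le> 1 - ?A" "1 - p1 \<le> ?B" "1 - p1 \<le> 1 - ?B"
      using up_prob_cases[of q xs ys] up_prob_cases[of q ys xs] q by auto
    then have "(1 - p1) * (1 - p1) \<le> (if a then ?A else 1 - ?A) * (if b then ?B else 1 - ?B)"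
      using q by (intro mult_mono) auto
    then have "(1 - p1)\<^sup>2 * c \<le> ((if a then ?A else 1 - ?A) * (if b then ?B else 1 - ?B)) * c"
      using c0 by (intro mult_right_mono) (auto simp: power2_eq_square)
    also have "\<dots> = stepE q (\<lambda>x y. of_bool (x = a # xs \<and> y = b # ys) * c) xs ys"
      by (cases a; cases b) (simp_all add: stepE_def)
    finally show ?thesis .
  qed
  also have "\<dots> \<le> stepE q (pathE q n F) xs ys"
    using q c nonneg_path by (intro stepE_mono) auto
  finally show ?case by (simp add: c_def mult.assoc)
qed simp

section \<open>Crossing times\<close>

locale band =
  fixes p0 p1 :: real
  assumes p0: "1/2 < p0" and p01: "p0 \<le> p1" and p1: "p1 < 1"
begin

text \<open>Odds of a step down for the smallest drift in the band, the ratio in the gambler's ruin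
  recursion.\<close>

definition r0 :: real where "r0 = (1 - p0) / p0"

lemma r0: "0 < r0" "r0 < 1" "1 / p0 \<le> 2" "0 < 1 / p0"
  using p0 p01 p1 by (auto simp: r0_def field_simps)

lemma band_q: "q \<in> {p0..p1} \<Longrightarrow> 1/2 < q" "q \<in> {p0..p1} \<Longrightarrow> q < 1"
  "q \<in> {p0..p1} \<Longrightarrow> 0 \<le> q" "q \<in> {p0..p1} \<Longrightarrow> q \<le> 1"
  using p0 p1 by auto

lemma up_prob_bounds: "q \<in> {p0..p1} \<Longrightarrow> 1/2 \<le> up_prob q xs ys" "q \<in> {p0..p1} \<Longrightarrow> up_prob q xs ys \<le> p1"
  "q \<in> {p0..p1} \<Longrightarrow> up_prob q xs ys \<le> 1" "q \<in> {p0..p1} \<Longrightarrow> 0 \<le> up_prob q xs ys"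
  using up_prob_cases[of q xs ys] p0 p01 p1 by auto

lemma stepE_mono_band: "q \<in> {p0..p1} \<Longrightarrow> (\<And>a b. F (a # xs) (b # ys) \<le> G (a # xs) (b # ys)) \<Longrightarrow> stepE q F xs ys \<le> stepE q G xs ys"
  by (intro stepE_mono) (auto simp: band_q)

text \<open>Bound for the expected time to get from \<open>z\<close> to \<open>z + 1\<close> for a walker without drift at the levels
  in \<open>f\<close> and with upward probability at least \<open>p0\<close> at the other ones, killed below \<open>0\<close>. For a
  step list, the value is \<open>0\<close> at negative levels.\<close>

primrec cross_rec :: "(int \<Rightarrow> bool) \<Rightarrow> nat \<Rightarrow> real" where
  "cross_rec f 0 = 2"
| "cross_rec f (Suc n) = (if f (int (Suc n)) then 2 + cross_rec f n else 1 / p0 + r0 * cross_rec f n)"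

definition cross :: "bool list \<Rightarrow> int \<Rightarrow> real" where
  "cross xs z = (if z < 0 then 0 else cross_rec (first_up xs) (nat z))"

lemma cross_rec_cong: "(\<And>i. 1 \<le> i \<Longrightarrow> i \<le> int n \<Longrightarrow> f i = g i) \<Longrightarrow> cross_rec f n = cross_rec g n"
  by (induction n) auto

lemma cross_rec_nonneg: "0 \<le> cross_rec f n"
  using r0 p0 by (induction n) auto

lemma cross_neg [simp]: "z < 0 \<Longrightarrow> cross xs z = 0"
  by (simp add: cross_def)

lemma cross_zero [simp]: "cross xs 0 = 2"
  by (simp add: cross_def)

lemma cross_nonneg: "0 \<le> cross xs z"
  by (simp add: cross_def cross_rec_nonneg)

lemma cross_rec: "1 \<le> z \<Longrightarrow> cross xs z = (if first_up xs z then 2 + cross xs (z - 1) else 1 / p0 + r0 * cross xs (z - 1))"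
proof -
  assume z: "1 \<le> z"
  then obtain n where n: "z = int (Suc n)" by (intro that[of "nat z - 1"]) auto
  then have "z - 1 = int n" by simp
  then show ?thesis using n by (simp add: cross_def nat_add_distrib)
qed

lemma cross_le: "0 \<le> z \<Longrightarrow> cross xs z \<le> 2 + cross xs (z - 1)"
proof -
  assume z: "0 \<le> z"
  have "r0 * cross xs (z - 1) \<le> 1 * cross xs (z - 1)"
    using r0 cross_nonneg by (intro mult_right_mono) auto
  moreover have "z = 0 \<or> 1 \<le> z" using z by auto
  ultimately show ?thesis using r0 cross_rec[of z xs] by auto
qed

text \<open>Levels up to here keep their value of \<open>first_up\<close> for ever; a maximum that
  has just been reached is still open.\<close>

definition determined :: "bool list \<Rightarrow> int" where
  "determined xs = mx xs - of_bool (new_max xs)"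

lemma cross_static: "z \<le> determined xs \<Longrightarrow> cross (b # xs) z = cross xs z"
  by (auto simp: cross_def determined_def split: if_splits intro!: cross_rec_cong)

lemma cross_static_mx: "z < mx xs \<Longrightarrow> cross (b # xs) z = cross xs z"
  by (rule cross_static) (auto simp: determined_def)

text \<open>At the maximum of \<open>ys\<close> and above no drift can be relied on, so the
  recursion of a symmetric level is applied there.\<close>

definition cross_ext :: "bool list \<Rightarrow> int \<Rightarrow> real" where
  "cross_ext ys z = (if z < mx ys then cross ys z else 2 + cross ys (z - 1))"

definition Phi :: "bool list \<Rightarrow> bool list \<Rightarrow> real" where
  "Phi xs ys = (\<Sum>z\<in>{pos xs..mx ys}. cross_ext ys z)"

lemma cross_ext_nonneg: "0 \<le> cross_ext ys z"
  by (simp add: cross_ext_def cross_nonneg)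

lemma Phi_nonneg: "0 \<le> Phi xs ys"
  by (auto simp: Phi_def intro!: sum_nonneg cross_ext_nonneg)

text \<open>When the first exit from the top level is decided, the symmetric value assumed so far
  can only turn out too large.\<close>

lemma cross_ext_Cons_le: "z \<le> mx ys \<Longrightarrow> cross_ext (b # ys) z \<le> cross_ext ys z"
proof -
  assume z: "z \<le> mx ys"
  have s: "y < mx ys \<Longrightarrow> cross (b # ys) y = cross ys y" for y by (rule cross_static_mx)
  show ?thesis
  proof (cases "z < mx ys")
    case True
    then show ?thesis using s by (auto simp: cross_ext_def)
  next
    case False
    then have "z = mx ys" using z by auto
    then show ?thesis using cross_le[of z "b # ys"] s[of "z - 1"] mx_nonneg[of ys] by (auto simp: cross_ext_def)
  qed
qed

text \<open>First-step analysis. Where the symmetric value is assumed, a fair step gives equality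
  and more drift only helps. Elsewhere the other walker has visited the level twice, so the upward
  probability is \<open>q\<close>, which is at least the \<open>p0\<close> assumed in
  \<open>cross\<close>.\<close>

lemma Phi_core:
  assumes q: "q \<in> {p0..p1}" and x: "0 \<le> pos xs" "pos xs \<le> mx ys"
  shows "- up_prob q xs ys * cross_ext ys (pos xs) + (1 - up_prob q xs ys) * cross_ext ys (pos xs - 1) \<le> -1"
proof -
  define x where "x = pos xs"
  define t where "t = cross ys (x - 1)"
  have t: "0 \<le> t" by (simp add: t_def cross_nonneg)
  have t1: "cross_ext ys (x - 1) = t" using x by (simp add: cross_ext_def t_def x_def)
  have u: "1/2 \<le> up_prob q xs ys" "up_prob q xs ys \<le> 1" using up_prob_bounds[OF q] by auto
  show ?thesis
  proof (cases "cross_ext ys x = 2 + t")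
    case True
    have "(1 - 2 * up_prob q xs ys) * t \<le> 0" using u t by (intro mult_nonpos_nonneg) auto
    then show ?thesis using True t1 u by (simp add: x_def algebra_simps)
  next
    case False
    then have xm: "x < mx ys" by (auto simp: cross_ext_def t_def split: if_splits)
    \<comment> \<open>At level \<open>0\<close> the symmetric value \<open>2 + 0\<close> always
      holds, because \<open>cross\<close> vanishes below \<open>0\<close>.\<close>
    have x1: "1 \<le> x"
    proof (rule ccontr)
      assume "\<not> 1 \<le> x"
      then have "x = 0" using x by (auto simp: x_def)
      then show False using False xm by (auto simp: cross_ext_def t_def)
    qed
    then have nb: "\<not> first_up ys x" using False xm by (auto simp: cross_ext_def t_def cross_rec)
    then have e: "up_prob q xs ys = q" using up_prob_excited[of xs ys q] x1 xm by (simp add: x_def)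
    have Tx: "cross_ext ys x = 1 / p0 + r0 * t" using xm x1 nb by (simp add: cross_ext_def cross_rec t_def)
    have "1 - q \<le> p0 * r0" using q p0 by (simp add: r0_def)
    also have "\<dots> \<le> q * r0" using q r0 by (intro mult_right_mono) auto
    finally have "(1 - q) * t \<le> q * r0 * t" using t by (intro mult_right_mono) auto
    moreover have "1 \<le> q * (1 / p0)" using q p0 by (simp add: field_simps)
    ultimately show ?thesis using t1 Tx e by (simp add: x_def algebra_simps)
  qed
qed

text \<open>The move of \<open>xs\<close> removes or adds one term at the lower end of the sum; the
  move of \<open>ys\<close> lowers the old terms and adds a term only at a new maximum.\<close>

lemma Phi_pointwise:
  assumes x: "pos xs \<le> mx ys"
  shows "Phi (a # xs) (b # ys) \<le> (Phi xs ys + (if a then - cross_ext ys (pos xs) else cross_ext ys (pos xs - 1)))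
           + of_bool (new_max (b # ys)) * cross_ext (b # ys) (mx (b # ys))"
proof -
  let ?x = "pos (a # xs)"
  have "Phi (a # xs) (b # ys) \<le> (\<Sum>z\<in>{?x..mx ys}. cross_ext (b # ys) z) + of_bool (new_max (b # ys)) * cross_ext (b # ys) (mx (b # ys))"
  proof (cases "new_max (b # ys)")
    case False
    then show ?thesis by (auto simp: Phi_def)
  next
    case True
    then have m: "mx (b # ys) = mx ys + 1" by auto
    have "{?x..mx ys + 1} \<subseteq> insert (mx ys + 1) {?x..mx ys}" by auto
    then have "Phi (a # xs) (b # ys) \<le> (\<Sum>z\<in>insert (mx ys + 1) {?x..mx ys}. cross_ext (b # ys) z)"
      unfolding Phi_def m by (intro sum_mono2) (auto simp: cross_ext_nonneg)
    then show ?thesis using True m by simp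
  qed
  also have "(\<Sum>z\<in>{?x..mx ys}. cross_ext (b # ys) z) \<le> (\<Sum>z\<in>{?x..mx ys}. cross_ext ys z)"
    by (intro sum_mono cross_ext_Cons_le) auto
  also have "(\<Sum>z\<in>{?x..mx ys}. cross_ext ys z) = Phi xs ys + (if a then - cross_ext ys (pos xs) else cross_ext ys (pos xs - 1))"
  proof (cases a)
    case True
    have "{pos xs..mx ys} = insert (pos xs) {pos xs + 1..mx ys}" using x by auto
    then show ?thesis using True by (simp add: Phi_def)
  next
    case False
    have "{pos xs - 1..mx ys} = insert (pos xs - 1) {pos xs..mx ys}" using x by auto
    then show ?thesis using False by (simp add: Phi_def)
  qed
  finally show ?thesis by simp
qed

lemma Phi_shift_nonneg:
  assumes "pos xs \<le> mx ys"
  shows "0 \<le> Phi xs ys + (if c then - cross_ext ys (pos xs) else cross_ext ys (pos xs - 1))"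
proof -
  have "cross_ext ys (pos xs) \<le> Phi xs ys"
    unfolding Phi_def using assms by (intro member_le_sum) (auto simp: cross_ext_nonneg)
  then show ?thesis using cross_ext_nonneg[of ys "pos xs - 1"] Phi_nonneg[of xs ys] by auto
qed

section \<open>Third moments of crossing times\<close>

text \<open>A level is first left downwards with probability at least \<open>1 - p1\<close>, and
  then the leading cubic term is multiplied by \<open>r0 ^ 3\<close>. Its mean factor is thus at
  most \<open>1 - 2 * contraction\<close>; one half of this margin is spent on the lower-order
  terms.\<close>

definition contraction :: real where "contraction = (1 - p1) * (1 - r0 ^ 3) / 2"
definition cubic_const :: real where "cubic_const = 18 * (max 1 (18 / contraction)) ^ 2 + 8"

lemma contraction: "0 < contraction" "contraction < 1"
proof -
  have r: "0 < r0 ^ 3" "r0 ^ 3 < 1" using r0 by (auto simp: power_less_one_iff)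
  show "0 < contraction" using r p1 by (simp add: contraction_def)
  have "(1 - p1) * (1 - r0 ^ 3) \<le> 1 * 1" using r p0 p01 p1 by (intro mult_mono) auto
  then show "contraction < 1" by (simp add: contraction_def)
qed

lemma cubic_const: "0 \<le> cubic_const"
  by (simp add: cubic_const_def)

text \<open>Expanding the cube leaves at most \<open>6 t^2 + 12 t + 8\<close>. Beyond
  \<open>18 / contraction\<close> the quadratic and linear terms are below
  \<open>contraction * t ^ 3\<close>, and before that they are bounded; this is the origin of
  \<open>cubic_const\<close>.\<close>

lemma cubic: "0 \<le> t \<Longrightarrow> 0 \<le> s \<Longrightarrow> s \<le> 1 \<Longrightarrow> (2 + s * t) ^ 3 \<le> s ^ 3 * t ^ 3 + contraction * t ^ 3 + cubic_const"
proof -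
  assume t: "0 \<le> t" and s: "0 \<le> s" "s \<le> 1"
  have e: "(2 + s * t) ^ 3 = s ^ 3 * t ^ 3 + 6 * (s * t) ^ 2 + 12 * (s * t) + 8"
    by (simp add: power3_eq_cube power2_eq_square algebra_simps)
  have stepE: "s * t \<le> t" "0 \<le> s * t" using t s by (auto simp: mult_left_le_one_le)
  then have st2: "(s * t) ^ 2 \<le> t ^ 2" by (rule power_mono)
  define K where "K = max 1 (18 / contraction)"
  have K: "1 \<le> K" "18 / contraction \<le> K" by (auto simp: K_def)
  have "6 * t ^ 2 + 12 * t \<le> contraction * t ^ 3 + 18 * K ^ 2"
  proof (cases "t \<le> K")
    case True
    have "t ^ 2 \<le> K ^ 2" using t True by (intro power_mono) auto
    moreover have "t \<le> K ^ 2" using True K by (smt (verit) power2_eq_square mult_left_mono mult_cancel_left2)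
    moreover have "0 \<le> contraction * t ^ 3" using t contraction by simp
    ultimately show ?thesis by linarith
  next
    case False
    then have "18 / contraction \<le> t" "1 \<le> t" using K by auto
    then have a: "18 \<le> contraction * t" using contraction by (simp add: field_simps)
    have "t \<le> t ^ 2" using \<open>1 \<le> t\<close> by (simp add: power2_eq_square)
    then have "6 * t ^ 2 + 12 * t \<le> 18 * t ^ 2" by simp
    also have "\<dots> \<le> (contraction * t) * t ^ 2" using a by (intro mult_right_mono) auto
    also have "\<dots> = contraction * t ^ 3" by (simp add: power3_eq_cube power2_eq_square)
    finally show ?thesis by (smt (verit) zero_le_power2)
  qed
  moreover have "6 * (s * t) ^ 2 + 12 * (s * t) \<le> 6 * t ^ 2 + 12 * t" using stepE st2 by linarith
  moreover have "cubic_const = 18 * K ^ 2 + 8" by (simp add: cubic_const_def K_def)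
  ultimately show ?thesis using e by linarith
qed

lemma cubic_mean:
  assumes "0 \<le> t" "0 \<le> u" "u \<le> p1"
  shows "u * (2 + t) ^ 3 + (1 - u) * (1 / p0 + r0 * t) ^ 3 \<le> (1 - contraction) * t ^ 3 + cubic_const"
proof -
  have 1: "(2 + t) ^ 3 \<le> t ^ 3 + contraction * t ^ 3 + cubic_const" using cubic[of t 1] assms by simp
  have "(1 / p0 + r0 * t) ^ 3 \<le> (2 + r0 * t) ^ 3" using r0 assms by (intro power_mono) auto
  also have "\<dots> \<le> r0 ^ 3 * t ^ 3 + contraction * t ^ 3 + cubic_const" using cubic[of t r0] assms r0 by simp
  finally have 2: "(1 / p0 + r0 * t) ^ 3 \<le> r0 ^ 3 * t ^ 3 + contraction * t ^ 3 + cubic_const" .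
  have "u * (2 + t) ^ 3 + (1 - u) * (1 / p0 + r0 * t) ^ 3
      \<le> u * (t ^ 3 + contraction * t ^ 3 + cubic_const) + (1 - u) * (r0 ^ 3 * t ^ 3 + contraction * t ^ 3 + cubic_const)"
    using 1 2 assms p1 by (intro add_mono mult_left_mono) auto
  also have "\<dots> = (r0 ^ 3 + u * (1 - r0 ^ 3) + contraction) * t ^ 3 + cubic_const" by (simp add: algebra_simps)
  also have "\<dots> \<le> (1 - contraction) * t ^ 3 + cubic_const"
  proof -
    have "u * (1 - r0 ^ 3) \<le> p1 * (1 - r0 ^ 3)" using assms r0 by (intro mult_right_mono) (auto simp: power_le_one)
    then have "r0 ^ 3 + u * (1 - r0 ^ 3) + contraction \<le> 1 - contraction" by (simp add: contraction_def algebra_simps)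
    then show ?thesis using assms by (intro add_mono mult_right_mono) auto
  qed
  finally show ?thesis .
qed

definition cube_mean :: real where "cube_mean = cubic_const / contraction"

text \<open>At levels \<open>z\<close> that are not yet determined, \<open>cube_bound z xs\<close> predicts the third moment of the
  crossing time of \<open>z\<close>: each further level contracts towards \<open>cube_mean\<close>.\<close>

definition cube_bound :: "int \<Rightarrow> bool list \<Rightarrow> real" where
  "cube_bound z xs = (1 - contraction) ^ nat (z - determined xs) * (cross xs (min z (determined xs)) ^ 3 - cube_mean) + cube_mean"

lemma cube_mean: "0 \<le> cube_mean" "cubic_const = contraction * cube_mean"
  using cubic_const contraction by (auto simp: cube_mean_def)

lemma cube_bound_determined: "z \<le> determined xs \<Longrightarrow> cube_bound z xs = cross xs z ^ 3"
  by (simp add: cube_bound_def)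

lemma cube_bound_bounds: "0 \<le> cube_bound z xs" "cube_bound z xs \<le> cross xs (min z (determined xs)) ^ 3 + cube_mean"
proof -
  define k where "k = nat (z - determined xs)"
  define x where "x = cross xs (min z (determined xs)) ^ 3"
  have x: "0 \<le> x" by (simp add: x_def cross_nonneg)
  have k: "0 \<le> (1 - contraction) ^ k" "(1 - contraction) ^ k \<le> 1" using contraction by (auto intro: power_le_one)
  have e: "cube_bound z xs = (1 - contraction) ^ k * x + (1 - (1 - contraction) ^ k) * cube_mean" by (simp add: cube_bound_def k_def x_def algebra_simps)
  show "0 \<le> cube_bound z xs" unfolding e using k x cube_mean by (intro add_nonneg_nonneg mult_nonneg_nonneg) auto
  have "(1 - contraction) ^ k * x \<le> 1 * x" using k x by (intro mult_right_mono) auto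
  moreover have "(1 - (1 - contraction) ^ k) * cube_mean \<le> 1 * cube_mean" using k cube_mean by (intro mult_right_mono) auto
  ultimately show "cube_bound z xs \<le> cross xs (min z (determined xs)) ^ 3 + cube_mean" using e by (simp add: x_def)
qed

text \<open>The prediction is a supermartingale. It moves only when the first exit from a new
  maximum at or below \<open>z\<close> is decided, and then a real contraction replaces one of the
  predicted ones.\<close>

lemma cube_bound_step:
  assumes q: "q \<in> {p0..p1}"
  shows "stepE q (\<lambda>a b. cube_bound z b) xs ys \<le> cube_bound z ys"
proof -
  have "up_prob q ys xs * cube_bound z (True # ys) + (1 - up_prob q ys xs) * cube_bound z (False # ys) \<le> cube_bound z ys"
  proof (cases "new_max ys \<and> mx ys \<le> z")
    case False
    have "cube_bound z (b # ys) = cube_bound z ys" for b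
    proof (cases "new_max ys")
      case True
      then have "z \<le> determined ys" "determined ys \<le> determined (b # ys)" using False new_max_imp[of ys] by (auto simp: determined_def)
      then show ?thesis by (simp add: cube_bound_determined cross_static)
    next
      case nonneg_path: False
      then have "determined (b # ys) = determined ys" by (auto simp: determined_def)
      then show ?thesis by (simp add: cube_bound_def cross_static)
    qed
    then show ?thesis by (simp add: algebra_simps)
  next
    case True
    define m where "m = mx ys"
    define k where "k = nat (z - m)"
    define t where "t = cross ys (m - 1)"
    have m: "pos ys = m" "1 \<le> m" "new_max ys" "m \<le> z" using new_max_imp[of ys] True by (auto simp: m_def)
    have d: "determined ys = m - 1" "determined (b # ys) = m" for b using m by (auto simp: determined_def m_def)
    have e: "nat (z - (m - 1)) = Suc k" using m by (auto simp: k_def)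
    have Tm: "cross (b # ys) m = (if b then 2 + t else 1 / p0 + r0 * t)" for b
    proof -
      have e1: "cross (b # ys) (m - 1) = t" unfolding t_def using d by (intro cross_static) auto
      have "first_up (b # ys) m = b" using m by (simp add: m_def)
      then show ?thesis by (subst cross_rec[OF m(2)]) (simp only: e1)
    qed
    have g: "cube_bound z (b # ys) = (1 - contraction) ^ k * ((if b then 2 + t else 1 / p0 + r0 * t) ^ 3 - cube_mean) + cube_mean" for b
      using m d Tm by (simp add: cube_bound_def k_def min_def)
    have g0: "cube_bound z ys = (1 - contraction) ^ k * ((1 - contraction) * (t ^ 3 - cube_mean)) + cube_mean"
      using m d e by (simp add: cube_bound_def t_def min_def)
    let ?u = "up_prob q ys xs"
    have "?u * cube_bound z (True # ys) + (1 - ?u) * cube_bound z (False # ys)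
        = (1 - contraction) ^ k * ((?u * (2 + t) ^ 3 + (1 - ?u) * (1 / p0 + r0 * t) ^ 3) - cube_mean) + cube_mean"
      unfolding g by (simp add: algebra_simps)
    also have "\<dots> \<le> (1 - contraction) ^ k * (((1 - contraction) * t ^ 3 + cubic_const) - cube_mean) + cube_mean"
      using cubic_mean[of t ?u] up_prob_bounds[OF q, of ys xs] contraction cross_nonneg[of ys "m - 1"]
      by (intro add_right_mono mult_left_mono diff_right_mono) (auto simp: t_def)
    also have "\<dots> = cube_bound z ys" unfolding g0 using cube_mean by (simp add: algebra_simps)
    finally show ?thesis .
  qed
  then show ?thesis by (simp add: stepE_snd)
qed

text \<open>The weights come from thresholds proportional to \<open>M + (m - z)\<close> in
  \<open>cross_young\<close>.\<close>

definition cube_sum :: "real \<Rightarrow> int \<Rightarrow> bool list \<Rightarrow> real" where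
  "cube_sum M m ys = (\<Sum>z\<in>{0..m - 1}. cross ys z ^ 3 / (M + of_int (m - z)) ^ 2)"

definition cube_bound_sum :: "real \<Rightarrow> int \<Rightarrow> bool list \<Rightarrow> real" where
  "cube_bound_sum M m ys = (\<Sum>z\<in>{0..m - 1}. cube_bound z ys / (M + of_int (m - z)) ^ 2)"

lemma cube_sum_nonneg: "0 \<le> cube_sum M m ys"
  by (auto simp: cube_sum_def cross_nonneg intro!: sum_nonneg divide_nonneg_nonneg)

lemma cube_bound_sum_nonneg: "0 \<le> cube_bound_sum M m ys"
  by (auto simp: cube_bound_sum_def intro!: sum_nonneg divide_nonneg_nonneg cube_bound_bounds)

lemma cube_bound_sum_eq: "m - 1 \<le> determined ys \<Longrightarrow> cube_bound_sum M m ys = cube_sum M m ys"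
  by (auto simp: cube_bound_sum_def cube_sum_def cube_bound_determined intro!: sum.cong)

lemma cube_bound_sum_eq_mx: "m \<le> mx ys \<Longrightarrow> cube_bound_sum M m ys = cube_sum M m ys"
  by (rule cube_bound_sum_eq) (auto simp: determined_def)

lemma cube_bound_sum_step:
  assumes q: "q \<in> {p0..p1}"
  shows "stepE q (\<lambda>a b. cube_bound_sum M m b) xs ys \<le> cube_bound_sum M m ys"
  unfolding cube_bound_sum_def stepE_sum stepE_divc
  by (intro sum_mono divide_right_mono cube_bound_step[OF q]) auto

lemma inverse_squares: "0 \<le> M \<Longrightarrow> (\<Sum>z\<in>{0..m - 1}. 1 / (M + real_of_int (m - z)) ^ 2) \<le> 2 / (M + 1)"
proof -
  assume M: "0 \<le> M"
  have ind: "(\<Sum>i<n. 1 / (M + 1 + real i) ^ 2) \<le> 2 / (M + 1) - 2 / (M + 1 + real n)" for n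
  proof (induction n)
    case (Suc n)
    define k where "k = M + 1 + real n"
    have k: "1 \<le> k" using M by (simp add: k_def)
    have "1 / k ^ 2 \<le> 2 / k - 2 / (k + 1)"
    proof -
      have "2 / k - 2 / (k + 1) = 2 / (k * (k + 1))" using k by (simp add: field_simps)
      also have "\<dots> \<ge> 2 / (k * (2 * k))" using k by (intro divide_left_mono mult_left_mono) auto
      finally show ?thesis using k by (simp add: power2_eq_square)
    qed
    then show ?case using Suc by (simp add: k_def algebra_simps)
  qed simp
  have "(\<Sum>z\<in>{0..m - 1}. 1 / (M + real_of_int (m - z)) ^ 2) = (\<Sum>i<nat m. 1 / (M + 1 + real i) ^ 2)"
    by (rule sum.reindex_bij_witness[of _ "\<lambda>i. m - 1 - int i" "\<lambda>z. nat (m - 1 - z)"])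
       (auto simp: algebra_simps)
  also have "\<dots> \<le> 2 / (M + 1) - 2 / (M + 1 + real (nat m))" by (rule ind)
  also have "\<dots> \<le> 2 / (M + 1)" using M by simp
  finally show ?thesis .
qed

lemma cube_bound_sum_bound:
  assumes M: "0 \<le> M" and c: "\<And>z. cube_bound z ys \<le> c"
  shows "cube_bound_sum M m ys \<le> c * (2 / (M + 1))"
proof -
  have "cube_bound_sum M m ys \<le> (\<Sum>z\<in>{0..m - 1}. c * (1 / (M + real_of_int (m - z)) ^ 2))"
    unfolding cube_bound_sum_def by (intro sum_mono) (simp add: divide_right_mono[OF c])
  also have "\<dots> = c * (\<Sum>z\<in>{0..m - 1}. 1 / (M + real_of_int (m - z)) ^ 2)"
    by (simp add: sum_distrib_left)
  also have "\<dots> \<le> c * (2 / (M + 1))"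
    using inverse_squares[OF M] c[of 0] cube_bound_bounds(1)[of 0 ys] by (intro mult_left_mono) auto
  finally show ?thesis .
qed

lemma cube_bound_Nil: "cube_bound z [] \<le> 8 + cube_mean"
proof -
  have "cross [] (min z (determined [])) \<le> 2" by (cases "min z 0 < 0") (auto simp: determined_def min_def)
  then have "cross [] (min z (determined [])) ^ 3 \<le> 2 ^ 3" by (intro power_mono) (auto simp: cross_nonneg)
  then show ?thesis using cube_bound_bounds(2)[of z "[]"] by simp
qed

text \<open>Until \<open>m\<close> is reached, the account holds the predicted value. On arrival all
  levels below \<open>m\<close> are determined, the prediction is exact, and it pays the
  charge.\<close>

lemma charge_step:
  assumes q: "q \<in> {p0..p1}"
  shows "stepE q (\<lambda>a b. of_bool (mx b < m) * cube_bound_sum M m b + of_bool (new_max b \<and> mx b = m) * cube_sum M m b) xs ys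
    \<le> of_bool (mx ys < m) * cube_bound_sum M m ys"
proof -
  have "stepE q (\<lambda>a b. of_bool (mx b < m) * cube_bound_sum M m b + of_bool (new_max b \<and> mx b = m) * cube_sum M m b) xs ys
    \<le> stepE q (\<lambda>a b. of_bool (mx ys < m) * cube_bound_sum M m b) xs ys"
    by (intro stepE_mono_band[OF q]) (auto simp: cube_bound_sum_eq_mx cube_sum_nonneg cube_bound_sum_nonneg)
  also have "\<dots> \<le> of_bool (mx ys < m) * cube_bound_sum M m ys"
    unfolding stepE_cmult by (intro mult_left_mono cube_bound_sum_step[OF q]) auto
  finally show ?thesis .
qed

lemma charge_sum:
  assumes q: "q \<in> {p0..p1}"
  shows "sumE q n (stepE q (\<lambda>a b. of_bool (new_max b \<and> mx b = m) * cube_sum M m b)) xs ys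
    \<le> of_bool (mx ys < m) * cube_bound_sum M m ys"
  using pathE_telescope_le[of q "\<lambda>a b. of_bool (mx b < m) * cube_bound_sum M m b"
      "stepE q (\<lambda>a b. of_bool (new_max b \<and> mx b = m) * cube_sum M m b)" "\<lambda>_ _. 0", where n=n and xs=xs and ys=ys]
    charge_step[OF q] q by (simp add: band_q cube_bound_sum_nonneg stepE_add)

end

section \<open>Two walkers and exchanges of roles\<close>

definition alive :: "bool list \<Rightarrow> bool list \<Rightarrow> bool" where
  "alive xs ys \<longleftrightarrow> nonneg_path xs \<and> nonneg_path ys \<and> length xs = length ys"

lemma alive_swap: "alive xs ys \<longleftrightarrow> alive ys xs"
  by (auto simp: alive_def)

lemma alive_pos: "alive xs ys \<Longrightarrow> 0 \<le> pos xs" "alive xs ys \<Longrightarrow> 0 \<le> pos ys"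
  by (auto simp: alive_def nonneg_path_pos)

lemma alive_Cons: "alive (a # xs) (b # ys) \<Longrightarrow> alive xs ys"
  by (auto simp: alive_def)

lemma alive_Nil [simp]: "alive [] []"
  by (simp add: alive_def)

definition lower :: "bool list \<Rightarrow> bool list \<Rightarrow> bool list" where
  "lower xs ys = (if mx xs \<le> mx ys then xs else ys)"

definition upper :: "bool list \<Rightarrow> bool list \<Rightarrow> bool list" where
  "upper xs ys = (if mx xs \<le> mx ys then ys else xs)"

definition peak :: "bool list \<Rightarrow> bool list \<Rightarrow> int" where
  "peak xs ys = max (mx xs) (mx ys)"

lemma mx_upper: "mx (upper xs ys) = peak xs ys" "mx (lower xs ys) \<le> peak xs ys"
  by (auto simp: upper_def lower_def peak_def)

lemma peak_step: "peak xs ys \<le> peak (a # xs) (b # ys)" "peak (a # xs) (b # ys) \<le> peak xs ys + 1"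
  by (auto simp: peak_def)

lemma peak_nonneg: "0 \<le> peak xs ys"
  using mx_nonneg[of xs] by (simp add: peak_def)

definition deficit :: "bool list \<Rightarrow> int" where "deficit xs = mx xs - pos xs"

definition excess :: "bool list \<Rightarrow> bool list \<Rightarrow> int" where "excess xs ys = max 0 (pos xs - mx ys)"

text \<open>The four terms together control the distance of both walkers from the overall maximum,
  and each of them separately has mean increment at most one.\<close>

definition spread :: "bool list \<Rightarrow> bool list \<Rightarrow> real" where
  "spread xs ys = of_int ((deficit xs)\<^sup>2 + (deficit ys)\<^sup>2 + (excess xs ys)\<^sup>2 + (excess ys xs)\<^sup>2)"

definition upper_sq :: "bool list \<Rightarrow> bool list \<Rightarrow> real" where
  "upper_sq xs ys = of_int ((deficit (upper xs ys))\<^sup>2)"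

definition swapped :: "bool list \<Rightarrow> bool list \<Rightarrow> bool list \<Rightarrow> bool list \<Rightarrow> bool" where
  "swapped xs ys a b \<longleftrightarrow> (mx xs \<le> mx ys) \<noteq> (mx a \<le> mx b)"

lemma deficit_nonneg: "0 \<le> deficit xs"
  using pos_le_mx[of xs] by (simp add: deficit_def)

text \<open>A maximum grows by at most one per step, so roles can change only when the walker with
  the lower maximum steps onto a new level, level with the other maximum or one above it.\<close>

lemma swapped_facts:
  assumes "swapped xs ys (a # xs) (b # ys)"
  shows "new_max (upper (a # xs) (b # ys))" "mx (upper (a # xs) (b # ys)) \<le> mx (lower (a # xs) (b # ys)) + 1"
    "deficit (upper (a # xs) (b # ys)) = 0"
proof -
  define A B where "A = a # xs" and "B = b # ys"
  define i j :: int where "i = of_bool (new_max A)" and "j = of_bool (new_max B)"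
  have m: "mx A = mx xs + i" "mx B = mx ys + j" unfolding A_def B_def i_def j_def by (rule mx_Cons_new_max)+
  have ij: "i \<in> {0, 1}" "j \<in> {0, 1}" by (auto simp: i_def j_def)
  have c: "(mx xs \<le> mx ys) \<noteq> (mx A \<le> mx B)" using assms unfolding swapped_def A_def B_def .
  have n: "new_max (upper A B) \<and> mx (upper A B) \<le> mx (lower A B) + 1"
  proof (cases "mx A \<le> mx B")
    case True
    then have "j = 1" "mx B \<le> mx A + 1" using m ij c by auto
    then show ?thesis using True by (auto simp: j_def upper_def lower_def)
  next
    case False
    then have "i = 1" "mx A \<le> mx B + 1" using m ij c by auto
    then show ?thesis using False by (auto simp: i_def upper_def lower_def)
  qed
  then show "new_max (upper (a # xs) (b # ys))" "mx (upper (a # xs) (b # ys)) \<le> mx (lower (a # xs) (b # ys)) + 1"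
    unfolding A_def B_def by blast+
  then show "deficit (upper (a # xs) (b # ys)) = 0"
    using new_max_imp[of "upper (a # xs) (b # ys)"] by (simp only: deficit_def)
qed

lemma swapped_window:
  assumes "swapped xs ys (a # xs) (b # ys)"
  shows "peak (a # xs) (b # ys) - pos (lower (a # xs) (b # ys)) \<le> deficit (lower (a # xs) (b # ys)) + 1"
  using swapped_facts[OF assms] by (simp add: deficit_def mx_upper)

context band
begin

text \<open>Below its maximum the walker has no drift away from it; at the maximum the deficit
  becomes \<open>0\<close> or \<open>1\<close>.\<close>

lemma deficit_step:
  assumes q: "q \<in> {p0..p1}"
  shows "stepE q (\<lambda>a b. of_int ((deficit a)\<^sup>2)) xs ys \<le> of_int ((deficit xs)\<^sup>2) + 1"
proof (cases "deficit xs = 0")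
  case True
  then have "deficit (True # xs) = 0" "deficit (False # xs) = 1" by (auto simp: deficit_def)
  then show ?thesis using True up_prob_bounds[OF q, of xs ys] by (simp add: stepE_fst)
next
  case False
  define y :: real where "y = of_int (deficit xs)"
  have y: "1 \<le> y" using False deficit_nonneg[of xs] by (simp add: y_def)
  have "real_of_int (deficit (True # xs)) = y - 1" "real_of_int (deficit (False # xs)) = y + 1"
    using False by (auto simp: deficit_def y_def)
  then have "stepE q (\<lambda>a b. of_int ((deficit a)\<^sup>2)) xs ys = up_prob q xs ys * (y - 1)\<^sup>2 + (1 - up_prob q xs ys) * (y + 1)\<^sup>2"
    by (simp add: stepE_fst)
  also have "\<dots> = y\<^sup>2 + 1 + 2 * y * (1 - 2 * up_prob q xs ys)" by (simp add: power2_eq_square algebra_simps)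
  also have "\<dots> \<le> y\<^sup>2 + 1"
    using y up_prob_bounds[OF q, of xs ys] by (auto intro!: mult_nonneg_nonpos)
  finally show ?thesis by (simp add: y_def)
qed

text \<open>Above the maximum of the other walker steps are fair, so the square gains one on
  average; growth of the other maximum only reduces the excess.\<close>

lemma excess_step:
  assumes q: "q \<in> {p0..p1}"
  shows "stepE q (\<lambda>a b. of_int ((excess a b)\<^sup>2)) xs ys \<le> of_int ((excess xs ys)\<^sup>2) + 1"
proof -
  have "stepE q (\<lambda>a b. of_int ((excess a b)\<^sup>2)) xs ys \<le> stepE q (\<lambda>a b. of_int ((excess a ys)\<^sup>2)) xs ys"
    by (intro stepE_mono_band[OF q]) (auto simp: excess_def intro!: power_mono)
  also have "\<dots> = up_prob q xs ys * of_int ((excess (True # xs) ys)\<^sup>2) + (1 - up_prob q xs ys) * of_int ((excess (False # xs) ys)\<^sup>2)"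
    by (rule stepE_fst)
  also have "\<dots> \<le> of_int ((excess xs ys)\<^sup>2) + 1"
  proof (cases "mx ys < pos xs")
    case True
    define z :: real where "z = of_int (excess xs ys)"
    have "real_of_int (excess (True # xs) ys) = z + 1" "real_of_int (excess (False # xs) ys) = z - 1"
      using True by (auto simp: excess_def z_def)
    then have "real_of_int ((excess (True # xs) ys)\<^sup>2) = (z + 1)\<^sup>2" "real_of_int ((excess (False # xs) ys)\<^sup>2) = (z - 1)\<^sup>2"
      "real_of_int ((excess xs ys)\<^sup>2) = z\<^sup>2" by (simp_all add: z_def)
    then show ?thesis unfolding up_prob_above[OF True, of q] by (simp only:) (simp add: power2_eq_square field_simps)
  next
    case False
    then have "excess (True # xs) ys \<in> {0, 1}" "excess (False # xs) ys = 0" "excess xs ys = 0" by (auto simp: excess_def)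
    then show ?thesis using up_prob_bounds[OF q, of xs ys] by auto
  qed
  finally show ?thesis .
qed

lemma spread_step:
  assumes q: "q \<in> {p0..p1}"
  shows "stepE q spread xs ys \<le> spread xs ys + 4"
proof -
  have "stepE q (\<lambda>a b. of_int ((deficit b)\<^sup>2)) xs ys \<le> of_int ((deficit ys)\<^sup>2) + 1"
    using deficit_step[OF q, of ys xs] by (subst stepE_swap)
  moreover have "stepE q (\<lambda>a b. of_int ((excess b a)\<^sup>2)) xs ys \<le> of_int ((excess ys xs)\<^sup>2) + 1"
    using excess_step[OF q, of ys xs] by (subst stepE_swap)
  moreover have "stepE q spread xs ys = stepE q (\<lambda>a b. of_int ((deficit a)\<^sup>2)) xs ys + stepE q (\<lambda>a b. of_int ((deficit b)\<^sup>2)) xs ys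
     + stepE q (\<lambda>a b. of_int ((excess a b)\<^sup>2)) xs ys + stepE q (\<lambda>a b. of_int ((excess b a)\<^sup>2)) xs ys"
    by (simp add: spread_def[abs_def] stepE_add)
  ultimately show ?thesis using deficit_step[OF q, of xs ys] excess_step[OF q, of xs ys]
    by (simp add: spread_def)
qed

text \<open>An exchange resets the squared deficit of the leader to \<open>0\<close>. The released
  amount is the squared deficit of the former leader, who is now the lower walker, and it can be
  spent on the cost of the exchange.\<close>

lemma upper_sq_step:
  assumes q: "q \<in> {p0..p1}"
  shows "stepE q (\<lambda>a b. upper_sq a b + of_bool (swapped xs ys a b) * of_int ((deficit (lower a b))\<^sup>2)) xs ys \<le> upper_sq xs ys + 1"
proof (cases "mx xs \<le> mx ys")
  case True
  have "stepE q (\<lambda>a b. upper_sq a b + of_bool (swapped xs ys a b) * of_int ((deficit (lower a b))\<^sup>2)) xs ys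
     \<le> stepE q (\<lambda>a b. of_int ((deficit b)\<^sup>2)) xs ys"
  proof (rule stepE_mono_band[OF q])
    fix a b
    show "upper_sq (a # xs) (b # ys) + of_bool (swapped xs ys (a # xs) (b # ys)) * of_int ((deficit (lower (a # xs) (b # ys)))\<^sup>2)
       \<le> real_of_int ((deficit (b # ys))\<^sup>2)"
    proof (cases "swapped xs ys (a # xs) (b # ys)")
      case c: True
      then have "lower (a # xs) (b # ys) = b # ys" using True by (simp add: swapped_def lower_def)
      then show ?thesis using c swapped_facts(3)[OF c] by (simp add: upper_sq_def)
    next
      case c: False
      then have "upper (a # xs) (b # ys) = b # ys" using True by (simp add: swapped_def upper_def)
      then show ?thesis using c by (simp add: upper_sq_def)
    qed
  qed
  also have "\<dots> \<le> of_int ((deficit ys)\<^sup>2) + 1" using deficit_step[OF q, of ys xs] by (subst stepE_swap)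
  finally show ?thesis using True by (simp add: upper_sq_def upper_def)
next
  case False
  have "stepE q (\<lambda>a b. upper_sq a b + of_bool (swapped xs ys a b) * of_int ((deficit (lower a b))\<^sup>2)) xs ys
     \<le> stepE q (\<lambda>a b. of_int ((deficit a)\<^sup>2)) xs ys"
  proof (rule stepE_mono_band[OF q])
    fix a b
    show "upper_sq (a # xs) (b # ys) + of_bool (swapped xs ys (a # xs) (b # ys)) * of_int ((deficit (lower (a # xs) (b # ys)))\<^sup>2)
       \<le> real_of_int ((deficit (a # xs))\<^sup>2)"
    proof (cases "swapped xs ys (a # xs) (b # ys)")
      case c: True
      then have "lower (a # xs) (b # ys) = a # xs" using False by (simp add: swapped_def lower_def)
      then show ?thesis using c swapped_facts(3)[OF c] by (simp add: upper_sq_def)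
    next
      case c: False
      then have "upper (a # xs) (b # ys) = a # xs" using False by (simp add: swapped_def upper_def)
      then show ?thesis using c by (simp add: upper_sq_def)
    qed
  qed
  also have "\<dots> \<le> of_int ((deficit xs)\<^sup>2) + 1" by (rule deficit_step[OF q])
  finally show ?thesis using False by (simp add: upper_sq_def upper_def)
qed

text \<open>If the other walker holds the overall maximum, the way from \<open>pos xs\<close> up to
  it is covered by three pieces: to the own maximum, on to the position of the other walker, on to
  the maximum of that walker. The factor \<open>3\<close> is Cauchy-Schwarz.\<close>

lemma peak_minus_pos:
  "(real_of_int (peak xs ys - pos xs))\<^sup>2 \<le> 3 * spread xs ys" "(real_of_int (peak xs ys - pos ys))\<^sup>2 \<le> 3 * spread xs ys"
proof -
  have sq: "(real_of_int w)\<^sup>2 \<le> 3 * (real_of_int a ^ 2 + real_of_int b ^ 2 + real_of_int c ^ 2)"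
    if "0 \<le> w" "w \<le> a + b + c" for w a b c
  proof -
    have "(real_of_int w)\<^sup>2 \<le> (real_of_int (a + b + c))\<^sup>2" using that by (intro power_mono) auto
    also have "\<dots> \<le> 3 * (real_of_int a ^ 2 + real_of_int b ^ 2 + real_of_int c ^ 2)"
      using zero_le_power2[of "real_of_int a - real_of_int b"] zero_le_power2[of "real_of_int b - real_of_int c"]
        zero_le_power2[of "real_of_int c - real_of_int a"]
      by (simp add: power2_eq_square algebra_simps)
    finally show ?thesis .
  qed
  have key: "(real_of_int (peak xs ys - pos xs))\<^sup>2 \<le> 3 * spread xs ys" for xs ys
  proof -
    have "0 \<le> peak xs ys - pos xs" "peak xs ys - pos xs \<le> deficit xs + deficit ys + excess ys xs"
      using pos_le_mx[of xs] pos_le_mx[of ys] by (auto simp: peak_def deficit_def excess_def)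
    from sq[OF this] show ?thesis
      by (rule order_trans) (simp add: spread_def)
  qed
  show "(real_of_int (peak xs ys - pos xs))\<^sup>2 \<le> 3 * spread xs ys" by (rule key)
  have "peak xs ys = peak ys xs" "spread xs ys = spread ys xs" by (auto simp: peak_def spread_def)
  then show "(real_of_int (peak xs ys - pos ys))\<^sup>2 \<le> 3 * spread xs ys" using key[of ys xs] by simp
qed

lemma spread_nonneg: "0 \<le> spread xs ys"
  by (simp add: spread_def)

definition potential :: "bool list \<Rightarrow> bool list \<Rightarrow> real" where
  "potential xs ys = Phi (lower xs ys) (upper xs ys)"

lemma potential_nonneg: "0 \<le> potential xs ys"
  by (simp add: potential_def Phi_nonneg)

lemma Phi_alive_step:
  assumes q: "q \<in> {p0..p1}" and alive_ind: "alive xs ys" and le: "mx xs \<le> mx ys"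
  shows "stepE q (\<lambda>a b. of_bool (alive a b) * Phi a b) xs ys + 1
    \<le> Phi xs ys + stepE q (\<lambda>a b. of_bool (alive a b \<and> new_max b) * cross_ext b (mx b)) xs ys"
proof -
  have x: "0 \<le> pos xs" "pos xs \<le> mx ys" using alive_pos[OF alive_ind] pos_le_mx[of xs] le by auto
  define f where "f = (\<lambda>a. Phi xs ys + (if hd a then - cross_ext ys (pos xs) else cross_ext ys (pos xs - 1)))"
  have f: "0 \<le> f (a # xs)" for a using Phi_shift_nonneg[OF x(2), of a] by (simp add: f_def)
  have "stepE q (\<lambda>a b. of_bool (alive a b) * Phi a b) xs ys
     \<le> stepE q (\<lambda>a b. f a + of_bool (alive a b \<and> new_max b) * cross_ext b (mx b)) xs ys"
  proof (rule stepE_mono_band[OF q])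
    fix a b
    have "Phi (a # xs) (b # ys) \<le> f (a # xs) + of_bool (new_max (b # ys)) * cross_ext (b # ys) (mx (b # ys))"
      using Phi_pointwise[OF x(2), of a b] by (simp add: f_def)
    then show "of_bool (alive (a # xs) (b # ys)) * Phi (a # xs) (b # ys)
      \<le> f (a # xs) + of_bool (alive (a # xs) (b # ys) \<and> new_max (b # ys)) * cross_ext (b # ys) (mx (b # ys))"
      using f[of a] by (cases "alive (a # xs) (b # ys)") (simp_all del: new_max.simps mx.simps)
  qed
  also have "\<dots> = stepE q (\<lambda>a b. f a) xs ys + stepE q (\<lambda>a b. of_bool (alive a b \<and> new_max b) * cross_ext b (mx b)) xs ys"
    by (rule stepE_add)
  also have "stepE q (\<lambda>a b. f a) xs ys = Phi xs ys + (- up_prob q xs ys * cross_ext ys (pos xs) + (1 - up_prob q xs ys) * cross_ext ys (pos xs - 1))"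
    by (subst stepE_fst) (simp add: f_def algebra_simps)
  finally show ?thesis using Phi_core[OF q x] by linarith
qed

text \<open>\<open>u\<close> is the walker that led before the step; only its new levels lengthen
  the way of the other one.\<close>

definition gain :: "bool list \<Rightarrow> bool list \<Rightarrow> bool list \<Rightarrow> bool list \<Rightarrow> real" where
  "gain xs ys a b = (let u = (if mx xs \<le> mx ys then b else a) in of_bool (alive a b \<and> new_max u) * cross_ext u (mx u))"

text \<open>After an exchange the old sum says nothing about the new one, so the new potential is
  charged in full.\<close>

definition swap_cost :: "bool list \<Rightarrow> bool list \<Rightarrow> bool list \<Rightarrow> bool list \<Rightarrow> real" where
  "swap_cost xs ys a b = of_bool (alive a b \<and> swapped xs ys a b) * potential a b"

lemma gain_nonneg: "0 \<le> gain xs ys a b" and swap_cost_nonneg: "0 \<le> swap_cost xs ys a b"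
  by (auto simp: gain_def swap_cost_def Let_def cross_ext_nonneg potential_nonneg)

lemma potential_step:
  assumes q: "q \<in> {p0..p1}" and alive_ind: "alive xs ys"
  shows "stepE q (\<lambda>a b. of_bool (alive a b) * potential a b) xs ys + 1
    \<le> potential xs ys + stepE q (gain xs ys) xs ys + stepE q (swap_cost xs ys) xs ys"
proof (cases "mx xs \<le> mx ys")
  case True
  have "stepE q (\<lambda>a b. of_bool (alive a b) * potential a b) xs ys
     \<le> stepE q (\<lambda>a b. of_bool (alive a b) * Phi a b + swap_cost xs ys a b) xs ys"
    using True by (intro stepE_mono_band[OF q]) (auto simp: swap_cost_def swapped_def potential_def lower_def upper_def Phi_nonneg)
  also have "\<dots> = stepE q (\<lambda>a b. of_bool (alive a b) * Phi a b) xs ys + stepE q (swap_cost xs ys) xs ys"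
    by (rule stepE_add)
  finally show ?thesis using Phi_alive_step[OF q alive_ind True] True
    by (simp add: potential_def lower_def upper_def gain_def[abs_def] Let_def)
next
  case False
  have "stepE q (\<lambda>a b. of_bool (alive a b) * potential a b) xs ys
     \<le> stepE q (\<lambda>a b. of_bool (alive a b) * Phi b a + swap_cost xs ys a b) xs ys"
    using False by (intro stepE_mono_band[OF q]) (auto simp: swap_cost_def swapped_def potential_def lower_def upper_def Phi_nonneg)
  also have "\<dots> = stepE q (\<lambda>a b. of_bool (alive a b) * Phi b a) xs ys + stepE q (swap_cost xs ys) xs ys"
    by (rule stepE_add)
  also have "stepE q (\<lambda>a b. of_bool (alive a b) * Phi b a) xs ys = stepE q (\<lambda>b a. of_bool (alive b a) * Phi b a) ys xs"
    by (subst stepE_swap) (simp add: alive_swap)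
  finally have 1: "stepE q (\<lambda>a b. of_bool (alive a b) * potential a b) xs ys
     \<le> stepE q (\<lambda>b a. of_bool (alive b a) * Phi b a) ys xs + stepE q (swap_cost xs ys) xs ys" .
  have 2: "stepE q (\<lambda>b a. of_bool (alive b a) * Phi b a) ys xs + 1
    \<le> Phi ys xs + stepE q (\<lambda>b a. of_bool (alive b a \<and> new_max a) * cross_ext a (mx a)) ys xs"
    using Phi_alive_step[OF q, of ys xs] alive_ind False by (simp add: alive_swap)
  have 3: "stepE q (\<lambda>b a. of_bool (alive b a \<and> new_max a) * cross_ext a (mx a)) ys xs
     = stepE q (\<lambda>a b. of_bool (alive a b \<and> new_max a) * cross_ext a (mx a)) xs ys"
    by (subst stepE_swap) (simp add: alive_swap)
  show ?thesis using 1 2 3 False by (simp add: potential_def lower_def upper_def gain_def[abs_def] Let_def)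
qed

section \<open>Crossing times summed over a window below the maximum\<close>

text \<open>Above the threshold \<open>B\<close> the factor \<open>t^2 / B^2\<close> is at least
  one.\<close>

lemma cross_young: "0 < B \<Longrightarrow> cross u z \<le> B + cross u z ^ 3 / B ^ 2"
proof -
  assume B: "0 < B"
  define t where "t = cross u z"
  have t: "0 \<le> t" by (simp add: t_def cross_nonneg)
  show ?thesis
  proof (cases "t \<le> B")
    case True
    then show ?thesis using B t by (simp add: t_def[symmetric] add_increasing2)
  next
    case False
    have "B\<^sup>2 \<le> t\<^sup>2" using False B by (intro power_mono) auto
    then have "t * B\<^sup>2 \<le> t * t\<^sup>2" using t by (intro mult_left_mono) auto
    then have "t \<le> t ^ 3 / B\<^sup>2" using B by (simp add: field_simps power3_eq_cube power2_eq_square)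
    then show ?thesis using B by (simp add: t_def[symmetric])
  qed
qed

text \<open>The top level contributes \<open>2 + cross u (mx u - 1)\<close>, and this crossing time
  occurs in the window once already; hence the factor \<open>2\<close>.\<close>

lemma Phi_window:
  assumes m: "0 \<le> mx u" and w: "1 \<le> w" "mx u - pos l \<le> w"
  shows "Phi l u \<le> 2 + 2 * (\<Sum>z\<in>{mx u - w..mx u - 1}. cross u z)"
proof -
  define m where "m = mx u"
  have "Phi l u \<le> (\<Sum>z\<in>insert m {m - w..m - 1}. cross_ext u z)"
    unfolding Phi_def using w by (intro sum_mono2) (auto simp: cross_ext_nonneg m_def)
  also have "\<dots> = cross_ext u m + (\<Sum>z\<in>{m - w..m - 1}. cross_ext u z)" by simp
  also have "(\<Sum>z\<in>{m - w..m - 1}. cross_ext u z) = (\<Sum>z\<in>{m - w..m - 1}. cross u z)"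
    by (intro sum.cong) (auto simp: cross_ext_def m_def)
  also have "cross_ext u m = 2 + cross u (m - 1)" by (simp add: cross_ext_def m_def)
  also have "cross u (m - 1) \<le> (\<Sum>z\<in>{m - w..m - 1}. cross u z)"
    using w by (intro member_le_sum) (auto simp: cross_nonneg)
  finally show ?thesis by (simp add: m_def)
qed

text \<open>The threshold grows linearly with the distance from \<open>m\<close>. The main term is
  quadratic in the width with a small factor \<open>e\<close>, so squared deficits can pay for
  it.\<close>

lemma window_sum:
  assumes e: "0 < e" and M: "0 \<le> M" and w: "0 \<le> w"
  shows "(\<Sum>z\<in>{m - w..m - 1}. cross u z) \<le> e * of_int w * (M + of_int w) + cube_sum M m u / e\<^sup>2"
proof -
  have "(\<Sum>z\<in>{m - w..m - 1}. cross u z)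
     \<le> (\<Sum>z\<in>{m - w..m - 1}. e * (M + of_int w) + (cross u z ^ 3 / (M + of_int (m - z)) ^ 2) / e\<^sup>2)"
  proof (intro sum_mono)
    fix z assume z: "z \<in> {m - w..m - 1}"
    define c where "c = M + real_of_int (m - z)"
    have "real_of_int (m - z) \<ge> 1" using z by (subst of_int_1[symmetric], subst of_int_le_iff) auto
    then have c: "0 < c" using M by (simp add: c_def)
    have 1: "cross u z \<le> e * c + cross u z ^ 3 / (e * c) ^ 2" using e c by (intro cross_young) auto
    have "real_of_int (m - z) \<le> of_int w" using z by (subst of_int_le_iff) auto
    then have 2: "e * c \<le> e * (M + of_int w)" using e by (intro mult_left_mono) (auto simp: c_def)
    have 3: "cross u z ^ 3 / (e * c) ^ 2 = (cross u z ^ 3 / c ^ 2) / e\<^sup>2" by (simp add: power_mult_distrib mult.commute)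
    show "cross u z \<le> e * (M + of_int w) + (cross u z ^ 3 / (M + of_int (m - z)) ^ 2) / e\<^sup>2"
      using 1[unfolded 3] 2 unfolding c_def by linarith
  qed
  also have "\<dots> = of_int w * (e * (M + of_int w)) + (\<Sum>z\<in>{m - w..m - 1}. cross u z ^ 3 / (M + of_int (m - z)) ^ 2) / e\<^sup>2"
    using w by (simp add: sum.distrib sum_divide_distrib)
  also have "(\<Sum>z\<in>{m - w..m - 1}. cross u z ^ 3 / (M + of_int (m - z)) ^ 2) \<le> cube_sum M m u"
  proof -
    have "(\<Sum>z\<in>{m - w..m - 1}. cross u z ^ 3 / (M + of_int (m - z)) ^ 2)
       = (\<Sum>z\<in>{m - w..m - 1} \<inter> {0..m - 1}. cross u z ^ 3 / (M + of_int (m - z)) ^ 2)"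
      by (rule sum.mono_neutral_right) auto
    also have "\<dots> \<le> cube_sum M m u"
      unfolding cube_sum_def by (intro sum_mono2) (auto simp: cross_nonneg)
    finally show ?thesis .
  qed
  finally show ?thesis by (simp add: divide_right_mono algebra_simps)
qed

text \<open>A constant threshold, for windows of bounded width: here a large \<open>A\<close> makes
  the third-moment part small, at the price of a main term that is only linear in the width.\<close>

lemma window_const:
  assumes A: "0 < A" and w: "0 \<le> w"
  shows "(\<Sum>z\<in>{m - w..m - 1}. cross u z) \<le> A * of_int w + (of_int w)\<^sup>2 * cube_sum 0 m u / A\<^sup>2"
proof (cases "w = 0")
  case False
  then have w1: "0 < real_of_int w" using w by simp
  have "(\<Sum>z\<in>{m - w..m - 1}. cross u z)
     \<le> (\<Sum>z\<in>{m - w..m - 1}. A + (cross u z ^ 3 / (of_int (m - z)) ^ 2) * ((of_int w)\<^sup>2 / A\<^sup>2))"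
  proof (intro sum_mono)
    fix z assume z: "z \<in> {m - w..m - 1}"
    define c where "c = real_of_int (m - z)"
    have c: "0 < c" using z unfolding c_def by (subst of_int_0_less_iff) auto
    have cw: "c \<le> of_int w" using z unfolding c_def by (subst of_int_le_iff) auto
    have "cross u z ^ 3 \<le> cross u z ^ 3 / c\<^sup>2 * (of_int w)\<^sup>2"
    proof -
      have "c\<^sup>2 \<le> (of_int w)\<^sup>2" using c cw by (intro power_mono) auto
      then have "cross u z ^ 3 * c\<^sup>2 \<le> cross u z ^ 3 * (of_int w)\<^sup>2" by (intro mult_left_mono) (auto simp: cross_nonneg)
      then show ?thesis using c by (simp add: field_simps)
    qed
    then have "cross u z ^ 3 / A\<^sup>2 \<le> (cross u z ^ 3 / c\<^sup>2 * (of_int w)\<^sup>2) / A\<^sup>2" by (rule divide_right_mono) simp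
    then show "cross u z \<le> A + (cross u z ^ 3 / (of_int (m - z)) ^ 2) * ((of_int w)\<^sup>2 / A\<^sup>2)"
      using cross_young[OF A, of u z] by (simp add: c_def del: of_int_diff)
  qed
  also have "\<dots> = of_int w * A + (\<Sum>z\<in>{m - w..m - 1}. cross u z ^ 3 / (of_int (m - z)) ^ 2) * ((of_int w)\<^sup>2 / A\<^sup>2)"
    using w by (simp only: sum.distrib sum_distrib_right[symmetric]) simp
  also have "(\<Sum>z\<in>{m - w..m - 1}. cross u z ^ 3 / (of_int (m - z)) ^ 2) \<le> cube_sum 0 m u"
  proof -
    have "(\<Sum>z\<in>{m - w..m - 1}. cross u z ^ 3 / (of_int (m - z)) ^ 2)
       = (\<Sum>z\<in>{m - w..m - 1} \<inter> {0..m - 1}. cross u z ^ 3 / (of_int (m - z)) ^ 2)"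
      by (rule sum.mono_neutral_right) auto
    also have "\<dots> \<le> cube_sum 0 m u"
      unfolding cube_sum_def add_0_left by (intro sum_mono2) (auto simp: cross_nonneg)
    finally show ?thesis .
  qed
  then have "(\<Sum>z\<in>{m - w..m - 1}. cross u z ^ 3 / (of_int (m - z)) ^ 2) * ((of_int w)\<^sup>2 / A\<^sup>2)
      \<le> cube_sum 0 m u * ((of_int w)\<^sup>2 / A\<^sup>2)" by (intro mult_right_mono) auto
  finally show ?thesis by (simp add: algebra_simps)
qed (auto simp: cube_sum_nonneg)

end

text \<open>Every new level is at once left downwards and reached again, so no level is first left
  upwards. If both walkers do this, the spread is zero and crossing times stay bounded at any height
  \<open>k\<close>.\<close>

primrec zigzag :: "nat \<Rightarrow> bool list" where
  "zigzag 0 = []"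
| "zigzag (Suc k) = True # False # True # zigzag k"

lemma zigzag_basic: "pos (zigzag k) = int k \<and> mx (zigzag k) = int k \<and> \<not> new_max (zigzag k) \<and> nonneg_path (zigzag k)
   \<and> (\<forall>z. \<not> first_up (zigzag k) z) \<and> length (zigzag k) = 3 * k"
  by (induction k) auto

lemma zigzag_alive: "alive (zigzag k) (zigzag k)"
  using zigzag_basic by (simp add: alive_def)

lemma zigzag_spread: "spread (zigzag k) (zigzag k) = 0" "upper_sq (zigzag k) (zigzag k) = 0" "peak (zigzag k) (zigzag k) = int k"
  using zigzag_basic[of k] by (auto simp: spread_def upper_sq_def deficit_def excess_def peak_def upper_def)

lemma inverse_squares_above: "1 \<le> k \<Longrightarrow> (\<Sum>m\<in>{int k + 1..int k + int n}. 1 / (real_of_int m)\<^sup>2) \<le> 1 / real k"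
proof -
  assume k: "1 \<le> k"
  have "(\<Sum>m\<in>{int k + 1..int k + int n}. 1 / (real_of_int m)\<^sup>2) \<le> 1 / real k - 1 / (real k + real n)"
  proof (induction n)
    case (Suc n)
    define x where "x = real k + real n"
    have x: "1 \<le> x" using k by (simp add: x_def)
    have e: "{int k + 1..int k + int (Suc n)} = insert (int k + int n + 1) {int k + 1..int k + int n}" by auto
    have "1 / (x + 1)\<^sup>2 \<le> 1 / (x * (x + 1))"
      using x by (intro divide_left_mono) (auto simp: power2_eq_square)
    also have "\<dots> = 1 / x - 1 / (x + 1)" using x by (simp add: field_simps)
    finally have "1 / (x + 1)\<^sup>2 \<le> 1 / x - 1 / (x + 1)" .
    then show ?case using Suc unfolding e by (simp add: x_def algebra_simps)
  qed simp
  also have "\<dots> \<le> 1 / real k" by simp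
  finally show ?thesis .
qed

context band
begin

lemma pathE_mono_band: "q \<in> {p0..p1} \<Longrightarrow> (\<And>a b. F a b \<le> H a b) \<Longrightarrow> pathE q n F xs ys \<le> pathE q n H xs ys"
  by (intro pathE_mono) (auto simp: band_q)

lemma pathE_nonneg_band: "q \<in> {p0..p1} \<Longrightarrow> (\<And>a b. 0 \<le> F a b) \<Longrightarrow> 0 \<le> pathE q n F xs ys"
  by (intro pathE_nonneg) (auto simp: band_q)

lemma new_max_sum:
  assumes q: "q \<in> {p0..p1}"
  shows "(\<Sum>t<n. pathE q (Suc t) (\<lambda>a b. of_bool (new_max b \<and> mx b = m)) xs ys) \<le> of_bool (mx ys < m)"
proof -
  have "stepE q (\<lambda>a b. of_bool (mx b < m)) a b + stepE q (\<lambda>a b. of_bool (new_max b \<and> mx b = m)) a b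
     \<le> of_bool (mx b < m)" for a b
  proof -
    have "stepE q (\<lambda>a b. of_bool (mx b < m) + of_bool (new_max b \<and> mx b = m)) a b \<le> stepE q (\<lambda>_ _. of_bool (mx b < m)) a b"
      by (intro stepE_mono_band[OF q]) auto
    then show ?thesis by (simp add: stepE_add)
  qed
  then show ?thesis
    using pathE_telescope_le[of q "\<lambda>a b. of_bool (mx b < m)" "stepE q (\<lambda>a b. of_bool (new_max b \<and> mx b = m))"
        "\<lambda>_ _. 0", where n=n and xs=xs and ys=ys] q by (simp add: band_q pathE_stepE)
qed

text \<open>Charges at new maxima are summed by level instead of by time. Each level is charged at
  most once, its third-moment part is at most the prediction at the start, and \<open>n\<close>
  steps reach at most \<open>n\<close> new levels.\<close>

lemma level_sum:
  assumes q: "q \<in> {p0..p1}" and M: "0 \<le> M" and g: "\<And>z. cube_bound z ys \<le> c"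
    and h: "\<And>m. 0 \<le> h m" and k: "0 \<le> k1" "0 \<le> k2"
  shows "(\<Sum>t<n. pathE q (Suc t) (\<lambda>a b. of_bool (new_max b) * (h (mx b) * (k1 + k2 * cube_sum M (mx b) b))) xs ys)
    \<le> (\<Sum>m\<in>{mx ys + 1..mx ys + int n}. h m) * (k1 + k2 * (c * (2 / (M + 1))))"
proof -
  let ?I = "{1..mx ys + int n}"
  define C where "C = k1 + k2 * (c * (2 / (M + 1)))"
  define A where "A m t = pathE q (Suc t) (\<lambda>a b. of_bool (new_max b \<and> mx b = m)) xs ys" for m t
  define B where "B m t = pathE q (Suc t) (\<lambda>a b. of_bool (new_max b \<and> mx b = m) * cube_sum M m b) xs ys" for m t
  have 1: "pathE q (Suc t) (\<lambda>a b. of_bool (new_max b) * (h (mx b) * (k1 + k2 * cube_sum M (mx b) b))) xs ys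
     \<le> (\<Sum>m\<in>?I. h m * (k1 * A m t + k2 * B m t))" if t: "t < n" for t
  proof -
    have "pathE q (Suc t) (\<lambda>a b. of_bool (new_max b) * (h (mx b) * (k1 + k2 * cube_sum M (mx b) b))) xs ys
      \<le> pathE q (Suc t) (\<lambda>a b. \<Sum>m\<in>?I. h m * (k1 * of_bool (new_max b \<and> mx b = m) + k2 * (of_bool (new_max b \<and> mx b = m) * cube_sum M m b))) xs ys"
    proof (rule pathE_mono_len)
      fix u w :: "bool list" assume l: "length u = Suc t" "length w = Suc t"
      define b where "b = w @ ys"
      have nonneg_path: "0 \<le> h m * (k1 * of_bool (new_max b \<and> mx b = m) + k2 * (of_bool (new_max b \<and> mx b = m) * cube_sum M m b))" for m
        using h k cube_sum_nonneg by (intro mult_nonneg_nonneg add_nonneg_nonneg) auto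
      have "of_bool (new_max b) * (h (mx b) * (k1 + k2 * cube_sum M (mx b) b))
         \<le> (\<Sum>m\<in>?I. h m * (k1 * of_bool (new_max b \<and> mx b = m) + k2 * (of_bool (new_max b \<and> mx b = m) * cube_sum M m b)))"
      proof (cases "new_max b")
        case True
        then have "mx b \<in> ?I" using new_max_imp[of b] mx_append_le[of w ys] l t by (auto simp: b_def)
        then show ?thesis using True member_le_sum[of "mx b" ?I "\<lambda>m. h m * (k1 * of_bool (new_max b \<and> mx b = m) + k2 * (of_bool (new_max b \<and> mx b = m) * cube_sum M m b))"] nonneg_path
          by simp
      next
        case False
        then show ?thesis by simp
      qed
      then show "of_bool (new_max (w @ ys)) * (h (mx (w @ ys)) * (k1 + k2 * cube_sum M (mx (w @ ys)) (w @ ys)))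
         \<le> (\<Sum>m\<in>?I. h m * (k1 * of_bool (new_max (w @ ys) \<and> mx (w @ ys) = m) + k2 * (of_bool (new_max (w @ ys) \<and> mx (w @ ys) = m) * cube_sum M m (w @ ys))))"
        by (simp only: b_def)
    qed (use q in \<open>auto simp: band_q\<close>)
    also have "\<dots> = (\<Sum>m\<in>?I. h m * (k1 * A m t + k2 * B m t))"
      by (simp only: pathE_sum pathE_cmult pathE_add A_def B_def)
    finally show ?thesis .
  qed
  have 2: "(\<Sum>t<n. k1 * A m t + k2 * B m t) \<le> of_bool (mx ys < m) * C" for m
  proof -
    have "(\<Sum>t<n. B m t) \<le> of_bool (mx ys < m) * cube_bound_sum M m ys"
      using charge_sum[OF q, where n=n and m=m and M=M and xs=xs and ys=ys] by (simp only: pathE_stepE B_def)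
    also have "\<dots> \<le> of_bool (mx ys < m) * (c * (2 / (M + 1)))"
      by (intro mult_left_mono cube_bound_sum_bound M g) auto
    finally have "(\<Sum>t<n. k1 * A m t + k2 * B m t) \<le> k1 * of_bool (mx ys < m) + k2 * (of_bool (mx ys < m) * (c * (2 / (M + 1))))"
      using new_max_sum[OF q, where n=n and m=m and xs=xs and ys=ys] k
      unfolding sum.distrib sum_distrib_left[symmetric] A_def by (intro add_mono mult_left_mono) auto
    then show ?thesis by (simp add: C_def algebra_simps)
  qed
  have "(\<Sum>t<n. pathE q (Suc t) (\<lambda>a b. of_bool (new_max b) * (h (mx b) * (k1 + k2 * cube_sum M (mx b) b))) xs ys)
     \<le> (\<Sum>t<n. \<Sum>m\<in>?I. h m * (k1 * A m t + k2 * B m t))"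
    by (intro sum_mono 1) auto
  also have "\<dots> = (\<Sum>m\<in>?I. h m * (\<Sum>t<n. k1 * A m t + k2 * B m t))"
    by (subst sum.swap) (simp add: sum_distrib_left)
  also have "\<dots> \<le> (\<Sum>m\<in>?I. h m * (of_bool (mx ys < m) * C))"
    by (intro sum_mono mult_left_mono 2 h)
  also have "\<dots> = (\<Sum>m\<in>{mx ys + 1..mx ys + int n}. h m * C)"
    using mx_nonneg[of ys] by (intro sum.mono_neutral_cong_right) auto
  also have "\<dots> = (\<Sum>m\<in>{mx ys + 1..mx ys + int n}. h m) * C"
    by (simp add: sum_distrib_right)
  finally show ?thesis by (simp add: C_def)
qed

definition level_charge :: "real \<Rightarrow> real \<Rightarrow> real \<Rightarrow> (int \<Rightarrow> real) \<Rightarrow> bool list \<Rightarrow> real" where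
  "level_charge M k1 k2 h u = of_bool (new_max u) * (h (mx u) * (k1 + k2 * cube_sum M (mx u) u))"

lemma level_charge_nonneg: "(\<And>m. 0 \<le> h m) \<Longrightarrow> 0 \<le> k1 \<Longrightarrow> 0 \<le> k2 \<Longrightarrow> 0 \<le> level_charge M k1 k2 h u"
  by (auto simp: level_charge_def cube_sum_nonneg intro!: mult_nonneg_nonneg add_nonneg_nonneg)

lemma level_charge_sum:
  assumes q: "q \<in> {p0..p1}" and M: "0 \<le> M" and g: "\<And>z. cube_bound z xs \<le> c" "\<And>z. cube_bound z ys \<le> c"
    and h: "\<And>m. 0 \<le> h m" and k: "0 \<le> k1" "0 \<le> k2" and e: "mx xs = m0" "mx ys = m0"
  shows "(\<Sum>t<n. pathE q (Suc t) (\<lambda>a b. level_charge M k1 k2 h a + level_charge M k1 k2 h b) xs ys)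
    \<le> 2 * ((\<Sum>m\<in>{m0 + 1..m0 + int n}. h m) * (k1 + k2 * (c * (2 / (M + 1)))))"
proof -
  define X where "X = (\<Sum>m\<in>{m0 + 1..m0 + int n}. h m) * (k1 + k2 * (c * (2 / (M + 1))))"
  have "(\<Sum>t<n. pathE q (Suc t) (\<lambda>a b. level_charge M k1 k2 h a) xs ys) = (\<Sum>t<n. pathE q (Suc t) (\<lambda>b a. level_charge M k1 k2 h a) ys xs)"
    by (subst pathE_swap) simp
  also have "\<dots> \<le> X"
    using level_sum[where h=h, OF q M g(1) h k, where n=n and xs=ys] e by (simp only: level_charge_def X_def)
  finally have 1: "(\<Sum>t<n. pathE q (Suc t) (\<lambda>a b. level_charge M k1 k2 h a) xs ys) \<le> X" .
  have 2: "(\<Sum>t<n. pathE q (Suc t) (\<lambda>a b. level_charge M k1 k2 h b) xs ys) \<le> X"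
    using level_sum[where h=h, OF q M g(2) h k, where n=n and xs=xs] e by (simp only: level_charge_def X_def)
  show ?thesis
    unfolding pathE_add sum.distrib X_def[symmetric] mult_2 using 1 2 by (rule add_mono)
qed

lemma gain_le:
  assumes "0 < A"
  shows "gain xs ys a b \<le> of_bool (alive a b \<and> new_max (if mx xs \<le> mx ys then b else a))
     * (2 + A + cube_sum 0 (mx (if mx xs \<le> mx ys then b else a)) (if mx xs \<le> mx ys then b else a) / A\<^sup>2)"
proof -
  define u where "u = (if mx xs \<le> mx ys then b else a)"
  have "cross_ext u (mx u) = 2 + cross u (mx u - 1)" by (simp add: cross_ext_def)
  also have "cross u (mx u - 1) \<le> A + cube_sum 0 (mx u) u / A\<^sup>2"
    using window_const[OF assms, of 1 u "mx u"] by simp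
  finally have "cross_ext u (mx u) \<le> 2 + A + cube_sum 0 (mx u) u / A\<^sup>2" by simp
  then show ?thesis unfolding gain_def Let_def u_def[symmetric] by (intro mult_left_mono) auto
qed

lemma swap_cost_le:
  assumes e: "0 < e" and M: "0 \<le> M" and c: "swapped xs ys (x # xs) (y # ys)"
  defines "a \<equiv> x # xs" and "b \<equiv> y # ys"
  shows "swap_cost xs ys a b \<le> of_bool (alive a b) * (2 + 2 * (e * (real_of_int (deficit (lower a b)) + 1) * (M + real_of_int (deficit (lower a b)) + 1)
      + cube_sum M (mx (upper a b)) (upper a b) / e\<^sup>2))"
proof -
  let ?w = "deficit (lower a b) + 1"
  have "potential a b \<le> 2 + 2 * (\<Sum>z\<in>{mx (upper a b) - ?w..mx (upper a b) - 1}. cross (upper a b) z)"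
    unfolding potential_def using swapped_window[OF c] deficit_nonneg mx_nonneg
    by (intro Phi_window) (auto simp: mx_upper peak_nonneg a_def b_def simp del: new_max.simps mx.simps)
  also have "(\<Sum>z\<in>{mx (upper a b) - ?w..mx (upper a b) - 1}. cross (upper a b) z)
     \<le> e * of_int ?w * (M + of_int ?w) + cube_sum M (mx (upper a b)) (upper a b) / e\<^sup>2"
    using deficit_nonneg by (intro window_sum e M) (simp add: add_increasing2)
  finally show ?thesis unfolding swap_cost_def
    by (cases "alive a b") (auto simp: c a_def b_def add.assoc)
qed

definition alive_ind :: "bool list \<Rightarrow> bool list \<Rightarrow> real" where
  "alive_ind xs ys = of_bool (alive xs ys)"

lemma alive_ind_cases: "alive_ind xs ys = 0 \<or> alive_ind xs ys = 1" "0 \<le> alive_ind xs ys" "alive_ind xs ys \<le> 1"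
  by (auto simp: alive_ind_def)

text \<open>The weight is summable over levels and fits the criterion for death: a walker below
  \<open>0\<close> is at distance at least \<open>k + 1\<close> from an overall maximum
  \<open>k\<close>.\<close>

definition inv_sq :: "int \<Rightarrow> real" where "inv_sq k = 1 / (of_int k + 1)\<^sup>2"

lemma inv_sq_antimono: "0 \<le> k \<Longrightarrow> k \<le> l \<Longrightarrow> inv_sq l \<le> inv_sq k"
  unfolding inv_sq_def by (intro divide_left_mono power_mono mult_pos_pos zero_less_power) auto

lemma inv_sq_nonneg: "0 \<le> inv_sq k"
  by (simp add: inv_sq_def)

section \<open>Positive probability of survival\<close>

text \<open>With the factor \<open>1/2\<close>, the growth of \<open>upper_sq\<close> uses up half
  of the unit decrease of the potential, and an exchange releases half of the squared deficit of the
  lower walker.\<close>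

definition lyapunov :: "bool list \<Rightarrow> bool list \<Rightarrow> real" where
  "lyapunov xs ys = potential xs ys + upper_sq xs ys / 2"

lemma lyapunov_nonneg: "0 \<le> lyapunov xs ys"
  by (simp add: lyapunov_def potential_nonneg upper_sq_def)

text \<open>The weight is frozen at its value before the step. A level reached in this step is at
  most \<open>peak xs ys + 1\<close>, where \<open>h\<close> is not smaller than that weight, so all
  charges can be expressed through \<open>h\<close>.\<close>

lemma lyapunov_step:
  assumes q: "q \<in> {p0..p1}" and alive_ind: "alive xs ys" and h: "0 \<le> peak xs ys" "\<And>m. h m = 1 / (real_of_int m)\<^sup>2"
  shows "inv_sq (peak xs ys) * stepE q (\<lambda>a b. alive_ind a b * lyapunov a b) xs ys + inv_sq (peak xs ys) / 2
    \<le> inv_sq (peak xs ys) * lyapunov xs ys + stepE q (\<lambda>a b. level_charge 0 6 129 h a + level_charge 0 6 129 h b) xs ys"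
proof -
  define o' where "o' = inv_sq (peak xs ys)"
  have o: "0 \<le> o'" by (simp add: o'_def inv_sq_nonneg)
  have hn: "0 \<le> h m" for m by (simp add: h)
  let ?S = "\<lambda>a b. of_bool (swapped xs ys a b) * real_of_int ((deficit (lower a b))\<^sup>2)"
  have ch: "of_bool (new_max u) * (o' * (k1 + k2 * cube_sum 0 (mx u) u)) \<le> level_charge 0 k1 k2 h u"
    if "mx u \<le> peak xs ys + 1" "0 \<le> k1" "0 \<le> k2" for u k1 k2
  proof (cases "new_max u")
    case True
    then have "1 \<le> mx u" using new_max_imp by auto
    then have "o' \<le> h (mx u)" using inv_sq_antimono[of "mx u - 1" "peak xs ys"] that by (simp add: o'_def h inv_sq_def)
    then show ?thesis using that cube_sum_nonneg[of 0 "mx u" u] by (simp add: True level_charge_def mult_right_mono)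
  next
    case False
    then show ?thesis by (simp add: level_charge_def)
  qed
  have key: "o' * (gain xs ys (x # xs) (y # ys) + swap_cost xs ys (x # xs) (y # ys))
     \<le> (level_charge 0 6 129 h (x # xs) + level_charge 0 6 129 h (y # ys)) + o' / 2 * ?S (x # xs) (y # ys)" for x y
  proof -
    define a b where "a = x # xs" and "b = y # ys"
    define u where "u = (if mx xs \<le> mx ys then b else a)"
    have bs: "mx a \<le> peak xs ys + 1" "mx b \<le> peak xs ys + 1" by (auto simp: a_def b_def peak_def)
    have uu: "mx u \<le> peak xs ys + 1" using bs by (simp add: u_def)
    have f3: "0 \<le> 3 + cube_sum 0 (mx u) u" using cube_sum_nonneg[of 0 "mx u" u] by simp
    have "gain xs ys a b \<le> of_bool (new_max u) * (3 + cube_sum 0 (mx u) u)"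
      using gain_le[of 1 xs ys a b] f3 unfolding u_def[symmetric]
      by (cases "alive a b"; cases "new_max u") simp_all
    then have g1: "o' * gain xs ys a b \<le> level_charge 0 3 1 h u"
      using ch[OF uu, of 3 1] mult_left_mono[OF _ o] by (fastforce simp: mult.left_commute)
    have s1: "o' * swap_cost xs ys a b \<le> of_bool (swapped xs ys a b) * level_charge 0 3 128 h (upper a b) + o' / 2 * ?S a b"
    proof (cases "swapped xs ys a b")
      case True
      define r where "r = real_of_int (deficit (lower a b))"
      have r: "0 \<le> r" using deficit_nonneg by (simp add: r_def)
      have n: "new_max (upper a b)" using swapped_facts(1) True by (simp add: a_def b_def)
      let ?F = "cube_sum 0 (mx (upper a b)) (upper a b)"
      \<comment> \<open>With slope \<open>1/8\<close> the window costs \<open>(r + 1)^2 / 4\<close>,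
        which is at most \<open>r^2 / 2 + 1/2\<close>; the first part is exactly what the exchange
        releases.\<close>
      have "swap_cost xs ys a b \<le> of_bool (alive a b) * (2 + 2 * (1/8 * (r + 1) * (0 + r + 1) + ?F / (1/8)\<^sup>2))"
        using swap_cost_le[of "1/8" 0 xs ys x y] True by (simp only: a_def b_def r_def)
      also have "\<dots> \<le> 2 + 2 * (1/8 * (r + 1) * (0 + r + 1) + ?F / (1/8)\<^sup>2)"
        using r cube_sum_nonneg[of 0 "mx (upper a b)" "upper a b"] by (cases "alive a b") auto
      also have "\<dots> = 2 + (r + 1)\<^sup>2 / 4 + 128 * ?F" by (simp add: power2_eq_square field_simps)
      also have "(r + 1)\<^sup>2 \<le> 2 * r\<^sup>2 + 2" using zero_le_power2[of "r - 1"] by (simp add: power2_eq_square algebra_simps)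
      finally have "swap_cost xs ys a b \<le> (3 + 128 * ?F) + r\<^sup>2 / 2" by (simp add: add_divide_distrib)
      then have "o' * swap_cost xs ys a b \<le> o' * (3 + 128 * ?F) + o' / 2 * r\<^sup>2"
        using mult_left_mono[OF _ o] by (fastforce simp: algebra_simps)
      also have "o' * (3 + 128 * ?F) \<le> level_charge 0 3 128 h (upper a b)"
        using ch[of "upper a b" 3 128] n bs by (auto simp: upper_def split: if_splits)
      finally show ?thesis using True by (simp add: r_def)
    next
      case False
      then show ?thesis by (simp add: swap_cost_def)
    qed
    have c3: "level_charge 0 3 1 h v + level_charge 0 3 128 h v = level_charge 0 6 129 h v" for v
      by (simp add: level_charge_def algebra_simps)
    have cn: "0 \<le> level_charge 0 3 1 h v" "0 \<le> level_charge 0 3 128 h v" for v using hn by (auto intro!: level_charge_nonneg)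
    have "level_charge 0 3 1 h u + of_bool (swapped xs ys a b) * level_charge 0 3 128 h (upper a b) \<le> level_charge 0 6 129 h a + level_charge 0 6 129 h b"
      using cn[of a] cn[of b] unfolding c3[symmetric] by (auto simp: u_def upper_def)
    then show ?thesis using g1 s1 by (simp only: a_def b_def distrib_left)
  qed
  have "o' * (stepE q (gain xs ys) xs ys + stepE q (swap_cost xs ys) xs ys)
     = stepE q (\<lambda>a b. o' * (gain xs ys a b + swap_cost xs ys a b)) xs ys"
    by (simp only: stepE_cmult stepE_add)
  also have "\<dots> \<le> stepE q (\<lambda>a b. (level_charge 0 6 129 h a + level_charge 0 6 129 h b) + o' / 2 * ?S a b) xs ys"
    by (intro stepE_mono_band[OF q] key)
  also have "\<dots> = stepE q (\<lambda>a b. level_charge 0 6 129 h a + level_charge 0 6 129 h b) xs ys + o' / 2 * stepE q ?S xs ys"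
    by (simp only: stepE_cmult stepE_add)
  finally have 1: "o' * (stepE q (gain xs ys) xs ys + stepE q (swap_cost xs ys) xs ys)
     \<le> stepE q (\<lambda>a b. level_charge 0 6 129 h a + level_charge 0 6 129 h b) xs ys + o' / 2 * stepE q ?S xs ys" .
  have 2: "o' * (stepE q (\<lambda>a b. alive_ind a b * potential a b) xs ys + 1) \<le> o' * (potential xs ys + stepE q (gain xs ys) xs ys + stepE q (swap_cost xs ys) xs ys)"
    using potential_step[OF q alive_ind] o by (intro mult_left_mono) (auto simp: alive_ind_def)
  have 3: "o' / 2 * (stepE q upper_sq xs ys + stepE q ?S xs ys) \<le> o' / 2 * (upper_sq xs ys + 1)"
    using upper_sq_step[OF q, of xs ys] o by (intro mult_left_mono) (auto simp: stepE_add)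
  have "stepE q (\<lambda>a b. alive_ind a b * lyapunov a b) xs ys \<le> stepE q (\<lambda>a b. alive_ind a b * potential a b + 1/2 * upper_sq a b) xs ys"
    using alive_ind_cases by (intro stepE_mono_band[OF q]) (auto simp: lyapunov_def alive_ind_def upper_sq_def)
  also have "\<dots> = stepE q (\<lambda>a b. alive_ind a b * potential a b) xs ys + 1/2 * stepE q upper_sq xs ys"
    by (simp only: stepE_cmult stepE_add)
  finally have "o' * stepE q (\<lambda>a b. alive_ind a b * lyapunov a b) xs ys \<le> o' * (stepE q (\<lambda>a b. alive_ind a b * potential a b) xs ys + 1/2 * stepE q upper_sq xs ys)"
    using o by (rule mult_left_mono)
  then show ?thesis using 1 2 3 by (simp add: o'_def[symmetric] lyapunov_def algebra_simps)
qed

lemma alive_ind_Cons: "\<not> alive xs ys \<Longrightarrow> alive_ind (a # xs) (b # ys) = 0"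
  using alive_Cons by (auto simp: alive_ind_def)

lemma stepE_dead: "\<not> alive xs ys \<Longrightarrow> stepE q (\<lambda>a b. alive_ind a b * H a b) xs ys = 0"
  by (simp add: stepE_def alive_ind_Cons)

text \<open>The larger one of the initial value and the fixed point of the recursion for levels with
  drift.\<close>

definition cross_cap :: real where "cross_cap = max 2 ((1 / p0) / (1 - r0))"

lemma cross_zigzag: "cross (zigzag k) z \<le> cross_cap"
proof -
  have f: "1 / p0 + r0 * cross_cap \<le> cross_cap"
  proof -
    have "(1 / p0) / (1 - r0) \<le> cross_cap" by (simp add: cross_cap_def)
    then have "1 / p0 \<le> cross_cap * (1 - r0)" using r0 by (subst (asm) pos_divide_le_eq) auto
    then show ?thesis by (simp add: algebra_simps)
  qed
  have "cross_rec (first_up (zigzag k)) n \<le> cross_cap" for n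
  proof (induction n)
    case (Suc n)
    have "r0 * cross_rec (first_up (zigzag k)) n \<le> r0 * cross_cap" using Suc r0 by (intro mult_left_mono) auto
    moreover have "\<not> first_up (zigzag k) (int (Suc n))" using zigzag_basic[of k] by blast
    ultimately show ?case unfolding cross_rec.simps using f by (simp only: if_False)
  qed (simp add: cross_cap_def)
  then show ?thesis by (auto simp: cross_def cross_cap_def)
qed

lemma cube_bound_zigzag: "cube_bound z (zigzag k) \<le> cross_cap ^ 3 + cube_mean"
proof -
  have "cross (zigzag k) w ^ 3 \<le> cross_cap ^ 3" for w by (intro power_mono cross_zigzag cross_nonneg)
  then show ?thesis using cube_bound_bounds(2)[of z "zigzag k"] by (smt (verit))
qed

definition death_const :: real where "death_const = 2 * (2 + cross_cap + 2 * (6 + 258 * (cross_cap ^ 3 + cube_mean)))"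

text \<open>Both sources are of order \<open>1 / k\<close>: the initial Lyapunov value is bounded
  and has weight at most \<open>1 / k\<close>, and the weights \<open>h\<close> of the levels above
  \<open>k\<close> have sum at most \<open>1 / k\<close>.\<close>

lemma alive_weight_sum:
  assumes q: "q \<in> {p0..p1}" and k: "1 \<le> k"
  shows "sumE q n (\<lambda>a b. alive_ind a b * inv_sq (peak a b)) (zigzag k) (zigzag k) \<le> death_const / real k"
proof -
  define h :: "int \<Rightarrow> real" where "h = (\<lambda>m. 1 / (real_of_int m)\<^sup>2)"
  define c where "c = (\<lambda>a b. level_charge 0 6 129 h a + level_charge 0 6 129 h b)"
  have c0: "0 \<le> c a b" for a b unfolding c_def by (intro add_nonneg_nonneg level_charge_nonneg) (auto simp: h_def)
  let ?V = "\<lambda>a b. alive_ind a b * (inv_sq (peak a b) * lyapunov a b)"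
  have step: "stepE q ?V a b + alive_ind a b * inv_sq (peak a b) * (1/2) \<le> ?V a b + stepE q c a b" for a b
  proof (cases "alive a b")
    case True
    have "stepE q ?V a b \<le> stepE q (\<lambda>x y. inv_sq (peak a b) * (alive_ind x y * lyapunov x y)) a b"
    proof (rule stepE_mono_band[OF q])
      fix x y
      have "inv_sq (peak (x # a) (y # b)) \<le> inv_sq (peak a b)" by (intro inv_sq_antimono peak_nonneg peak_step)
      then have "inv_sq (peak (x # a) (y # b)) * (alive_ind (x # a) (y # b) * lyapunov (x # a) (y # b)) \<le> inv_sq (peak a b) * (alive_ind (x # a) (y # b) * lyapunov (x # a) (y # b))"
        by (intro mult_right_mono mult_nonneg_nonneg lyapunov_nonneg alive_ind_cases)
      then show "alive_ind (x # a) (y # b) * (inv_sq (peak (x # a) (y # b)) * lyapunov (x # a) (y # b)) \<le> inv_sq (peak a b) * (alive_ind (x # a) (y # b) * lyapunov (x # a) (y # b))"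
        by (simp only: mult.left_commute)
    qed
    also have "\<dots> = inv_sq (peak a b) * stepE q (\<lambda>x y. alive_ind x y * lyapunov x y) a b" by (rule stepE_cmult)
    finally show ?thesis using lyapunov_step[OF q True peak_nonneg, of h] True by (simp add: alive_ind_def h_def c_def)
  next
    case False
    have "0 \<le> stepE q c a b" using stepE_mono_band[OF q, of "\<lambda>_ _. 0" a b c] c0 by simp
    then show ?thesis using False by (simp add: stepE_dead) (simp add: alive_ind_def)
  qed
  have V0: "?V (zigzag k) (zigzag k) \<le> (2 + cross_cap) / real k"
  proof -
    have "potential (zigzag k) (zigzag k) = cross_ext (zigzag k) (int k)" using zigzag_basic[of k] by (simp add: potential_def Phi_def lower_def upper_def)
    also have "\<dots> \<le> 2 + cross_cap" using zigzag_basic[of k] cross_zigzag[of k "int k - 1"] by (simp add: cross_ext_def)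
    finally have 1: "lyapunov (zigzag k) (zigzag k) \<le> 2 + cross_cap" by (simp add: lyapunov_def zigzag_spread)
    have "real k \<le> (real k + 1)\<^sup>2" by (simp add: power2_eq_square algebra_simps)
    then have 2: "inv_sq (int k) \<le> 1 / real k" using k by (simp add: inv_sq_def divide_left_mono)
    have "inv_sq (int k) * lyapunov (zigzag k) (zigzag k) \<le> 1 / real k * (2 + cross_cap)"
      using 1 2 by (intro mult_mono) (auto simp: lyapunov_nonneg)
    then show ?thesis using zigzag_alive[of k] by (simp add: zigzag_spread alive_ind_def)
  qed
  have "sumE q n (\<lambda>a b. alive_ind a b * inv_sq (peak a b) * (1/2)) (zigzag k) (zigzag k)
     \<le> ?V (zigzag k) (zigzag k) + sumE q n (stepE q c) (zigzag k) (zigzag k)"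
    by (rule pathE_telescope_le[OF _ _ step]) (use q in \<open>auto simp: band_q inv_sq_nonneg lyapunov_nonneg alive_ind_def\<close>)
  also have "sumE q n (stepE q c) (zigzag k) (zigzag k) \<le> 2 * ((\<Sum>m\<in>{int k + 1..int k + int n}. h m) * (6 + 129 * ((cross_cap ^ 3 + cube_mean) * (2 / (0 + 1)))))"
    unfolding pathE_stepE c_def using zigzag_basic[of k]
    by (intro level_charge_sum[OF q]) (auto simp: cube_bound_zigzag h_def)
  also have "(\<Sum>m\<in>{int k + 1..int k + int n}. h m) \<le> 1 / real k"
    using inverse_squares_above[OF k] by (simp add: h_def)
  finally have "sumE q n (\<lambda>a b. alive_ind a b * inv_sq (peak a b) * (1/2)) (zigzag k) (zigzag k)
     \<le> (2 + cross_cap) / real k + 2 * (1 / real k * (6 + 129 * ((cross_cap ^ 3 + cube_mean) * 2)))"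
    using V0 cube_mean cross_cap_def by (simp add: mult_right_mono)
  moreover have "sumE q n (\<lambda>a b. alive_ind a b * inv_sq (peak a b) * (1/2)) (zigzag k) (zigzag k)
     = 1/2 * sumE q n (\<lambda>a b. alive_ind a b * inv_sq (peak a b)) (zigzag k) (zigzag k)"
    by (subst mult.commute) (simp only: pathE_cmult sum_distrib_left)
  moreover have "(2 + cross_cap) / real k + 2 * (1 / real k * (6 + 129 * ((cross_cap ^ 3 + cube_mean) * 2))) = 1/2 * (death_const / real k)"
    using k by (simp add: death_const_def field_simps)
  ultimately show ?thesis by linarith
qed

text \<open>When a walker falls below \<open>0\<close>, its distance from the overall maximum forces
  \<open>3 * spread * inv_sq\<close> to be at least \<open>1\<close>. Before that, this quantity
  grows on average by at most \<open>3 * 4\<close> weights per step, and it starts from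
  \<open>0\<close>.\<close>

lemma dead_zigzag:
  assumes q: "q \<in> {p0..p1}" and k: "1 \<le> k"
  shows "1 - pathE q n alive_ind (zigzag k) (zigzag k) \<le> 12 * (death_const / real k)"
proof -
  let ?D = "\<lambda>a b. alive_ind a b * (3 * spread a b * inv_sq (peak a b)) + (1 - alive_ind a b)"
  have step: "stepE q ?D a b + 0 \<le> ?D a b + 12 * (alive_ind a b * inv_sq (peak a b))" for a b
  proof (cases "alive a b")
    case True
    have "stepE q ?D a b \<le> stepE q (\<lambda>x y. 3 * inv_sq (peak a b) * spread x y) a b"
    proof (rule stepE_mono_band[OF q])
      fix x y
      define A B where "A = x # a" and "B = y # b"
      have o: "inv_sq (peak A B) \<le> inv_sq (peak a b)" unfolding A_def B_def by (intro inv_sq_antimono peak_nonneg peak_step)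
      then have *: "3 * spread A B * inv_sq (peak A B) \<le> 3 * inv_sq (peak a b) * spread A B" using spread_nonneg[of A B]
        by (metis mult.assoc mult.commute mult_left_mono mult_nonneg_nonneg zero_le_numeral)
      have "1 \<le> 3 * spread A B * inv_sq (peak A B)" if d: "\<not> alive A B"
      proof -
        have "pos A < 0 \<or> pos B < 0" using d True by (auto simp: alive_def A_def B_def)
        then have "peak A B + 1 \<le> peak A B - pos A \<or> peak A B + 1 \<le> peak A B - pos B" by auto
        then have "(real_of_int (peak A B + 1))\<^sup>2 \<le> (real_of_int (peak A B - pos A))\<^sup>2 \<or> (real_of_int (peak A B + 1))\<^sup>2 \<le> (real_of_int (peak A B - pos B))\<^sup>2"
          using peak_nonneg[of A B] by (auto intro!: power_mono simp del: of_int_add of_int_diff)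
        then have "(real_of_int (peak A B + 1))\<^sup>2 \<le> 3 * spread A B" using peak_minus_pos[of A B] by linarith
        then show ?thesis using peak_nonneg[of A B] by (simp add: inv_sq_def field_simps)
      qed
      then show "alive_ind (x # a) (y # b) * (3 * spread (x # a) (y # b) * inv_sq (peak (x # a) (y # b))) + (1 - alive_ind (x # a) (y # b))
        \<le> 3 * inv_sq (peak a b) * spread (x # a) (y # b)"
        using * unfolding A_def[symmetric] B_def[symmetric] by (cases "alive A B") (auto simp: alive_ind_def)
    qed
    also have "\<dots> = 3 * inv_sq (peak a b) * stepE q spread a b" by (rule stepE_cmult)
    also have "\<dots> \<le> 3 * inv_sq (peak a b) * (spread a b + 4)"
      by (intro mult_left_mono spread_step[OF q]) (auto simp: inv_sq_nonneg)
    finally show ?thesis using True by (simp add: alive_ind_def algebra_simps)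
  next
    case False
    have "stepE q ?D a b = 1" using False by (simp add: stepE_def alive_ind_Cons algebra_simps)
    then show ?thesis using False by (simp add: alive_ind_def)
  qed
  have "pathE q n (\<lambda>a b. 1 - alive_ind a b) (zigzag k) (zigzag k) \<le> pathE q n ?D (zigzag k) (zigzag k)"
    using alive_ind_cases by (intro pathE_mono_band[OF q]) (auto intro!: mult_nonneg_nonneg spread_nonneg inv_sq_nonneg)
  also have "\<dots> \<le> ?D (zigzag k) (zigzag k) + sumE q n (\<lambda>a b. 12 * (alive_ind a b * inv_sq (peak a b))) (zigzag k) (zigzag k)"
    using pathE_telescope[OF _ _ step, where n=n and xs="zigzag k" and ys="zigzag k"] q by (simp add: band_q)
  also have "?D (zigzag k) (zigzag k) = 0" using zigzag_alive[of k] by (simp add: zigzag_spread alive_ind_def)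
  also have "sumE q n (\<lambda>a b. 12 * (alive_ind a b * inv_sq (peak a b))) (zigzag k) (zigzag k)
      = 12 * sumE q n (\<lambda>a b. alive_ind a b * inv_sq (peak a b)) (zigzag k) (zigzag k)"
    by (simp only: pathE_cmult sum_distrib_left)
  also have "\<dots> \<le> 12 * (death_const / real k)" using alive_weight_sum[OF q k, of n] by simp
  finally show ?thesis by (simp add: pathE_diff)
qed

lemma alive_ind_antimono:
  assumes q: "q \<in> {p0..p1}"
  shows "pathE q (n + k) alive_ind xs ys \<le> pathE q n alive_ind xs ys"
proof (induction k)
  case (Suc k)
  have "stepE q alive_ind a b \<le> alive_ind a b" for a b
  proof -
    have "stepE q alive_ind a b \<le> stepE q (\<lambda>_ _. alive_ind a b) a b"
      by (intro stepE_mono_band[OF q]) (auto simp: alive_ind_def dest: alive_Cons)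
    then show ?thesis by simp
  qed
  then have "pathE q (n + k) (stepE q alive_ind) xs ys \<le> pathE q (n + k) alive_ind xs ys" by (rule pathE_mono_band[OF q])
  then show ?case using Suc by (simp add: pathE_stepE)
qed simp

lemma survival:
  obtains rho where "0 < rho" "\<And>q n. q \<in> {p0..p1} \<Longrightarrow> rho \<le> pathE q n alive_ind [] []"
proof -
  \<comment> \<open>From this height the probability of death is at most \<open>1/2\<close>; the
    zigzag path leading there has \<open>3 * k\<close> steps.\<close>
  define k where "k = max 1 (nat \<lceil>24 * death_const\<rceil>)"
  have k: "1 \<le> k" "24 * death_const \<le> real k" by (auto simp: k_def) linarith
  define rho where "rho = ((1 - p1)\<^sup>2) ^ (3 * k) * (1/2)"
  have "0 < rho" using p1 by (simp add: rho_def)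
  moreover have "rho \<le> pathE q n alive_ind [] []" if q: "q \<in> {p0..p1}" for q n
  proof -
    have "12 * (death_const / real k) \<le> 1/2" using k by (simp add: field_simps)
    then have h: "1/2 \<le> pathE q n alive_ind (zigzag k) (zigzag k)" using dead_zigzag[OF q k(1), of n] by linarith
    have "rho \<le> ((1 - p1)\<^sup>2) ^ (3 * k) * pathE q n alive_ind (zigzag k @ []) (zigzag k @ [])"
      unfolding rho_def using h by (intro mult_left_mono) auto
    also have "\<dots> \<le> pathE q (3 * k) (pathE q n alive_ind) [] []"
      using q p1 zigzag_basic[of k] p0 by (intro pathE_path pathE_nonneg_band[OF q]) (auto simp: alive_ind_def)
    also have "\<dots> = pathE q (n + 3 * k) alive_ind [] []" by (simp add: pathE_pathE add.commute)
    also have "\<dots> \<le> pathE q n alive_ind [] []" by (rule alive_ind_antimono[OF q])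
    finally show ?thesis .
  qed
  ultimately show ?thesis by (rule that)
qed

end

section \<open>Runs\<close>

text \<open>\<open>run_mode N xs ys = Some (z, k)\<close> means that a run from base level \<open>z\<close> has age \<open>k < N\<close>;
  otherwise the process is waiting for the next fresh time.\<close>

definition fresh :: "bool list \<Rightarrow> bool list \<Rightarrow> bool" where
  "fresh xs ys \<longleftrightarrow> new_max xs \<and> new_max ys \<and> pos xs = pos ys"

fun run_mode :: "nat \<Rightarrow> bool list \<Rightarrow> bool list \<Rightarrow> (int \<times> nat) option" where
  "run_mode N (a # xs) (b # ys) = (case run_mode N xs ys of
       None \<Rightarrow> if fresh (a # xs) (b # ys) then Some (pos (a # xs), 0) else None
     | Some (z, k) \<Rightarrow> if pos (a # xs) < z \<or> pos (b # ys) < z \<or> N \<le> Suc k then None else Some (z, Suc k))"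
| "run_mode N _ _ = None"

definition scanning :: "nat \<Rightarrow> bool list \<Rightarrow> bool list \<Rightarrow> real" where
  "scanning N xs ys = of_bool (run_mode N xs ys = None)"

lemma run_mode_inv: "run_mode N xs ys = Some (z, k) \<Longrightarrow> 1 \<le> N \<Longrightarrow> 1 \<le> z \<and> k < N"
proof (induction N xs ys arbitrary: z k rule: run_mode.induct)
  case (1 N a xs b ys)
  then show ?case using new_max_imp[of "a # xs"]
    by (auto simp: fresh_def split: option.splits if_splits simp del: pos.simps new_max.simps mx.simps)
qed auto

lemma fresh_facts:
  assumes "fresh (a # xs) (b # ys)"
  shows "mx (a # xs) = mx xs + 1" "mx (b # ys) = mx ys + 1" "mx (a # xs) = mx (b # ys)"
    "peak (a # xs) (b # ys) = peak xs ys + 1" "spread (a # xs) (b # ys) = 0" "0 \<le> pos (a # xs)" "0 \<le> pos (b # ys)"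
proof -
  define A B where "A = a # xs" and "B = b # ys"
  have n: "new_max A" "new_max B" "pos A = pos B" using assms by (auto simp: fresh_def A_def B_def)
  have m: "mx A = mx xs + 1" "mx B = mx ys + 1"
    using mx_Cons_new_max[of a xs] mx_Cons_new_max[of b ys] n by (simp_all add: A_def B_def)
  have p: "pos A = mx A" "pos B = mx B" "1 \<le> mx A" using new_max_imp[of A] new_max_imp[of B] n by auto
  have "peak A B = peak xs ys + 1" "spread A B = 0" using m p n by (auto simp: peak_def spread_def deficit_def excess_def)
  then show "mx (a # xs) = mx xs + 1" "mx (b # ys) = mx ys + 1" "mx (a # xs) = mx (b # ys)"
    "peak (a # xs) (b # ys) = peak xs ys + 1" "spread (a # xs) (b # ys) = 0" "0 \<le> pos (a # xs)" "0 \<le> pos (b # ys)"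
    using m p n by (simp_all only: A_def B_def)
qed

lemma alive_step: "alive xs ys \<Longrightarrow> alive (a # xs) (b # ys) \<longleftrightarrow> 0 \<le> pos (a # xs) \<and> 0 \<le> pos (b # ys)"
  by (auto simp: alive_def)

text \<open>The base level of a run is at least \<open>1\<close>, so a walker falling below
  \<open>0\<close> ends the run in the same step: killing never cuts off part of a run.\<close>

lemma dead_scan:
  assumes "alive xs ys" "\<not> alive (a # xs) (b # ys)" "1 \<le> N"
  shows "run_mode N (a # xs) (b # ys) = None"
  using assms alive_step[OF assms(1)] run_mode_inv[of N xs ys] fresh_facts(6,7)[of a xs b ys]
  by (force split: option.splits simp del: pos.simps)

primrec run_value :: "(bool list \<Rightarrow> bool list \<Rightarrow> real) \<Rightarrow> real \<Rightarrow> nat \<Rightarrow> int \<Rightarrow> bool list \<Rightarrow> bool list \<Rightarrow> real" where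
  "run_value d q 0 z xs ys = 0"
| "run_value d q (Suc k) z xs ys = d xs ys + stepE q (\<lambda>a b. if pos a < z \<or> pos b < z then 0 else run_value d q k z a b) xs ys"

definition run_rest :: "(bool list \<Rightarrow> bool list \<Rightarrow> real) \<Rightarrow> real \<Rightarrow> nat \<Rightarrow> bool list \<Rightarrow> bool list \<Rightarrow> real" where
  "run_rest d q N xs ys = (case run_mode N xs ys of None \<Rightarrow> 0 | Some (z, k) \<Rightarrow> run_value d q (N - k) z xs ys)"

lemma run_rest_run:
  assumes "run_mode N xs ys = Some (z, k)" "1 \<le> N"
  shows "run_rest d q N xs ys = d xs ys + stepE q (run_rest d q N) xs ys"
proof -
  have k: "N - k = Suc (N - Suc k)" using run_mode_inv[OF assms] by auto
  have "run_rest d q N (a # xs) (b # ys)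
     = (if pos (a # xs) < z \<or> pos (b # ys) < z then 0 else run_value d q (N - Suc k) z (a # xs) (b # ys))" for a b
    using assms by (auto simp: run_rest_def simp del: pos.simps)
  then have "stepE q (run_rest d q N) xs ys = stepE q (\<lambda>a b. if pos a < z \<or> pos b < z then 0 else run_value d q (N - Suc k) z a b) xs ys"
    by (intro stepE_cong)
  then show ?thesis unfolding run_rest_def using assms k by (simp add: run_rest_def)
qed

lemma run_rest_scan:
  assumes "run_mode N xs ys = None"
  shows "run_rest d q N (a # xs) (b # ys) = of_bool (fresh (a # xs) (b # ys)) * run_value d q N (pos (a # xs)) (a # xs) (b # ys)"
  using assms by (auto simp: run_rest_def simp del: pos.simps)

lemma pos_append: "pos (u @ xs) = pos u + pos xs"
  by (induction u) auto

lemma nonneg_path_append_pos: "nonneg_path (u @ xs) \<Longrightarrow> nonneg_path xs"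
  by (induction u) auto

text \<open>A level reached for the first time has one visit, like level \<open>0\<close> in an
  empty history, and levels above it have none.\<close>

lemma visit_count_append:
  assumes "new_max ys" "0 \<le> x"
  shows "visit_count (w @ ys) (x + pos ys) = visit_count w x"
proof (induction w)
  case Nil
  show ?case using visit_count_new_max[OF assms(1)] new_max_imp[OF assms(1)] visit_count_above[of ys "x + pos ys"] assms(2) by auto
next
  case (Cons b w)
  then show ?case by (simp add: pos_append)
qed

lemma up_prob_append:
  assumes "fresh xs ys" "0 \<le> pos u"
  shows "up_prob q (u @ xs) (w @ ys) = up_prob q u w" "0 \<le> pos w \<Longrightarrow> up_prob q (w @ ys) (u @ xs) = up_prob q w u"
  using assms visit_count_append[of ys "pos u" w] visit_count_append[of xs "pos w" u]
  by (auto simp: up_prob_def fresh_def pos_append)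

text \<open>At a fresh time both walkers see untouched levels from the base upwards, and the run
  stops as soon as one of them leaves this region.\<close>

lemma run_value_translate:
  assumes f: "fresh xs ys" and d: "\<And>u w. 0 \<le> pos u \<Longrightarrow> 0 \<le> pos w \<Longrightarrow> d (u @ xs) (w @ ys) = d u w"
    and "0 \<le> pos u" "0 \<le> pos w"
  shows "run_value d q k (pos xs) (u @ xs) (w @ ys) = run_value d q k 0 u w"
  using assms(3,4)
proof (induction k arbitrary: u w)
  case (Suc k)
  have e: "pos ys = pos xs" using f by (simp add: fresh_def)
  have *: "(if pos (a # u @ xs) < pos xs \<or> pos (b # w @ ys) < pos xs then 0 else run_value d q k (pos xs) (a # u @ xs) (b # w @ ys))
    = (if pos (a # u) < 0 \<or> pos (b # w) < 0 then 0 else run_value d q k 0 (a # u) (b # w))" for a b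
    using Suc.IH[of "a # u" "b # w"] by (auto simp: pos_append e)
  have "stepE q (\<lambda>a b. if pos a < pos xs \<or> pos b < pos xs then 0 else run_value d q k (pos xs) a b) (u @ xs) (w @ ys)
     = stepE q (\<lambda>a b. if pos a < 0 \<or> pos b < 0 then 0 else run_value d q k 0 a b) u w"
    unfolding stepE_def * up_prob_append(1)[OF f Suc.prems(1)] up_prob_append(2)[OF f Suc.prems] ..
  then show ?case using d Suc.prems by simp
qed simp

context band
begin

text \<open>Two roles: the mean of the killed sum up to time \<open>n\<close>, and for
  \<open>n = N\<close> the mean total of \<open>d\<close> over one run.\<close>

definition drift_sum :: "(bool list \<Rightarrow> bool list \<Rightarrow> real) \<Rightarrow> real \<Rightarrow> nat \<Rightarrow> real" where
  "drift_sum d q n = sumE q n (\<lambda>a b. alive_ind a b * d a b) [] []"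

lemma pathE_dead: "\<not> alive xs ys \<Longrightarrow> pathE q n (\<lambda>a b. alive_ind a b * d a b) xs ys = 0"
proof (induction n arbitrary: xs ys)
  case 0
  then show ?case by (simp add: alive_ind_def)
next
  case (Suc n)
  have "pathE q n (\<lambda>a b. alive_ind a b * d a b) (a # xs) (b # ys) = 0" for a b
    using Suc.prems alive_Cons by (intro Suc.IH) blast
  then have "stepE q (pathE q n (\<lambda>a b. alive_ind a b * d a b)) xs ys = stepE q (\<lambda>_ _. 0) xs ys" by (rule stepE_cong)
  then show ?case by simp
qed

lemma run_value_eq: "alive xs ys \<Longrightarrow> run_value d q k 0 xs ys = sumE q k (\<lambda>a b. alive_ind a b * d a b) xs ys"
proof (induction k arbitrary: xs ys)
  case (Suc k)
  have *: "(if pos (a # xs) < 0 \<or> pos (b # ys) < 0 then 0 else run_value d q k 0 (a # xs) (b # ys))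
     = sumE q k (\<lambda>a b. alive_ind a b * d a b) (a # xs) (b # ys)" for a b
  proof (cases "alive (a # xs) (b # ys)")
    case True
    then show ?thesis using Suc.IH alive_pos[OF True] by (simp del: pos.simps)
  next
    case False
    then show ?thesis using alive_step[OF Suc.prems, of a b] by (auto simp: pathE_dead simp del: pos.simps)
  qed
  have "stepE q (\<lambda>a b. if pos a < 0 \<or> pos b < 0 then 0 else run_value d q k 0 a b) xs ys
     = stepE q (\<lambda>a b. \<Sum>t<k. pathE q t (\<lambda>a b. alive_ind a b * d a b) a b) xs ys"
    by (rule stepE_cong) (rule *)
  also have "\<dots> = (\<Sum>t<k. pathE q (Suc t) (\<lambda>a b. alive_ind a b * d a b) xs ys)" by (simp add: stepE_sum)
  finally show ?case using Suc.prems by (subst sum.lessThan_Suc_shift) (simp add: alive_ind_def)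
qed simp

definition fresh_rate :: "nat \<Rightarrow> real \<Rightarrow> bool list \<Rightarrow> bool list \<Rightarrow> real" where
  "fresh_rate N q xs ys = alive_ind xs ys * (scanning N xs ys * stepE q (\<lambda>a b. alive_ind a b * of_bool (fresh a b)) xs ys)"

definition run_count :: "nat \<Rightarrow> real \<Rightarrow> nat \<Rightarrow> real" where
  "run_count N q n = sumE q n (fresh_rate N q) [] []"

definition shift_invariant :: "(bool list \<Rightarrow> bool list \<Rightarrow> real) \<Rightarrow> bool" where
  "shift_invariant d \<longleftrightarrow> (\<forall>xs ys u w. fresh xs ys \<longrightarrow> 0 \<le> pos u \<longrightarrow> 0 \<le> pos w \<longrightarrow> d (u @ xs) (w @ ys) = d u w)"

text \<open>An exact balance: inside a run the remaining value decreases by the current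
  \<open>d\<close>, and each start of a run adds the same amount
  \<open>drift_sum d q N\<close>.\<close>

lemma run_rest_step:
  assumes N: "1 \<le> N" and d: "shift_invariant d"
  shows "stepE q (\<lambda>a b. alive_ind a b * run_rest d q N a b) xs ys + alive_ind xs ys * ((1 - scanning N xs ys) * d xs ys)
    = alive_ind xs ys * run_rest d q N xs ys + drift_sum d q N * fresh_rate N q xs ys"
proof (cases "alive xs ys")
  case False
  then show ?thesis by (simp add: stepE_dead) (simp add: alive_ind_def fresh_rate_def)
next
  case True
  have dR: "alive_ind (a # xs) (b # ys) * run_rest d q N (a # xs) (b # ys) = run_rest d q N (a # xs) (b # ys)" for a b
    using dead_scan[OF True, of a b N] N by (cases "alive (a # xs) (b # ys)") (simp_all add: alive_ind_def run_rest_def del: run_mode.simps)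
  show ?thesis
  proof (cases "run_mode N xs ys")
    case None
    have "run_value d q N (pos (a # xs)) (a # xs) (b # ys) = drift_sum d q N" if "fresh (a # xs) (b # ys)" for a b
      using run_value_translate[OF that, of d "[]" "[]" q N] d that run_value_eq[of "[]" "[]" d q N]
      by (simp add: drift_sum_def shift_invariant_def del: pos.simps) (simp del: pos.simps add: pos.simps(1))
    then have "alive_ind (a # xs) (b # ys) * run_rest d q N (a # xs) (b # ys)
        = drift_sum d q N * (alive_ind (a # xs) (b # ys) * of_bool (fresh (a # xs) (b # ys)))" for a b
      by (simp add: run_rest_scan[OF None] del: pos.simps)
    then have "stepE q (\<lambda>a b. alive_ind a b * run_rest d q N a b) xs ys = stepE q (\<lambda>a b. drift_sum d q N * (alive_ind a b * of_bool (fresh a b))) xs ys"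
      by (intro stepE_cong)
    then show ?thesis using True None by (simp add: stepE_cmult fresh_rate_def scanning_def alive_ind_def run_rest_def)
  next
    case (Some zk)
    then have "run_rest d q N xs ys = d xs ys + stepE q (run_rest d q N) xs ys" using run_rest_run[OF _ N, of xs ys] by (cases zk) auto
    moreover have "stepE q (\<lambda>a b. alive_ind a b * run_rest d q N a b) xs ys = stepE q (run_rest d q N) xs ys"
      by (intro stepE_cong dR)
    ultimately show ?thesis using True Some by (simp add: fresh_rate_def scanning_def alive_ind_def)
  qed
qed

lemma scanning_cases: "scanning N a b = 0 \<or> scanning N a b = 1" "0 \<le> scanning N a b" "scanning N a b \<le> 1"
  by (auto simp: scanning_def)

text \<open>Wald's identity, corrected by the run in progress at time \<open>n\<close>. Telescoping
  gives inequalities only, so it is applied to all quantities and to their negatives.\<close>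

lemma run_identity:
  assumes q: "q \<in> {p0..p1}" and N: "1 \<le> N" and d: "shift_invariant d"
  shows "sumE q n (\<lambda>a b. alive_ind a b * ((1 - scanning N a b) * d a b)) [] []
      + pathE q n (\<lambda>a b. alive_ind a b * run_rest d q N a b) [] [] = drift_sum d q N * run_count N q n"
proof -
  have e: "drift_sum d q N * run_count N q n = sumE q n (\<lambda>a b. drift_sum d q N * fresh_rate N q a b) [] []"
    by (simp only: run_count_def pathE_cmult sum_distrib_left)
  have r: "alive_ind [] [] * run_rest d q N [] [] = 0" by (simp add: run_rest_def)
  have "sumE q n (\<lambda>a b. alive_ind a b * ((1 - scanning N a b) * d a b)) [] []
      + pathE q n (\<lambda>a b. alive_ind a b * run_rest d q N a b) [] [] \<le> 0 + drift_sum d q N * run_count N q n"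
    unfolding e r[symmetric] by (rule pathE_telescope) (use q run_rest_step[OF N d] in \<open>auto simp: band_q\<close>)
  moreover have "sumE q n (\<lambda>a b. - (alive_ind a b * ((1 - scanning N a b) * d a b))) [] []
      + pathE q n (\<lambda>a b. - (alive_ind a b * run_rest d q N a b)) [] [] \<le> - 0 + sumE q n (\<lambda>a b. - (drift_sum d q N * fresh_rate N q a b)) [] []"
  proof -
    have "stepE q (\<lambda>a b. - (alive_ind a b * run_rest d q N a b)) a b = - stepE q (\<lambda>a b. alive_ind a b * run_rest d q N a b) a b" for a b
      using stepE_cmult[of q "-1" "\<lambda>a b. alive_ind a b * run_rest d q N a b" a b] by simp
    then have "stepE q (\<lambda>a b. - (alive_ind a b * run_rest d q N a b)) a b + - (alive_ind a b * ((1 - scanning N a b) * d a b))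
        \<le> - (alive_ind a b * run_rest d q N a b) + - (drift_sum d q N * fresh_rate N q a b)" for a b
      using run_rest_step[OF N d, of q a b] by simp
    then show ?thesis unfolding r[symmetric]
      using q by (intro pathE_telescope) (auto simp: band_q)
  qed
  moreover have "pathE q t (\<lambda>a b. - F a b) [] [] = - pathE q t F [] []" for F t
    using pathE_cmult[of t q "-1" F] by simp
  ultimately show ?thesis by (simp add: sum_negf e)
qed

lemma run_value_bound:
  assumes q: "q \<in> {p0..p1}" and d: "\<And>a b. \<bar>d a b\<bar> \<le> B"
  shows "\<bar>run_value d q k z xs ys\<bar> \<le> B * real k"
proof (induction k arbitrary: xs ys)
  case (Suc k)
  have B: "0 \<le> B" using d[of "[]" "[]"] by linarith
  define F where "F = (\<lambda>a b. if pos a < z \<or> pos b < z then 0 else run_value d q k z a b)"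
  have F: "F a b \<le> B * real k" "- (B * real k) \<le> F a b" for a b
    using Suc[of a b] B by (auto simp: F_def abs_le_iff)
  have "stepE q F xs ys \<le> stepE q (\<lambda>_ _. B * real k) xs ys" by (intro stepE_mono_band[OF q] F)
  moreover have "stepE q (\<lambda>_ _. - (B * real k)) xs ys \<le> stepE q F xs ys" by (intro stepE_mono_band[OF q] F)
  ultimately show ?case using d[of xs ys] by (simp add: F_def[symmetric] algebra_simps abs_le_iff)
qed simp

lemma run_rest_bound:
  assumes q: "q \<in> {p0..p1}" and d: "\<And>a b. \<bar>d a b\<bar> \<le> B"
  shows "\<bar>run_rest d q N xs ys\<bar> \<le> B * real N"
proof (cases "run_mode N xs ys")
  case None
  then show ?thesis using d[of "[]" "[]"] by (auto simp: run_rest_def)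
next
  case (Some zk)
  obtain z k where zk: "zk = (z, k)" by (cases zk)
  have B: "0 \<le> B" using d[of "[]" "[]"] by linarith
  have "\<bar>run_rest d q N xs ys\<bar> \<le> B * real (N - k)" using run_value_bound[OF q d, where k="N - k"] Some by (simp add: run_rest_def zk)
  also have "\<dots> \<le> B * real N" using B by (intro mult_left_mono) auto
  finally show ?thesis .
qed

definition scan_time :: "nat \<Rightarrow> real \<Rightarrow> nat \<Rightarrow> real" where
  "scan_time N q n = sumE q n (\<lambda>a b. alive_ind a b * scanning N a b) [] []"

lemma alive_ind_run_rest_pathE_bound:
  assumes q: "q \<in> {p0..p1}" and d: "\<And>a b. \<bar>d a b\<bar> \<le> B"
  shows "\<bar>pathE q n (\<lambda>a b. alive_ind a b * run_rest d q N a b) xs ys\<bar> \<le> B * real N"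
proof -
  have b: "alive_ind a b * run_rest d q N a b \<le> B * real N" "- (B * real N) \<le> alive_ind a b * run_rest d q N a b" for a b
  proof -
    have r: "\<bar>run_rest d q N a b\<bar> \<le> B * real N" by (rule run_rest_bound[OF q d])
    then have "0 \<le> B * real N" by linarith
    then show "alive_ind a b * run_rest d q N a b \<le> B * real N" "- (B * real N) \<le> alive_ind a b * run_rest d q N a b"
      using r alive_ind_cases(1)[of a b] by (auto simp: abs_le_iff)
  qed
  have "pathE q n (\<lambda>a b. alive_ind a b * run_rest d q N a b) xs ys \<le> pathE q n (\<lambda>_ _. B * real N) xs ys"
    by (intro pathE_mono_band[OF q] b)
  moreover have "pathE q n (\<lambda>_ _. - (B * real N)) xs ys \<le> pathE q n (\<lambda>a b. alive_ind a b * run_rest d q N a b) xs ys"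
    by (intro pathE_mono_band[OF q] b)
  ultimately show ?thesis by (simp add: abs_le_iff)
qed

lemma fresh_rate_nonneg: "q \<in> {p0..p1} \<Longrightarrow> 0 \<le> fresh_rate N q xs ys"
  unfolding fresh_rate_def using stepE_mono_band[of q "\<lambda>_ _. 0" xs ys "\<lambda>a b. alive_ind a b * of_bool (fresh a b)"]
  by (intro mult_nonneg_nonneg scanning_cases alive_ind_cases) (auto simp: alive_ind_cases)

lemma run_count_nonneg: "q \<in> {p0..p1} \<Longrightarrow> 0 \<le> run_count N q n"
  unfolding run_count_def by (intro sum_nonneg pathE_nonneg_band fresh_rate_nonneg)

lemma run_time_le:
  assumes q: "q \<in> {p0..p1}"
  shows "sumE q n (\<lambda>a b. alive_ind a b * (1 - scanning N a b)) [] [] \<le> real n"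
proof -
  have "pathE q t (\<lambda>a b. alive_ind a b * (1 - scanning N a b)) [] [] \<le> pathE q t (\<lambda>_ _. 1) [] []" for t
    using alive_ind_cases(1) scanning_cases(1) by (intro pathE_mono_band[OF q]) (metis diff_zero diff_self mult_1 mult_zero_left mult_zero_right order_refl zero_le_one)
  then have "sumE q n (\<lambda>a b. alive_ind a b * (1 - scanning N a b)) [] [] \<le> (\<Sum>t<n. 1)" by (intro sum_mono) simp
  then show ?thesis by simp
qed

text \<open>For \<open>d = 1\<close> the identity says that the mean run length times the number of
  runs is the time spent in runs, with at most \<open>N\<close> added for the run in
  progress.\<close>

lemma run_count_le:
  assumes q: "q \<in> {p0..p1}" and N: "1 \<le> N"
  shows "drift_sum (\<lambda>_ _. 1) q N * run_count N q n \<le> real n + real N"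
proof -
  have "shift_invariant (\<lambda>_ _. 1)" by (simp add: shift_invariant_def)
  from run_identity[OF q N this, of n] run_time_le[OF q, where n=n and N=N] alive_ind_run_rest_pathE_bound[OF q, where d="\<lambda>_ _. 1" and B=1 and n=n and N=N and xs="[]" and ys="[]"]
  show ?thesis by simp
qed

text \<open>Comparison of two horizons: waiting costs at most \<open>B\<close> per step, the
  unfinished run at most \<open>B * N\<close>, and each run started contributes the mean at horizon
  \<open>N\<close>.\<close>

lemma drift_sum_le:
  assumes q: "q \<in> {p0..p1}" and N: "1 \<le> N" and d: "shift_invariant d" and B: "\<And>a b. \<bar>d a b\<bar> \<le> B"
  shows "\<bar>drift_sum d q n\<bar> \<le> B * real N + B * scan_time N q n + \<bar>drift_sum d q N\<bar> * run_count N q n"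
proof -
  have B0: "0 \<le> B" using B[of "[]" "[]"] by linarith
  have "drift_sum d q n = sumE q n (\<lambda>a b. alive_ind a b * (scanning N a b * d a b)) [] []
     + sumE q n (\<lambda>a b. alive_ind a b * ((1 - scanning N a b) * d a b)) [] []"
    unfolding drift_sum_def sum.distrib[symmetric] pathE_add[symmetric]
    by (intro sum.cong refl arg_cong[where f="\<lambda>F. pathE q t F [] []" for t] ext) (simp add: algebra_simps)
  moreover have "\<bar>\<Sum>t<n. pathE q t (\<lambda>a b. alive_ind a b * (scanning N a b * d a b)) [] []\<bar> \<le> B * scan_time N q n"
  proof -
    have b: "alive_ind a b * (scanning N a b * d a b) \<le> B * (alive_ind a b * scanning N a b)" "- B * (alive_ind a b * scanning N a b) \<le> alive_ind a b * (scanning N a b * d a b)" for a b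
      using alive_ind_cases(1)[of a b] scanning_cases(1)[of N a b] B[of a b] by auto
    have "\<bar>pathE q t (\<lambda>a b. alive_ind a b * (scanning N a b * d a b)) [] []\<bar> \<le> B * pathE q t (\<lambda>a b. alive_ind a b * scanning N a b) [] []" for t
    proof (rule abs_leI)
      show "pathE q t (\<lambda>a b. alive_ind a b * (scanning N a b * d a b)) [] [] \<le> B * pathE q t (\<lambda>a b. alive_ind a b * scanning N a b) [] []"
        unfolding pathE_cmult[symmetric] by (intro pathE_mono_band[OF q] b)
      have "- B * pathE q t (\<lambda>a b. alive_ind a b * scanning N a b) [] [] \<le> pathE q t (\<lambda>a b. alive_ind a b * (scanning N a b * d a b)) [] []"
        unfolding pathE_cmult[symmetric] by (intro pathE_mono_band[OF q] b)
      then show "- pathE q t (\<lambda>a b. alive_ind a b * (scanning N a b * d a b)) [] [] \<le> B * pathE q t (\<lambda>a b. alive_ind a b * scanning N a b) [] []"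
        by linarith
    qed
    then show ?thesis unfolding scan_time_def sum_distrib_left
      by (intro order_trans[OF sum_abs] sum_mono)
  qed
  moreover have "\<bar>drift_sum d q N * run_count N q n\<bar> = \<bar>drift_sum d q N\<bar> * run_count N q n" using run_count_nonneg[OF q] by (simp add: abs_mult)
  moreover note run_identity[OF q N d, of n] alive_ind_run_rest_pathE_bound[where d=d, OF q B, where n=n and N=N and xs="[]" and ys="[]"]
  ultimately show ?thesis by linarith
qed

end

section \<open>Paths leading to a fresh time\<close>

lemma pos_parity: "even (pos xs + int (length xs))"
  by (induction xs) auto

lemma replicate_True:
  "pos (replicate k True @ xs) = pos xs + int k"
  "mx (replicate k True @ xs) = max (mx xs) (pos xs + int k)"
  using pos_le_mx[of xs] by (induction k) auto

lemma new_max_replicate: "mx xs < pos xs + int (Suc k) \<Longrightarrow> new_max (replicate (Suc k) True @ xs)"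
  using pos_le_mx[of xs] by (auto simp: replicate_True)

lemma nonneg_path_replicate: "nonneg_path xs \<Longrightarrow> nonneg_path (replicate k True @ xs)"
  using nonneg_path_pos[of xs] by (induction k) (auto simp: replicate_True)

primrec bounce :: "nat \<Rightarrow> bool list" where
  "bounce 0 = []"
| "bounce (Suc k) = True # False # bounce k"

lemma bounce_facts: "length (bounce k) = 2 * k \<and> pos (bounce k @ ys) = pos ys \<and> mx (bounce k @ ys) = mx ys
   \<and> (1 \<le> pos ys \<longrightarrow> nonneg_path ys \<longrightarrow> nonneg_path (bounce k @ ys))"
  using pos_le_mx[of ys] by (induction k) auto

lemma fresh_swap: "fresh xs ys \<longleftrightarrow> fresh ys xs"
  by (auto simp: fresh_def)

lemma peak_swap: "peak xs ys = peak ys xs"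
  by (simp add: peak_def)

text \<open>Equal lengths give equal parities. The lagging walker climbs the even gap while the
  other one bounces down and up, which makes no new maximum; then both climb together to the level
  above the overall maximum.\<close>

lemma fresh_path:
  assumes alive_ind: "alive xs ys" and R: "peak xs ys - pos xs \<le> int R" "peak xs ys - pos ys \<le> int R"
  obtains u w k where "length u = Suc k" "length w = Suc k" "k \<le> 2 * R" "alive (u @ xs) (w @ ys)" "fresh (u @ xs) (w @ ys)"
proof -
  have key: "\<exists>u w k. length u = Suc k \<and> length w = Suc k \<and> k \<le> 2 * R \<and> alive (u @ xs) (w @ ys) \<and> fresh (u @ xs) (w @ ys)"
    if alive_ind: "alive xs ys" and R: "peak xs ys - pos xs \<le> int R" "peak xs ys - pos ys \<le> int R" and le: "pos xs \<le> pos ys" for xs ys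
  proof -
    have "length xs = length ys" "nonneg_path xs" "nonneg_path ys" using alive_ind by (auto simp: alive_def)
    then have "even (pos ys - pos xs)" using pos_parity[of xs] pos_parity[of ys] by presburger
    then obtain e where "pos ys - pos xs = 2 * e" by (elim evenE)
    then obtain d where d: "pos ys - pos xs = 2 * int d" using le by (intro that[of "nat e"]) auto
    define x1 where "x1 = replicate (2 * d) True @ xs"
    define y1 where "y1 = bounce d @ ys"
    have 1: "pos x1 = pos ys" "pos y1 = pos ys" "mx y1 = mx ys" "mx x1 \<le> peak xs ys" "mx y1 \<le> peak xs ys"
      using d bounce_facts[of d ys] pos_le_mx[of ys] by (auto simp: x1_def y1_def replicate_True peak_def)
    have "nonneg_path y1"
    proof (cases "d = 0")
      case False
      then have "1 \<le> pos ys" using d \<open>nonneg_path xs\<close> nonneg_path_pos[of xs] by auto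
      then show ?thesis using bounce_facts[of d ys] \<open>nonneg_path ys\<close> by (simp add: y1_def)
    qed (simp add: y1_def \<open>nonneg_path ys\<close>)
    moreover have "nonneg_path x1" using \<open>nonneg_path xs\<close> nonneg_path_replicate by (simp add: x1_def)
    ultimately have n1: "nonneg_path x1" "nonneg_path y1" by auto
    define j where "j = nat (peak xs ys - pos ys)"
    have "pos ys \<le> peak xs ys" using pos_le_mx[of ys] by (auto simp: peak_def)
    then have j: "int j = peak xs ys - pos ys" by (simp add: j_def)
    define u where "u = replicate (Suc j) True @ replicate (2 * d) True"
    define w where "w = replicate (Suc j) True @ bounce d"
    have uw: "u @ xs = replicate (Suc j) True @ x1" "w @ ys = replicate (Suc j) True @ y1"
      by (simp_all add: u_def w_def x1_def y1_def)
    have l: "length u = Suc (j + 2 * d)" "length w = Suc (j + 2 * d)"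
      using bounce_facts[of d ys] by (simp_all add: u_def w_def)
    have "int (j + 2 * d) \<le> 2 * int R" using R d j by simp
    then have k: "j + 2 * d \<le> 2 * R" by linarith
    have "fresh (u @ xs) (w @ ys)" unfolding uw fresh_def
      using 1 j by (intro conjI new_max_replicate) (auto simp: replicate_True simp del: replicate.simps)
    moreover have "alive (u @ xs) (w @ ys)"
      using n1 nonneg_path_replicate[of x1 "Suc j"] nonneg_path_replicate[of y1 "Suc j"] \<open>length xs = length ys\<close> bounce_facts[of d ys]
      unfolding alive_def uw by (simp add: x1_def y1_def del: replicate.simps)
    ultimately show ?thesis using l k by blast
  qed
  show ?thesis
  proof (cases "pos xs \<le> pos ys")
    case True
    then show ?thesis using key[OF alive_ind R] that by blast
  next
    case False
    then obtain u w k where "length u = Suc k" "length w = Suc k" "k \<le> 2 * R" "alive (u @ ys) (w @ xs)" "fresh (u @ ys) (w @ xs)"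
      using key[of ys xs] alive_ind R by (auto simp: alive_swap peak_swap)
    then show ?thesis using that[of w k u] by (simp add: alive_swap fresh_swap)
  qed
qed

lemma alive_append: "length u = length w \<Longrightarrow> alive (u @ xs) (w @ ys) \<Longrightarrow> alive xs ys"
  using nonneg_path_append_pos by (auto simp: alive_def)

context band
begin

definition step_min :: real where "step_min = (1 - p1)\<^sup>2"

lemma step_min: "0 < step_min" "step_min \<le> 1"
  using p1 p0 p01 by (auto simp: step_min_def power_le_one)

lemma pathE_first_step:
  assumes q: "q \<in> {p0..p1}" and F: "\<And>a b. 0 \<le> F a b"
  shows "step_min * F (a # xs) (b # ys) \<le> stepE q F xs ys"
  using pathE_path[of F q p1 "[a]" 1 "[b]" xs ys] F q p0 p1 by (simp add: step_min_def)

text \<open>Follow the prescribed path to its first fresh state. Until then the process keeps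
  waiting, and a shorter prefix is only more likely.\<close>

lemma fresh_prob:
  assumes q: "q \<in> {p0..p1}"
  shows "length u = Suc k \<Longrightarrow> length w = Suc k \<Longrightarrow> alive (u @ xs) (w @ ys) \<Longrightarrow> fresh (u @ xs) (w @ ys)
    \<Longrightarrow> run_mode N xs ys = None \<Longrightarrow> step_min ^ Suc k \<le> (\<Sum>j<Suc k. pathE q j (fresh_rate N q) xs ys)"
proof (induction k arbitrary: u w xs ys)
  case 0
  then obtain a b where ab: "u = [a]" "w = [b]" by (auto simp: length_Suc_conv)
  have "step_min * (alive_ind (a # xs) (b # ys) * of_bool (fresh (a # xs) (b # ys))) \<le> stepE q (\<lambda>a b. alive_ind a b * of_bool (fresh a b)) xs ys"
    by (rule pathE_first_step[OF q]) (auto simp: alive_ind_cases)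
  moreover have "alive xs ys" using 0 ab alive_Cons by auto
  ultimately show ?case using 0 ab by (simp add: fresh_rate_def alive_ind_def scanning_def)
next
  case (Suc k)
  obtain u' a where u: "u = u' @ [a]" using Suc.prems by (cases u rule: rev_cases) auto
  obtain w' b where w: "w = w' @ [b]" using Suc.prems by (cases w rule: rev_cases) auto
  have l: "length u' = Suc k" "length w' = Suc k" using Suc.prems u w by auto
  have a1: "alive (a # xs) (b # ys)" using Suc.prems u w l alive_append[of u' w' "a # xs" "b # ys"] by simp
  then have a0: "alive xs ys" by (rule alive_Cons)
  have f0: "0 \<le> pathE q j (fresh_rate N q) xs ys" for j xs ys by (intro pathE_nonneg_band[OF q] fresh_rate_nonneg[OF q])
  show ?case
  proof (cases "fresh (a # xs) (b # ys)")
    case True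
    have "step_min ^ Suc (Suc k) \<le> step_min ^ 1" using step_min by (intro power_decreasing) auto
    also have "step_min ^ 1 = step_min * (alive_ind (a # xs) (b # ys) * of_bool (fresh (a # xs) (b # ys)))" using True a1 by (simp add: alive_ind_def)
    also have "\<dots> \<le> stepE q (\<lambda>a b. alive_ind a b * of_bool (fresh a b)) xs ys"
      by (rule pathE_first_step[OF q]) (auto simp: alive_ind_cases)
    also have "\<dots> = pathE q 0 (fresh_rate N q) xs ys" using a0 Suc.prems by (simp add: fresh_rate_def alive_ind_def scanning_def)
    also have "\<dots> \<le> (\<Sum>j<Suc (Suc k). pathE q j (fresh_rate N q) xs ys)" using f0 by (intro member_le_sum) auto
    finally show ?thesis .
  next
    case False
    then have "run_mode N (a # xs) (b # ys) = None" using Suc.prems by simp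
    then have "step_min ^ Suc k \<le> (\<Sum>j<Suc k. pathE q j (fresh_rate N q) (a # xs) (b # ys))"
      using Suc.IH[OF l, of "a # xs" "b # ys"] Suc.prems u w by simp
    then have "step_min ^ Suc (Suc k) \<le> step_min * (\<Sum>j<Suc k. pathE q j (fresh_rate N q) (a # xs) (b # ys))" using step_min by simp
    also have "\<dots> \<le> stepE q (\<lambda>a b. \<Sum>j<Suc k. pathE q j (fresh_rate N q) a b) xs ys"
      by (rule pathE_first_step[OF q]) (intro sum_nonneg f0)
    also have "\<dots> = (\<Sum>j<Suc k. pathE q (Suc j) (fresh_rate N q) xs ys)" by (simp add: stepE_sum del: sum.lessThan_Suc)
    also have "\<dots> \<le> (\<Sum>j<Suc (Suc k). pathE q j (fresh_rate N q) xs ys)" using f0[of 0] by (subst (2) sum.lessThan_Suc_shift) simp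
    finally show ?thesis .
  qed
qed

section \<open>Time between runs\<close>

definition near :: "nat \<Rightarrow> bool list \<Rightarrow> bool list \<Rightarrow> bool" where
  "near R a b \<longleftrightarrow> peak a b - pos a \<le> int R \<and> peak a b - pos b \<le> int R"

lemma near_fresh:
  assumes q: "q \<in> {p0..p1}" and "alive xs ys" "near R xs ys" "run_mode N xs ys = None"
  shows "step_min ^ (2 * R + 1) \<le> (\<Sum>j<2 * R + 1. pathE q j (fresh_rate N q) xs ys)"
proof -
  obtain u w k where uw: "length u = Suc k" "length w = Suc k" "k \<le> 2 * R" "alive (u @ xs) (w @ ys)" "fresh (u @ xs) (w @ ys)"
    using assms unfolding near_def by (elim conjE) (rule fresh_path)
  have "step_min ^ (2 * R + 1) \<le> step_min ^ Suc k" using step_min uw by (intro power_decreasing) auto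
  also have "\<dots> \<le> (\<Sum>j<Suc k. pathE q j (fresh_rate N q) xs ys)" using fresh_prob[OF q] uw assms by blast
  also have "\<dots> \<le> (\<Sum>j<2 * R + 1. pathE q j (fresh_rate N q) xs ys)"
    using uw by (intro sum_mono2 pathE_nonneg_band[OF q] fresh_rate_nonneg[OF q]) auto
  finally show ?thesis .
qed

text \<open>Each waiting time in a \<open>near\<close> state has a fixed chance that a run starts
  within \<open>2 * R + 1\<close> steps, and one start serves at most that many waiting times. So
  such states are rare because runs are.\<close>

lemma near_scan_sum:
  assumes q: "q \<in> {p0..p1}"
  shows "step_min ^ (2 * R + 1) * sumE q n (\<lambda>a b. alive_ind a b * scanning N a b * of_bool (near R a b)) [] []
    \<le> real (2 * R + 1) * run_count N q (n + (2 * R + 1))"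
proof -
  let ?K = "2 * R + 1"
  have f0: "0 \<le> pathE q j (fresh_rate N q) xs ys" for j xs ys by (intro pathE_nonneg_band[OF q] fresh_rate_nonneg[OF q])
  have pw: "step_min ^ ?K * (alive_ind a b * scanning N a b * of_bool (near R a b)) \<le> (\<Sum>j<?K. pathE q j (fresh_rate N q) a b)" for a b
  proof (cases "alive a b \<and> run_mode N a b = None \<and> near R a b")
    case True
    then show ?thesis using near_fresh[OF q, of a b R N] by (simp add: alive_ind_def scanning_def)
  next
    case False
    then have z: "alive_ind a b * scanning N a b * of_bool (near R a b) = 0" by (auto simp: alive_ind_def scanning_def)
    have "0 \<le> (\<Sum>j<?K. pathE q j (fresh_rate N q) a b)" by (intro sum_nonneg f0)
    then show ?thesis by (simp only: z mult_zero_right)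
  qed
  have "step_min ^ ?K * sumE q n (\<lambda>a b. alive_ind a b * scanning N a b * of_bool (near R a b)) [] []
     = sumE q n (\<lambda>a b. step_min ^ ?K * (alive_ind a b * scanning N a b * of_bool (near R a b))) [] []"
    by (simp only: pathE_cmult sum_distrib_left)
  also have "\<dots> \<le> sumE q n (\<lambda>a b. \<Sum>j<?K. pathE q j (fresh_rate N q) a b) [] []"
    by (intro sum_mono pathE_mono_band[OF q] pw)
  also have "\<dots> = (\<Sum>j<?K. \<Sum>t<n. pathE q (t + j) (fresh_rate N q) [] [])"
    unfolding pathE_sum by (subst sum.swap) (simp only: pathE_pathE)
  also have "\<dots> \<le> (\<Sum>j<?K. run_count N q (n + ?K))"
  proof (rule sum_mono)
    fix j assume j: "j \<in> {..<?K}"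
    have "(\<Sum>t<n. pathE q (t + j) (fresh_rate N q) [] []) = (\<Sum>t\<in>(\<lambda>t. t + j) ` {..<n}. pathE q t (fresh_rate N q) [] [])"
      by (subst sum.reindex) (auto simp: inj_on_def)
    also have "\<dots> \<le> run_count N q (n + ?K)" unfolding run_count_def using j f0 by (intro sum_mono2) auto
    finally show "(\<Sum>t<n. pathE q (t + j) (fresh_rate N q) [] []) \<le> run_count N q (n + ?K)" .
  qed
  also have "\<dots> = real ?K * run_count N q (n + ?K)" by simp
  finally show ?thesis .
qed

text \<open>While the other walker is far away, the leading walker is a simple random walk above its
  starting level, so it gains only \<open>O(sqrt k)\<close> levels in \<open>k\<close> steps.\<close>

definition new_far :: "nat \<Rightarrow> bool list \<Rightarrow> bool list \<Rightarrow> bool list \<Rightarrow> bool list \<Rightarrow> bool" where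
  "new_far R xs ys a b \<longleftrightarrow> peak xs ys < peak a b \<and> \<not> near R a b"

definition new_far_rate :: "nat \<Rightarrow> real \<Rightarrow> bool list \<Rightarrow> bool list \<Rightarrow> real" where
  "new_far_rate R q xs ys = stepE q (\<lambda>a b. of_bool (new_far R xs ys a b)) xs ys"

lemma new_far_rate_nonneg: "q \<in> {p0..p1} \<Longrightarrow> 0 \<le> new_far_rate R q xs ys"
  unfolding new_far_rate_def using stepE_mono_band[of q "\<lambda>_ _. 0" xs ys "\<lambda>a b. of_bool (new_far R xs ys a b)"] by simp

lemma new_far_rate_sum_le:
  assumes q: "q \<in> {p0..p1}"
  shows "(\<Sum>j<k. pathE q j (new_far_rate R q) xs ys) \<le> pathE q k (\<lambda>a b. real_of_int (peak a b)) xs ys - real_of_int (peak xs ys)"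
proof -
  let ?V = "\<lambda>a b. - 1 * real_of_int (peak a b)"
  have "stepE q ?V a b + new_far_rate R q a b \<le> ?V a b + 0" for a b
  proof -
    have "new_far_rate R q a b \<le> stepE q (\<lambda>x y. real_of_int (peak x y) - real_of_int (peak a b)) a b"
      unfolding new_far_rate_def
    proof (rule stepE_mono_band[OF q])
      fix x y
      show "of_bool (new_far R a b (x # a) (y # b)) \<le> real_of_int (peak (x # a) (y # b)) - real_of_int (peak a b)"
        using peak_step(1)[of a b x y] by (auto simp: new_far_def simp del: mx.simps)
    qed
    then show ?thesis by (simp only: stepE_cmult stepE_diff stepE_const)
  qed
  from pathE_telescope[OF _ _ this, where n=k and xs=xs and ys=ys] q show ?thesis
    unfolding pathE_cmult by (simp add: band_q)
qed

lemma height_step: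
  assumes q: "q \<in> {p0..p1}" and c: "mx ys < c"
  shows "stepE q (\<lambda>a b. of_int ((max 0 (pos a - c))\<^sup>2)) xs ys \<le> of_int ((max 0 (pos xs - c))\<^sup>2) + 1"
proof (cases "c \<le> pos xs")
  case True
  define z h :: real where "z = of_int (pos xs - c)" and "h = real_of_int ((max 0 (pos (False # xs) - c))\<^sup>2)"
  have h: "h \<le> (z - 1)\<^sup>2"
    using True by (cases "pos xs = c") (auto simp: z_def h_def)
  have e: "real_of_int ((max 0 (pos (True # xs) - c))\<^sup>2) = (z + 1)\<^sup>2" "real_of_int ((max 0 (pos xs - c))\<^sup>2) = z\<^sup>2"
    using True by (auto simp: z_def)
  have u: "up_prob q xs ys = 1/2" using up_prob_above[of ys xs q] c True by simp
  have "(z + 1)\<^sup>2 + (z - 1)\<^sup>2 = 2 * z\<^sup>2 + 2" by (simp add: power2_eq_square algebra_simps)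
  then show ?thesis using h unfolding stepE_fst e u h_def[symmetric] by simp
next
  case False
  then have "max 0 (pos (True # xs) - c) = 0" "max 0 (pos (False # xs) - c) = 0" "max 0 (pos xs - c) = 0" by auto
  then show ?thesis unfolding stepE_fst by (simp del: pos.simps)
qed

definition height_sq :: "int \<Rightarrow> bool list \<Rightarrow> bool list \<Rightarrow> real" where
  "height_sq c a b = real_of_int ((max 0 (pos a - c))\<^sup>2) + real_of_int ((deficit a)\<^sup>2)"

text \<open>The second assumption keeps the other walker below \<open>c\<close> during all
  \<open>k\<close> steps, so that steps from \<open>c\<close> and above remain fair.\<close>

lemma height_sq_pathE:
  assumes q: "q \<in> {p0..p1}"
  shows "mx ys < c \<Longrightarrow> pos ys + int k < c \<Longrightarrow> pathE q k (height_sq c) xs ys \<le> height_sq c xs ys + 2 * real k"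
proof (induction k arbitrary: xs ys)
  case (Suc k)
  have "pathE q k (height_sq c) (a # xs) (b # ys) \<le> height_sq c (a # xs) (b # ys) + 2 * real k" for a b
    using Suc.prems by (intro Suc.IH) auto
  then have "stepE q (pathE q k (height_sq c)) xs ys \<le> stepE q (\<lambda>a b. height_sq c a b + 2 * real k) xs ys" by (rule stepE_mono_band[OF q])
  also have "\<dots> = stepE q (height_sq c) xs ys + 2 * real k" by (simp add: stepE_add)
  also have "stepE q (height_sq c) xs ys \<le> height_sq c xs ys + 2"
    using height_step[OF q Suc.prems(1), of xs] deficit_step[OF q, of xs ys]
    unfolding height_sq_def[abs_def] stepE_add by linarith
  finally show ?case by simp
qed simp

lemma append_bounds: "pos (w @ ys) \<le> pos ys + int (length w)" "mx (w @ ys) \<le> max (mx ys) (pos ys + int (length w))"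
proof -
  show "pos (w @ ys) \<le> pos ys + int (length w)" by (induction w) auto
  show "mx (w @ ys) \<le> max (mx ys) (pos ys + int (length w))"
  proof (induction w)
    case (Cons b w)
    have "pos (w @ ys) \<le> pos ys + int (length w)" by (induction w) auto
    then show ?case using Cons by auto
  qed simp
qed

lemma mx_append_ge: "mx xs \<le> mx (u @ xs)"
  by (induction u) auto

text \<open>The maximum exceeds \<open>c\<close> by at most the height above \<open>c\<close> plus
  the deficit. The sum of their squares has mean at most \<open>2 * k\<close>, and the
  arithmetic-geometric inequality with scale \<open>sqrt k\<close> turns this into a bound on the
  sum.\<close>

lemma peak_growth:
  assumes q: "q \<in> {p0..p1}" and x: "pos xs = c" "mx xs = c" and y: "mx ys < c" "pos ys + int k < c"
  shows "pathE q k (\<lambda>a b. real_of_int (peak a b)) xs ys \<le> of_int c + 2 * sqrt (real k)"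
proof (cases "k = 0")
  case True
  then show ?thesis using x y by (simp add: peak_def)
next
  case False
  define s where "s = sqrt (real k)"
  have s: "0 < s" "s\<^sup>2 = real k" using False by (simp_all add: s_def)
  have am: "h \<le> h\<^sup>2 / (2 * s) + s / 2" for h
  proof -
    have "2 * s * h \<le> h\<^sup>2 + s\<^sup>2" using zero_le_power2[of "h - s"] by (simp add: power2_eq_square algebra_simps)
    then have "h \<le> (h\<^sup>2 + s\<^sup>2) / (2 * s)" using s(1) by (simp add: field_simps)
    also have "\<dots> = h\<^sup>2 / (2 * s) + s / 2" using s(1) by (simp add: add_divide_distrib power2_eq_square)
    finally show ?thesis .
  qed
  have "pathE q k (\<lambda>a b. real_of_int (peak a b)) xs ys \<le> pathE q k (\<lambda>a b. 1 / (2 * s) * height_sq c a b + (s + of_int c)) xs ys"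
  proof (rule pathE_mono_len)
    fix u w :: "bool list" assume l: "length u = k" "length w = k"
    define A where "A = u @ xs"
    have "mx (w @ ys) < c" using append_bounds(2)[of w ys] l y by auto
    moreover have "c \<le> mx A" using mx_append_ge[of xs u] x by (simp add: A_def)
    ultimately have b: "peak A (w @ ys) = mx A" by (simp add: peak_def)
    have "mx A = deficit A + pos A" by (simp add: deficit_def)
    then have "mx A \<le> c + max 0 (pos A - c) + deficit A" by simp
    then have "real_of_int (mx A) \<le> of_int c + of_int (max 0 (pos A - c)) + of_int (deficit A)" by linarith
    also have "\<dots> \<le> 1 / (2 * s) * height_sq c A (w @ ys) + (s + of_int c)"
      using am[of "of_int (max 0 (pos A - c))"] am[of "of_int (deficit A)"]
      by (simp add: height_sq_def distrib_left del: of_int_max)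
    finally show "real_of_int (peak (u @ xs) (w @ ys)) \<le> 1 / (2 * s) * height_sq c (u @ xs) (w @ ys) + (s + of_int c)"
      by (simp add: b A_def[symmetric])
  qed (use q in \<open>auto simp: band_q\<close>)
  also have "\<dots> = 1 / (2 * s) * pathE q k (height_sq c) xs ys + (s + of_int c)"
    by (simp only: pathE_add pathE_cmult pathE_const)
  also have "\<dots> \<le> 1 / (2 * s) * (2 * real k) + (s + of_int c)"
    using height_sq_pathE[OF q y, of xs] x s by (intro add_right_mono mult_left_mono) (auto simp: height_sq_def deficit_def)
  also have "\<dots> = of_int c + 2 * s"
  proof -
    have "real k / s = s" using s by (metis nonzero_mult_div_cancel_right power2_eq_square less_irrefl)
    moreover have "1 / (2 * s) * (2 * real k) = real k / s" by simp
    ultimately have "1 / (2 * s) * (2 * real k) = s" by (rule trans[rotated])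
    then show ?thesis by simp
  qed
  finally show ?thesis by (simp add: s_def)
qed

text \<open>A new overall maximum is held by a walker standing on it; the other one, more than
  \<open>R\<close> below, cannot catch up within \<open>k\<close> steps.\<close>

lemma new_far_bound:
  assumes q: "q \<in> {p0..p1}" and new_far_rate: "new_far R xs ys (a # xs) (b # ys)" and k: "k \<le> R"
  shows "(\<Sum>j<k. pathE q j (new_far_rate R q) (a # xs) (b # ys)) \<le> 2 * sqrt (real R)"
proof -
  define A B c where "A = a # xs" and "B = b # ys" and "c = peak A B"
  have m: "mx A = mx xs + of_bool (new_max A)" "mx B = mx ys + of_bool (new_max B)" unfolding A_def B_def by (rule mx_Cons_new_max)+
  have old: "mx xs < c" "mx ys < c" using new_far_rate by (auto simp: new_far_def A_def B_def c_def peak_def)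
  have far: "pos A + int R < c \<or> pos B + int R < c" using new_far_rate by (auto simp: new_far_def near_def A_def B_def c_def)
  have bc: "peak A B = c" by (simp add: c_def)
  have lt: "mx A < c" if "pos A < c" using that old m new_max_imp[of A] by (cases "new_max A") auto
  have lt': "mx B < c" if "pos B < c" using that old m new_max_imp[of B] by (cases "new_max B") auto
  have top: "pos A = c" if "mx A = c" using that old m new_max_imp[of A] by (cases "new_max A") auto
  have top': "pos B = c" if "mx B = c" using that old m new_max_imp[of B] by (cases "new_max B") auto
  have "pathE q k (\<lambda>a b. real_of_int (peak a b)) A B \<le> of_int c + 2 * sqrt (real k)"
    using far
  proof
    assume f: "pos B + int R < c"
    then have "mx B < c" by (intro lt') auto
    moreover then have "mx A = c" using bc by (auto simp: peak_def)
    ultimately show ?thesis using f k by (intro peak_growth[OF q] top) auto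
  next
    assume f: "pos A + int R < c"
    then have "mx A < c" by (intro lt) auto
    moreover then have "mx B = c" using bc by (auto simp: peak_def)
    ultimately have "pathE q k (\<lambda>a b. real_of_int (peak a b)) B A \<le> of_int c + 2 * sqrt (real k)"
      using f k by (intro peak_growth[OF q] top') auto
    then show ?thesis by (subst pathE_swap) (simp add: peak_swap)
  qed
  moreover have "sqrt (real k) \<le> sqrt (real R)" using k by simp
  ultimately show ?thesis using new_far_rate_sum_le[OF q, where k=k and R=R and xs=A and ys=B]
    unfolding bc unfolding A_def B_def by linarith
qed

text \<open>Wait for the first new far level of the block: it counts one, and
  \<open>new_far_bound\<close> covers the steps after it.\<close>

lemma new_far_block_sum:
  assumes q: "q \<in> {p0..p1}"
  shows "k \<le> R \<Longrightarrow> (\<Sum>j<k. pathE q j (new_far_rate R q) xs ys) \<le> 1 + 2 * sqrt (real R)"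
proof (induction k arbitrary: xs ys)
  case (Suc k)
  define S where "S = (\<lambda>a b. \<Sum>j<k. pathE q j (new_far_rate R q) a b)"
  have "(\<Sum>j<Suc k. pathE q j (new_far_rate R q) xs ys) = new_far_rate R q xs ys + stepE q S xs ys"
    by (subst sum.lessThan_Suc_shift) (simp add: S_def stepE_sum)
  also have "\<dots> = stepE q (\<lambda>a b. of_bool (new_far R xs ys a b) + S a b) xs ys" by (simp add: new_far_rate_def stepE_add)
  also have "\<dots> \<le> stepE q (\<lambda>_ _. 1 + 2 * sqrt (real R)) xs ys"
  proof (rule stepE_mono_band[OF q])
    fix a b
    show "of_bool (new_far R xs ys (a # xs) (b # ys)) + S (a # xs) (b # ys) \<le> 1 + 2 * sqrt (real R)"
    proof (cases "new_far R xs ys (a # xs) (b # ys)")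
      case True
      then show ?thesis using new_far_bound[OF q True, of k] Suc.prems by (simp add: S_def)
    next
      case False
      then show ?thesis using Suc.IH[of "a # xs" "b # ys"] Suc.prems by (simp add: S_def)
    qed
  qed
  finally show ?case by simp
qed simp

lemma new_far_rate_sum:
  assumes q: "q \<in> {p0..p1}" and R: "1 \<le> R"
  shows "sumE q n (new_far_rate R q) [] [] \<le> (real n / real R + 1) * (1 + 2 * sqrt (real R))"
proof -
  have n0: "0 \<le> pathE q t (new_far_rate R q) xs ys" for t xs ys by (intro pathE_nonneg_band[OF q] new_far_rate_nonneg[OF q])
  have blocks: "(\<Sum>t<i * R. pathE q t (new_far_rate R q) [] []) \<le> real i * (1 + 2 * sqrt (real R))" for i
  proof (induction i)
    case (Suc i)
    have "(\<Sum>t<i * R + R. pathE q t (new_far_rate R q) [] []) = (\<Sum>t<i * R. pathE q t (new_far_rate R q) [] []) + (\<Sum>t\<in>{i * R..<i * R + R}. pathE q t (new_far_rate R q) [] [])"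
      by (subst sum.union_disjoint[symmetric]) (auto intro!: sum.cong)
    also have "(\<Sum>t\<in>{i * R..<i * R + R}. pathE q t (new_far_rate R q) [] []) = (\<Sum>j<R. pathE q (i * R + j) (new_far_rate R q) [] [])"
      by (rule sum.reindex_bij_witness[of _ "\<lambda>j. i * R + j" "\<lambda>t. t - i * R"]) auto
    also have "\<dots> = pathE q (i * R) (\<lambda>a b. \<Sum>j<R. pathE q j (new_far_rate R q) a b) [] []"
      unfolding pathE_sum by (simp only: pathE_pathE)
    also have "\<dots> \<le> pathE q (i * R) (\<lambda>_ _. 1 + 2 * sqrt (real R)) [] []"
      by (intro pathE_mono_band[OF q] new_far_block_sum[OF q]) auto
    finally show ?case using Suc by (simp add: algebra_simps)
  qed simp
  define i where "i = n div R + 1"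
  have "n \<le> i * R" using R by (simp add: i_def dividend_less_div_times less_imp_le add.commute)
  then have "sumE q n (new_far_rate R q) [] [] \<le> (\<Sum>t<i * R. pathE q t (new_far_rate R q) [] [])"
    using n0 by (intro sum_mono2) auto
  also have "\<dots> \<le> real i * (1 + 2 * sqrt (real R))" by (rule blocks)
  also have "real i \<le> real n / real R + 1" using of_nat_div_le_of_nat[of n R, where 'a=real] by (simp add: i_def)
  finally show ?thesis by (simp add: mult_right_mono)
qed

end

context band
begin

section \<open>Balance of the potential between runs\<close>

text \<open>The potential is not followed during a run, so the whole of it is charged when waiting
  resumes.\<close>

definition end_cost :: "nat \<Rightarrow> real \<Rightarrow> bool list \<Rightarrow> bool list \<Rightarrow> real" where
  "end_cost N q xs ys = alive_ind xs ys * ((1 - scanning N xs ys) * stepE q (\<lambda>a b. alive_ind a b * (scanning N a b * potential a b)) xs ys)"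

definition scan_cost :: "nat \<Rightarrow> real \<Rightarrow> bool list \<Rightarrow> bool list \<Rightarrow> real" where
  "scan_cost N q xs ys = alive_ind xs ys * (scanning N xs ys * (stepE q (gain xs ys) xs ys + stepE q (swap_cost xs ys) xs ys))"

lemma scan_step:
  assumes q: "q \<in> {p0..p1}"
  shows "stepE q (\<lambda>a b. alive_ind a b * (scanning N a b * potential a b)) xs ys + alive_ind xs ys * scanning N xs ys
    \<le> alive_ind xs ys * (scanning N xs ys * potential xs ys) + (scan_cost N q xs ys + end_cost N q xs ys)"
proof (cases "alive xs ys")
  case False
  then show ?thesis by (simp add: stepE_dead) (simp add: alive_ind_def scan_cost_def end_cost_def)
next
  case True
  show ?thesis
  proof (cases "scanning N xs ys = 1")
    case s: True
    have "stepE q (\<lambda>a b. alive_ind a b * (scanning N a b * potential a b)) xs ys \<le> stepE q (\<lambda>a b. of_bool (alive a b) * potential a b) xs ys"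
      by (intro stepE_mono_band[OF q]) (auto simp: alive_ind_def potential_nonneg intro!: mult_left_le_one_le scanning_cases)
    then show ?thesis using potential_step[OF q True] True s by (simp add: alive_ind_def scan_cost_def end_cost_def)
  next
    case False
    then have "scanning N xs ys = 0" using scanning_cases(1) by metis
    then show ?thesis using True by (simp add: alive_ind_def scan_cost_def end_cost_def)
  qed
qed

lemma scan_le:
  assumes q: "q \<in> {p0..p1}"
  shows "scan_time N q n \<le> 4 + sumE q n (scan_cost N q) [] [] + sumE q n (end_cost N q) [] []"
proof -
  have "sumE q n (\<lambda>a b. alive_ind a b * scanning N a b) [] []
     \<le> alive_ind [] [] * (scanning N [] [] * potential [] []) + sumE q n (\<lambda>a b. scan_cost N q a b + end_cost N q a b) [] []"
    by (rule pathE_telescope_le[OF _ _ scan_step[OF q]])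
       (use q in \<open>auto simp: band_q intro!: mult_nonneg_nonneg alive_ind_cases scanning_cases potential_nonneg\<close>)
  moreover have "alive_ind [] [] * (scanning N [] [] * potential [] []) \<le> 4"
    by (simp add: alive_ind_def scanning_def potential_def lower_def upper_def Phi_def cross_ext_def)
  ultimately show ?thesis by (simp add: scan_time_def pathE_add sum.distrib)
qed

definition unit_weight :: "int \<Rightarrow> real" where "unit_weight = (\<lambda>_. 1)"

lemma level_charge_one: "level_charge M 0 k unit_weight u = of_bool (new_max u) * (k * cube_sum M (mx u) u)"
  by (simp add: level_charge_def unit_weight_def)

text \<open>In a \<open>near\<close> state the main terms are constants, to be charged to the runs.
  Otherwise a new overall maximum is counted by \<open>new_far\<close>, and at an exchange the
  deficit of the lower walker is at least \<open>R\<close>, so that its square pays with a small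
  factor. \<open>A1\<close> and \<open>A2\<close> are the thresholds for near exchanges and for
  gains, \<open>e\<close> is the slope for far exchanges.\<close>

lemma cost_pointwise:
  assumes e: "0 < e" and A: "0 < A1" "0 < A2" and R: "1 \<le> R"
  defines "K1 \<equiv> 4 + A2 + 2 * A1 * (real R + 1)" and "k0 \<equiv> 1 / A2\<^sup>2 + 2 * (real R + 1)\<^sup>2 / A1\<^sup>2"
  shows "gain xs ys (x # xs) (y # ys) + swap_cost xs ys (x # xs) (y # ys)
    \<le> K1 * (alive_ind (x # xs) (y # ys) * of_bool (near R (x # xs) (y # ys)))
      + (2 + A2) * of_bool (new_far R xs ys (x # xs) (y # ys))
      + (12 * e + 2 / (real R)\<^sup>2) * (of_bool (swapped xs ys (x # xs) (y # ys)) * of_int ((deficit (lower (x # xs) (y # ys)))\<^sup>2))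
      + ((level_charge 0 0 k0 unit_weight (x # xs) + level_charge 0 0 k0 unit_weight (y # ys))
        + (level_charge (real R) 0 (2 / e\<^sup>2) unit_weight (x # xs) + level_charge (real R) 0 (2 / e\<^sup>2) unit_weight (y # ys)))"
proof -
  define a b where "a = x # xs" and "b = y # ys"
  define u where "u = (if mx xs \<le> mx ys then b else a)"
  have e2: "0 \<le> 2 / e\<^sup>2" using e by simp
  have k: "0 \<le> 1 / A2\<^sup>2" "0 \<le> 2 * (real R + 1)\<^sup>2 / A1\<^sup>2" using A by auto
  have m: "mx a = mx xs + of_bool (new_max a)" "mx b = mx ys + of_bool (new_max b)" unfolding a_def b_def by (rule mx_Cons_new_max)+
  let ?nr = "alive_ind a b * of_bool (near R a b) :: real"
  have g: "gain xs ys a b \<le> (2 + A2) * ?nr + (2 + A2) * of_bool (new_far R xs ys a b) + level_charge 0 0 (1 / A2\<^sup>2) unit_weight u"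
  proof (cases "alive a b \<and> new_max u")
    case True
    then have "peak xs ys < peak a b" using m by (auto simp: u_def peak_def split: if_splits)
    then have "1 \<le> ?nr + of_bool (new_far R xs ys a b)" using True by (auto simp: alive_ind_def new_far_def)
    then have "(2 + A2) * 1 \<le> (2 + A2) * (?nr + of_bool (new_far R xs ys a b))" using A by (intro mult_left_mono) auto
    then show ?thesis using gain_le[OF A(2), of xs ys a b] True
      unfolding u_def[symmetric] by (simp add: level_charge_one distrib_left)
  next
    case False
    then have "gain xs ys a b = 0" by (auto simp: gain_def u_def Let_def)
    moreover have "0 \<le> level_charge 0 0 (1 / A2\<^sup>2) unit_weight u" by (auto simp: level_charge_one cube_sum_nonneg)
    ultimately show ?thesis using A by (auto simp: alive_ind_def)
  qed
  define r where "r = real_of_int (deficit (lower a b))"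
  have r0: "0 \<le> r" using deficit_nonneg by (simp add: r_def)
  let ?h = "upper a b"
  have s: "swap_cost xs ys a b \<le> (2 + 2 * A1 * (real R + 1)) * ?nr
      + (12 * e + 2 / (real R)\<^sup>2) * (of_bool (swapped xs ys a b) * of_int ((deficit (lower a b))\<^sup>2))
      + (level_charge 0 0 (2 * (real R + 1)\<^sup>2 / A1\<^sup>2) unit_weight ?h + level_charge (real R) 0 (2 / e\<^sup>2) unit_weight ?h)"
  proof (cases "alive a b \<and> swapped xs ys a b")
    case False
    moreover have "0 \<le> level_charge 0 0 (2 * (real R + 1)\<^sup>2 / A1\<^sup>2) unit_weight ?h" "0 \<le> level_charge (real R) 0 (2 / e\<^sup>2) unit_weight ?h"
      using k e2 by (auto simp: level_charge_one cube_sum_nonneg)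
    ultimately show ?thesis using A e by (auto simp: swap_cost_def alive_ind_def)
  next
    case True
    have n: "new_max ?h" and yh: "deficit ?h = 0" using True swapped_facts(1,3)[of xs ys x y] by (auto simp: a_def b_def)
    have F0: "0 \<le> cube_sum 0 (mx ?h) ?h" "0 \<le> cube_sum (real R) (mx ?h) ?h" by (rule cube_sum_nonneg)+
    show ?thesis
    proof (cases "near R a b")
      case nr: True
      have "peak a b - pos (lower a b) \<le> int R" using nr by (auto simp: near_def lower_def)
      then have "potential a b \<le> 2 + 2 * (\<Sum>z\<in>{mx ?h - (int R + 1)..mx ?h - 1}. cross ?h z)"
        unfolding potential_def by (intro Phi_window) (auto simp: mx_upper peak_nonneg)
      also have "(\<Sum>z\<in>{mx ?h - (int R + 1)..mx ?h - 1}. cross ?h z)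
         \<le> A1 * of_int (int R + 1) + (of_int (int R + 1))\<^sup>2 * cube_sum 0 (mx ?h) ?h / A1\<^sup>2"
        by (intro window_const A) auto
      finally have "potential a b \<le> (2 + 2 * A1 * (real R + 1)) + level_charge 0 0 (2 * (real R + 1)\<^sup>2 / A1\<^sup>2) unit_weight ?h"
        using n by (simp add: level_charge_one algebra_simps)
      moreover have "0 \<le> (12 * e + 2 / (real R)\<^sup>2) * (of_bool (swapped xs ys a b) * of_int ((deficit (lower a b))\<^sup>2))" using e by simp
      moreover have "0 \<le> level_charge (real R) 0 (2 / e\<^sup>2) unit_weight ?h" using e2 F0 by (simp add: level_charge_one)
      moreover have "swap_cost xs ys a b = potential a b" using True by (simp add: swap_cost_def)
      moreover have n1: "?nr = 1" using True nr by (simp add: alive_ind_def)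
      ultimately show ?thesis unfolding n1 mult_1_right by simp
    next
      case fr: False
      have "pos ?h = mx ?h" using yh by (simp add: deficit_def)
      then have "int R < peak a b - pos (lower a b)" using fr by (auto simp: near_def lower_def upper_def mx_upper peak_def split: if_splits)
      also have "\<dots> \<le> deficit (lower a b) + 1" using swapped_window[of xs ys x y] True by (simp add: a_def b_def)
      finally have "int R \<le> deficit (lower a b)" by simp
      then have rR: "real R \<le> r" by (simp add: r_def)
      have r1: "1 \<le> r" using rR R by linarith
      \<comment> \<open>Since \<open>1 \<le> R \<le> r\<close>, every factor is a multiple of
        \<open>r\<close>; the constant \<open>2\<close> is likewise bounded by
        \<open>2 * r^2 / R^2\<close>.\<close>
      have "(r + 1) * (real R + r + 1) \<le> (2 * r) * (3 * r)" using rR r1 by (intro mult_mono) auto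
      then have "e * ((r + 1) * (real R + r + 1)) \<le> e * (6 * r\<^sup>2)" using e by (intro mult_left_mono) (auto simp: power2_eq_square)
      moreover have "(real R)\<^sup>2 \<le> r\<^sup>2" using rR by (intro power_mono) auto
      then have "2 \<le> 2 / (real R)\<^sup>2 * r\<^sup>2" using R by (simp add: field_simps)
      moreover have "swap_cost xs ys a b \<le> 2 + 2 * (e * (r + 1) * (real R + r + 1) + cube_sum (real R) (mx ?h) ?h / e\<^sup>2)"
        using swap_cost_le[OF e, of "real R" xs ys x y] True by (simp add: a_def b_def r_def)
      ultimately have "swap_cost xs ys a b \<le> (12 * e + 2 / (real R)\<^sup>2) * r\<^sup>2 + 2 / e\<^sup>2 * cube_sum (real R) (mx ?h) ?h"
        by (simp add: algebra_simps)
      moreover have "0 \<le> level_charge 0 0 (2 * (real R + 1)\<^sup>2 / A1\<^sup>2) unit_weight ?h" using k F0 by (simp add: level_charge_one)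
      moreover have "of_bool (swapped xs ys a b) * of_int ((deficit (lower a b))\<^sup>2) = r\<^sup>2" using True by (simp add: r_def)
      moreover have n0: "?nr = 0" using fr by simp
      moreover have "level_charge (real R) 0 (2 / e\<^sup>2) unit_weight ?h = 2 / e\<^sup>2 * cube_sum (real R) (mx ?h) ?h" using n by (simp add: level_charge_one)
      ultimately show ?thesis unfolding n0 mult_zero_right by simp
    qed
  qed
  have c1: "level_charge 0 0 (1 / A2\<^sup>2) unit_weight v + level_charge 0 0 (2 * (real R + 1)\<^sup>2 / A1\<^sup>2) unit_weight v = level_charge 0 0 k0 unit_weight v" for v
    by (simp add: level_charge_one k0_def algebra_simps)
  have cn: "0 \<le> level_charge 0 0 (1 / A2\<^sup>2) unit_weight v" "0 \<le> level_charge 0 0 (2 * (real R + 1)\<^sup>2 / A1\<^sup>2) unit_weight v" "0 \<le> level_charge (real R) 0 (2 / e\<^sup>2) unit_weight v" for v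
    using k e2 by (auto simp: level_charge_one cube_sum_nonneg)
  have c2: "level_charge 0 0 (1 / A2\<^sup>2) unit_weight u + level_charge 0 0 (2 * (real R + 1)\<^sup>2 / A1\<^sup>2) unit_weight ?h \<le> level_charge 0 0 k0 unit_weight a + level_charge 0 0 k0 unit_weight b"
    unfolding c1[symmetric] using cn(1,2)[of a] cn(1,2)[of b] by (auto simp: u_def upper_def)
  have c3: "level_charge (real R) 0 (2 / e\<^sup>2) unit_weight ?h \<le> level_charge (real R) 0 (2 / e\<^sup>2) unit_weight a + level_charge (real R) 0 (2 / e\<^sup>2) unit_weight b"
    using cn(3)[of a] cn(3)[of b] by (auto simp: upper_def)
  have "K1 * ?nr = (2 + A2) * ?nr + (2 + 2 * A1 * (real R + 1)) * ?nr" by (simp add: K1_def algebra_simps)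
  then show ?thesis using g s c2 c3 unfolding a_def[symmetric] b_def[symmetric] by linarith
qed

definition c0 :: real where "c0 = 8 + cube_mean"

lemma level_charge_one_sum:
  assumes q: "q \<in> {p0..p1}" and M: "0 \<le> M" and k: "0 \<le> k"
  shows "sumE q n (stepE q (\<lambda>a b. level_charge M 0 k unit_weight a + level_charge M 0 k unit_weight b)) [] [] \<le> 2 * (real n * (k * (c0 * (2 / (M + 1)))))"
proof -
  have "(\<Sum>m\<in>{0 + 1..0 + int n}. unit_weight m) = real n" by (simp add: unit_weight_def)
  then show ?thesis unfolding pathE_stepE
    using level_charge_sum[where h=unit_weight, OF q M, where n=n and xs="[]" and ys="[]" and ?m0.0=0 and c=c0 and ?k1.0=0 and ?k2.0=k] k cube_bound_Nil
    by (simp add: unit_weight_def c0_def)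
qed

lemma swapped_sum:
  assumes q: "q \<in> {p0..p1}"
  shows "sumE q n (\<lambda>xs ys. stepE q (\<lambda>a b. of_bool (swapped xs ys a b) * of_int ((deficit (lower a b))\<^sup>2)) xs ys) [] [] \<le> real n"
proof -
  have "sumE q n (\<lambda>xs ys. stepE q (\<lambda>a b. of_bool (swapped xs ys a b) * of_int ((deficit (lower a b))\<^sup>2)) xs ys) [] []
     \<le> upper_sq [] [] + sumE q n (\<lambda>_ _. 1) [] []"
  proof (rule pathE_telescope_le[where V=upper_sq and d="\<lambda>_ _. 1"])
    fix xs ys
    show "stepE q upper_sq xs ys + stepE q (\<lambda>a b. of_bool (swapped xs ys a b) * of_int ((deficit (lower a b))\<^sup>2)) xs ys \<le> upper_sq xs ys + 1"
      using upper_sq_step[OF q, of xs ys] by (simp only: stepE_add)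
  qed (use q in \<open>auto simp: band_q upper_sq_def\<close>)
  then show ?thesis by (simp add: upper_sq_def upper_def deficit_def)
qed

text \<open>The cost belongs to the state after the step, which is either still waiting or the start
  of a run.\<close>

lemma near_cost_sum:
  assumes q: "q \<in> {p0..p1}"
  shows "sumE q n (\<lambda>xs ys. alive_ind xs ys * (scanning N xs ys * stepE q (\<lambda>a b. alive_ind a b * of_bool (near R a b)) xs ys)) [] []
    \<le> (\<Sum>t<Suc n. pathE q t (\<lambda>a b. alive_ind a b * scanning N a b * of_bool (near R a b)) [] []) + run_count N q n"
proof -
  let ?H = "\<lambda>a b. alive_ind a b * scanning N a b * of_bool (near R a b)"
  have H: "0 \<le> ?H a b" for a b by (intro mult_nonneg_nonneg alive_ind_cases scanning_cases) auto
  have pw: "alive_ind xs ys * (scanning N xs ys * stepE q (\<lambda>a b. alive_ind a b * of_bool (near R a b)) xs ys) \<le> stepE q ?H xs ys + fresh_rate N q xs ys" for xs ys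
  proof (cases "alive xs ys \<and> run_mode N xs ys = None")
    case True
    have "stepE q (\<lambda>a b. alive_ind a b * of_bool (near R a b)) xs ys \<le> stepE q (\<lambda>a b. ?H a b + alive_ind a b * of_bool (fresh a b)) xs ys"
      using True by (intro stepE_mono_band[OF q]) (auto simp: alive_ind_def scanning_def)
    then show ?thesis using True by (simp add: stepE_add fresh_rate_def alive_ind_def scanning_def)
  next
    case False
    have "0 \<le> stepE q ?H xs ys" using stepE_mono_band[OF q, of "\<lambda>_ _. 0" xs ys ?H] H by simp
    then show ?thesis using False fresh_rate_nonneg[OF q, of N xs ys] by (auto simp: alive_ind_def scanning_def)
  qed
  have "sumE q n (\<lambda>xs ys. alive_ind xs ys * (scanning N xs ys * stepE q (\<lambda>a b. alive_ind a b * of_bool (near R a b)) xs ys)) [] []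
    \<le> sumE q n (\<lambda>a b. stepE q ?H a b + fresh_rate N q a b) [] []"
    by (intro sum_mono pathE_mono_band[OF q] pw)
  also have "\<dots> = (\<Sum>t<n. pathE q (Suc t) ?H [] []) + run_count N q n"
    by (simp only: pathE_add pathE_stepE sum.distrib run_count_def)
  also have "(\<Sum>t<n. pathE q (Suc t) ?H [] []) \<le> (\<Sum>t<Suc n. pathE q t ?H [] [])"
    using H by (subst sum.lessThan_Suc_shift) simp
  finally show ?thesis by simp
qed

lemma scan_cost_sum:
  assumes q: "q \<in> {p0..p1}" and e: "0 < e" and A: "0 < A1" "0 < A2" and R: "1 \<le> R"
  defines "K1 \<equiv> 4 + A2 + 2 * A1 * (real R + 1)" and "k0 \<equiv> 1 / A2\<^sup>2 + 2 * (real R + 1)\<^sup>2 / A1\<^sup>2"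
  shows "sumE q n (scan_cost N q) [] []
    \<le> K1 * ((\<Sum>t<Suc n. pathE q t (\<lambda>a b. alive_ind a b * scanning N a b * of_bool (near R a b)) [] []) + run_count N q n)
      + (2 + A2) * ((real n / real R + 1) * (1 + 2 * sqrt (real R)))
      + (12 * e + 2 / (real R)\<^sup>2) * real n
      + (2 * (real n * (k0 * (c0 * 2))) + 2 * (real n * (2 / e\<^sup>2 * (c0 * (2 / (real R + 1))))))"
proof -
  define f1 where "f1 = (\<lambda>xs ys. alive_ind xs ys * (scanning N xs ys * stepE q (\<lambda>a b. alive_ind a b * of_bool (near R a b)) xs ys))"
  define f3 where "f3 = (\<lambda>xs ys. stepE q (\<lambda>a b. of_bool (swapped xs ys a b) * real_of_int ((deficit (lower a b))\<^sup>2)) xs ys)"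
  define f4 where "f4 = stepE q (\<lambda>a b. level_charge 0 0 k0 unit_weight a + level_charge 0 0 k0 unit_weight b)"
  define f5 where "f5 = stepE q (\<lambda>a b. level_charge (real R) 0 (2 / e\<^sup>2) unit_weight a + level_charge (real R) 0 (2 / e\<^sup>2) unit_weight b)"
  have K1: "0 \<le> K1" and k0: "0 \<le> k0" and e2: "0 \<le> 2 / e\<^sup>2" and e3: "0 \<le> 12 * e + 2 / (real R)\<^sup>2"
    using A e by (auto simp: K1_def k0_def)
  have on: "0 \<le> unit_weight m" for m by (simp add: unit_weight_def)
  have nonneg_path: "0 \<le> f3 xs ys" "0 \<le> f4 xs ys" "0 \<le> f5 xs ys" "0 \<le> new_far_rate R q xs ys" for xs ys
    using stepE_mono_band[OF q, of "\<lambda>_ _. 0" xs ys "\<lambda>a b. of_bool (swapped xs ys a b) * real_of_int ((deficit (lower a b))\<^sup>2)"]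
      stepE_mono_band[OF q, of "\<lambda>_ _. 0" xs ys "\<lambda>a b. level_charge 0 0 k0 unit_weight a + level_charge 0 0 k0 unit_weight b"]
      stepE_mono_band[OF q, of "\<lambda>_ _. 0" xs ys "\<lambda>a b. level_charge (real R) 0 (2 / e\<^sup>2) unit_weight a + level_charge (real R) 0 (2 / e\<^sup>2) unit_weight b"]
      level_charge_nonneg[of unit_weight, OF on order_refl k0] level_charge_nonneg[of unit_weight, OF on order_refl e2] new_far_rate_nonneg[OF q]
    by (simp_all add: f3_def f4_def f5_def)
  have pw: "scan_cost N q xs ys \<le> K1 * f1 xs ys + (2 + A2) * new_far_rate R q xs ys + (12 * e + 2 / (real R)\<^sup>2) * f3 xs ys
      + (f4 xs ys + f5 xs ys)" for xs ys
  proof (cases "alive_ind xs ys * scanning N xs ys = 1")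
    case True
    then have 1: "alive_ind xs ys = 1" "scanning N xs ys = 1" using alive_ind_cases(1)[of xs ys] scanning_cases(1)[of N xs ys] by auto
    have "stepE q (gain xs ys) xs ys + stepE q (swap_cost xs ys) xs ys = stepE q (\<lambda>a b. gain xs ys a b + swap_cost xs ys a b) xs ys"
      by (rule stepE_add[symmetric])
    also have "\<dots> \<le> stepE q (\<lambda>a b. K1 * (alive_ind a b * of_bool (near R a b))
      + (2 + A2) * of_bool (new_far R xs ys a b)
      + (12 * e + 2 / (real R)\<^sup>2) * (of_bool (swapped xs ys a b) * of_int ((deficit (lower a b))\<^sup>2))
      + ((level_charge 0 0 k0 unit_weight a + level_charge 0 0 k0 unit_weight b) + (level_charge (real R) 0 (2 / e\<^sup>2) unit_weight a + level_charge (real R) 0 (2 / e\<^sup>2) unit_weight b))) xs ys"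
      unfolding K1_def k0_def by (intro stepE_mono_band[OF q] cost_pointwise e A R)
    also have "\<dots> = K1 * f1 xs ys + (2 + A2) * new_far_rate R q xs ys + (12 * e + 2 / (real R)\<^sup>2) * f3 xs ys + (f4 xs ys + f5 xs ys)"
      using 1 by (simp only: stepE_add stepE_cmult f1_def f3_def f4_def f5_def new_far_rate_def mult_1)
    finally show ?thesis using 1 by (simp add: scan_cost_def)
  next
    case False
    then have 0: "alive_ind xs ys * scanning N xs ys = 0" using alive_ind_cases(1)[of xs ys] scanning_cases(1)[of N xs ys] by auto
    then have "scan_cost N q xs ys = 0" "f1 xs ys = 0" by (auto simp: scan_cost_def f1_def)
    then show ?thesis using nonneg_path[of xs ys] A e3 by simp
  qed
  have "sumE q n (scan_cost N q) [] [] \<le> sumE q n (\<lambda>xs ys. K1 * f1 xs ys + (2 + A2) * new_far_rate R q xs ys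
      + (12 * e + 2 / (real R)\<^sup>2) * f3 xs ys + (f4 xs ys + f5 xs ys)) [] []"
    by (intro sum_mono pathE_mono_band[OF q] pw)
  also have "\<dots> = K1 * sumE q n f1 [] [] + (2 + A2) * sumE q n (new_far_rate R q) [] []
     + (12 * e + 2 / (real R)\<^sup>2) * sumE q n f3 [] [] + (sumE q n f4 [] [] + sumE q n f5 [] [])"
    by (simp only: pathE_add pathE_cmult sum.distrib sum_distrib_left)
  also have "\<dots> \<le> K1 * ((\<Sum>t<Suc n. pathE q t (\<lambda>a b. alive_ind a b * scanning N a b * of_bool (near R a b)) [] []) + run_count N q n)
      + (2 + A2) * ((real n / real R + 1) * (1 + 2 * sqrt (real R)))
      + (12 * e + 2 / (real R)\<^sup>2) * real n
      + (2 * (real n * (k0 * (c0 * (2 / (0 + 1))))) + 2 * (real n * (2 / e\<^sup>2 * (c0 * (2 / (real R + 1))))))"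
    unfolding f1_def f3_def f4_def f5_def
    using K1 k0 e2 e3 A
    by (intro add_mono mult_left_mono near_cost_sum[OF q] new_far_rate_sum[OF q R] swapped_sum[OF q] level_charge_one_sum[OF q]) auto
  finally show ?thesis by simp
qed

end

section \<open>The potential at the ends of runs\<close>

lemma run_mode_swap: "run_mode N xs ys = run_mode N ys xs"
proof (induction N xs ys rule: run_mode.induct)
  case (1 N a xs b ys)
  have "fresh (a # xs) (b # ys) \<longleftrightarrow> fresh (b # ys) (a # xs)" by (rule fresh_swap)
  moreover have "fresh (a # xs) (b # ys) \<Longrightarrow> pos (a # xs) = pos (b # ys)" unfolding fresh_def by blast
  ultimately show ?case using 1 by (auto split: option.splits simp del: pos.simps)
qed (auto; metis run_mode.simps(2,3) neq_Nil_conv)+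

context band
begin

text \<open>A window down to the lower walker, with slope \<open>e\<close>. The mixed product of
  \<open>M\<close> and the width is split into squares, so that \<open>M\<close> enters the constant
  only.\<close>

lemma potential_le_spread:
  assumes e: "0 < e" and M: "0 \<le> M"
  shows "potential a b \<le> (2 + e * M\<^sup>2 + 3 * e) + 9 * e * spread a b + 2 / e\<^sup>2 * cube_sum M (mx (upper a b)) (upper a b)"
proof -
  define w where "w = max 1 (peak a b - pos (lower a b))"
  define r where "r = real_of_int w"
  have r: "0 \<le> r" by (simp add: r_def w_def)
  have "(real_of_int (peak a b - pos (lower a b)))\<^sup>2 \<le> 3 * spread a b"
    using peak_minus_pos[of a b] by (auto simp: lower_def)
  then have r2: "r\<^sup>2 \<le> 1 + 3 * spread a b" using spread_nonneg[of a b]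
    by (cases "1 \<le> peak a b - pos (lower a b)") (auto simp: r_def w_def max_def)
  have "potential a b \<le> 2 + 2 * (\<Sum>z\<in>{mx (upper a b) - w..mx (upper a b) - 1}. cross (upper a b) z)"
    unfolding potential_def by (intro Phi_window) (auto simp: mx_upper peak_nonneg w_def)
  also have "(\<Sum>z\<in>{mx (upper a b) - w..mx (upper a b) - 1}. cross (upper a b) z) \<le> e * r * (M + r) + cube_sum M (mx (upper a b)) (upper a b) / e\<^sup>2"
    unfolding r_def by (intro window_sum e M) (simp add: w_def)
  also have "e * r * (M + r) \<le> e * (M\<^sup>2 / 2 + 3 / 2 * (1 + 3 * spread a b))"
  proof -
    have "r * (M + r) \<le> M\<^sup>2 / 2 + 3 / 2 * r\<^sup>2"
      using zero_le_power2[of "M - r"] by (simp add: power2_eq_square algebra_simps)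
    also have "\<dots> \<le> M\<^sup>2 / 2 + 3 / 2 * (1 + 3 * spread a b)" using r2 by simp
    finally show ?thesis using e by (simp add: mult.assoc mult_left_mono)
  qed
  finally show ?thesis by (simp add: algebra_simps)
qed

lemma end_count:
  assumes q: "q \<in> {p0..p1}"
  shows "sumE q n (\<lambda>xs ys. alive_ind xs ys * ((1 - scanning N xs ys) * stepE q (\<lambda>a b. alive_ind a b * scanning N a b) xs ys)) [] [] \<le> run_count N q n"
proof -
  let ?V = "\<lambda>a b. alive_ind a b * (1 - scanning N a b)"
  have step: "stepE q ?V xs ys + alive_ind xs ys * ((1 - scanning N xs ys) * stepE q (\<lambda>a b. alive_ind a b * scanning N a b) xs ys) \<le> ?V xs ys + fresh_rate N q xs ys" for xs ys
  proof (cases "alive xs ys")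
    case False
    then show ?thesis by (simp add: stepE_dead) (simp add: alive_ind_def fresh_rate_def)
  next
    case True
    show ?thesis
    proof (cases "run_mode N xs ys = None")
      case s: True
      have "stepE q ?V xs ys = stepE q (\<lambda>a b. alive_ind a b * of_bool (fresh a b)) xs ys"
        by (rule stepE_cong) (use s in \<open>auto simp: scanning_def simp del: pos.simps\<close>)
      then show ?thesis using True s by (simp add: fresh_rate_def alive_ind_def scanning_def)
    next
      case False
      have "stepE q ?V xs ys + stepE q (\<lambda>a b. alive_ind a b * scanning N a b) xs ys = stepE q (\<lambda>a b. alive_ind a b) xs ys"
        unfolding stepE_add[symmetric] by (rule stepE_cong) (simp add: algebra_simps)
      also have "\<dots> \<le> stepE q (\<lambda>_ _. 1) xs ys" by (intro stepE_mono_band[OF q] alive_ind_cases)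
      finally have *: "stepE q ?V xs ys + stepE q (\<lambda>a b. alive_ind a b * scanning N a b) xs ys \<le> 1" by simp
      have "alive_ind xs ys = 1" "scanning N xs ys = 0" using True False by (simp_all add: alive_ind_def scanning_def)
      then show ?thesis using * by (simp add: fresh_rate_def)
    qed
  qed
  have "sumE q n (\<lambda>xs ys. alive_ind xs ys * ((1 - scanning N xs ys) * stepE q (\<lambda>a b. alive_ind a b * scanning N a b) xs ys)) [] []
     \<le> ?V [] [] + sumE q n (fresh_rate N q) [] []"
    by (rule pathE_telescope_le[OF _ _ step]) (use q in \<open>auto simp: band_q alive_ind_def scanning_def\<close>)
  then show ?thesis by (simp add: run_count_def scanning_def)
qed

text \<open>The spread vanishes at a fresh time and gains at most \<open>4\<close> per step on
  average, so whatever is found at the ends of runs was gained inside runs.\<close>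

lemma end_spread:
  assumes q: "q \<in> {p0..p1}"
  shows "sumE q n (\<lambda>xs ys. alive_ind xs ys * ((1 - scanning N xs ys) * stepE q (\<lambda>a b. alive_ind a b * (scanning N a b * spread a b)) xs ys)) [] [] \<le> 4 * real n"
proof -
  let ?V = "\<lambda>a b. alive_ind a b * ((1 - scanning N a b) * spread a b)"
  have step: "stepE q ?V xs ys + alive_ind xs ys * ((1 - scanning N xs ys) * stepE q (\<lambda>a b. alive_ind a b * (scanning N a b * spread a b)) xs ys) \<le> ?V xs ys + 4" for xs ys
  proof (cases "alive xs ys")
    case False
    then show ?thesis by (simp add: stepE_dead) (simp add: alive_ind_def)
  next
    case True
    show ?thesis
    proof (cases "run_mode N xs ys = None")
      case s: True
      have "?V (a # xs) (b # ys) = 0" for a b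
        using s fresh_facts(5)[of a xs b ys] by (cases "fresh (a # xs) (b # ys)") (simp_all add: scanning_def)
      then have "stepE q ?V xs ys = stepE q (\<lambda>_ _. 0) xs ys" by (rule stepE_cong)
      then show ?thesis using True s by (simp add: alive_ind_def scanning_def)
    next
      case False
      have "stepE q ?V xs ys + stepE q (\<lambda>a b. alive_ind a b * (scanning N a b * spread a b)) xs ys = stepE q (\<lambda>a b. alive_ind a b * spread a b) xs ys"
        unfolding stepE_add[symmetric] by (rule stepE_cong) (simp add: algebra_simps)
      also have "\<dots> \<le> stepE q spread xs ys" by (intro stepE_mono_band[OF q]) (simp add: alive_ind_def spread_nonneg)
      also have "\<dots> \<le> spread xs ys + 4" by (rule spread_step[OF q])
      finally have *: "stepE q ?V xs ys + stepE q (\<lambda>a b. alive_ind a b * (scanning N a b * spread a b)) xs ys \<le> spread xs ys + 4" .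
      have "alive_ind xs ys = 1" "scanning N xs ys = 0" using True False by (simp_all add: alive_ind_def scanning_def)
      then show ?thesis using * by simp
    qed
  qed
  have "sumE q n (\<lambda>xs ys. alive_ind xs ys * ((1 - scanning N xs ys) * stepE q (\<lambda>a b. alive_ind a b * (scanning N a b * spread a b)) xs ys)) [] []
     \<le> ?V [] [] + sumE q n (\<lambda>_ _. 4) [] []"
    by (rule pathE_telescope_le[OF _ _ step]) (use q in \<open>auto simp: band_q alive_ind_def scanning_def spread_nonneg\<close>)
  then show ?thesis by (simp add: scanning_def)
qed

text \<open>Runs that end do so at pairwise different overall maxima, because a run starts at a new level.\<close>

lemma end_level:
  assumes q: "q \<in> {p0..p1}"
  shows "sumE q n (\<lambda>xs ys. (1 - scanning N xs ys) * stepE q (\<lambda>a b. scanning N a b * (of_bool (mx b = m \<and> peak a b = m) * cube_sum M m b)) xs ys) [] []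
    \<le> cube_bound_sum M m []"
proof -
  \<comment> \<open>The second alternative keeps the account open while the run that has reached
    level \<open>m\<close> is still going on.\<close>
  let ?V = "\<lambda>a b. of_bool (peak a b < m \<or> (peak a b = m \<and> run_mode N a b \<noteq> None)) * cube_bound_sum M m b"
  let ?C = "\<lambda>xs ys. (1 - scanning N xs ys) * stepE q (\<lambda>a b. scanning N a b * (of_bool (mx b = m \<and> peak a b = m) * cube_sum M m b)) xs ys"
  have step: "stepE q ?V xs ys + ?C xs ys \<le> ?V xs ys + 0" for xs ys
  proof -
    have "stepE q ?V xs ys + ?C xs ys = stepE q (\<lambda>a b. ?V a b + (1 - scanning N xs ys) * (scanning N a b * (of_bool (mx b = m \<and> peak a b = m) * cube_sum M m b))) xs ys"
      by (simp only: stepE_add stepE_cmult)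
    also have "\<dots> \<le> stepE q (\<lambda>a b. of_bool (peak xs ys < m \<or> (peak xs ys = m \<and> run_mode N xs ys \<noteq> None)) * cube_bound_sum M m b) xs ys"
    proof (rule stepE_mono_band[OF q])
      fix a b
      define A B where "A = a # xs" and "B = b # ys"
      have m1: "peak xs ys \<le> peak A B" unfolding A_def B_def by (rule peak_step)
      have g: "mx B = m \<Longrightarrow> cube_sum M m B = cube_bound_sum M m B" by (simp add: cube_bound_sum_eq_mx)
      have f: "run_mode N A B \<noteq> None \<Longrightarrow> run_mode N xs ys = None \<Longrightarrow> peak xs ys < peak A B"
        using fresh_facts(4)[of a xs b ys] by (auto simp: A_def B_def split: if_splits simp del: pos.simps)
      have "?V A B + (1 - scanning N xs ys) * (scanning N A B * (of_bool (mx B = m \<and> peak A B = m) * cube_sum M m B))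
         \<le> of_bool (peak xs ys < m \<or> (peak xs ys = m \<and> run_mode N xs ys \<noteq> None)) * cube_bound_sum M m B"
        using m1 g f cube_bound_sum_nonneg[of M m B] by (cases "run_mode N A B"; cases "run_mode N xs ys") (auto simp: scanning_def)
      then show "?V (a # xs) (b # ys) + (1 - scanning N xs ys) * (scanning N (a # xs) (b # ys) * (of_bool (mx (b # ys) = m \<and> peak (a # xs) (b # ys) = m) * cube_sum M m (b # ys)))
         \<le> of_bool (peak xs ys < m \<or> (peak xs ys = m \<and> run_mode N xs ys \<noteq> None)) * cube_bound_sum M m (b # ys)"
        by (simp only: A_def B_def)
    qed
    also have "\<dots> \<le> ?V xs ys"
      unfolding stepE_cmult by (intro mult_left_mono cube_bound_sum_step[OF q]) auto
    finally show ?thesis by simp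
  qed
  have "sumE q n ?C [] [] \<le> ?V [] [] + sumE q n (\<lambda>_ _. 0) [] []"
    by (rule pathE_telescope_le[OF _ _ step]) (use q in \<open>auto simp: band_q cube_bound_sum_nonneg\<close>)
  also have "\<dots> \<le> cube_bound_sum M m []" using cube_bound_sum_nonneg[of M m "[]"] by (cases "peak [] [] < m \<or> (peak [] [] = m \<and> run_mode N [] [] \<noteq> None)") simp_all
  finally show ?thesis .
qed

lemma end_F:
  assumes q: "q \<in> {p0..p1}" and M: "0 \<le> M"
  shows "sumE q n (\<lambda>xs ys. (1 - scanning N xs ys) * stepE q (\<lambda>a b. scanning N a b * (of_bool (mx b = peak a b) * cube_sum M (peak a b) b)) xs ys) [] []
    \<le> (real n + 1) * (c0 * (2 / (M + 1)))"
proof -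
  let ?C = "\<lambda>m xs ys. (1 - scanning N xs ys) * stepE q (\<lambda>a b. scanning N a b * (of_bool (mx b = m \<and> peak a b = m) * cube_sum M m b)) xs ys"
  have C0: "0 \<le> (1 - scanning N xs ys)" for xs ys using scanning_cases by simp
  have "pathE q t (\<lambda>xs ys. (1 - scanning N xs ys) * stepE q (\<lambda>a b. scanning N a b * (of_bool (mx b = peak a b) * cube_sum M (peak a b) b)) xs ys) [] []
     \<le> pathE q t (\<lambda>xs ys. \<Sum>m\<in>{0..int n}. ?C m xs ys) [] []" if t: "t < n" for t
  proof (rule pathE_mono_len)
    fix u w :: "bool list" assume l: "length u = t" "length w = t"
    define xs ys where "xs = u @ []" and "ys = w @ []"
    have bl: "peak (a # xs) (b # ys) \<in> {0..int n}" for a b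
      using mx_le_length[of "a # xs"] mx_le_length[of "b # ys"] l t peak_nonneg[of "a # xs" "b # ys"]
      by (auto simp: peak_def xs_def ys_def simp del: mx.simps)
    have "stepE q (\<lambda>a b. scanning N a b * (of_bool (mx b = peak a b) * cube_sum M (peak a b) b)) xs ys
       \<le> stepE q (\<lambda>a b. \<Sum>m\<in>{0..int n}. scanning N a b * (of_bool (mx b = m \<and> peak a b = m) * cube_sum M m b)) xs ys"
    proof (rule stepE_mono_band[OF q])
      fix a b
      define A B where "A = a # xs" and "B = b # ys"
      have "scanning N A B * (of_bool (mx B = peak A B \<and> peak A B = peak A B) * cube_sum M (peak A B) B)
          \<le> (\<Sum>m\<in>{0..int n}. scanning N A B * (of_bool (mx B = m \<and> peak A B = m) * cube_sum M m B))"
        using bl[of a b] by (intro member_le_sum[where f="\<lambda>m. scanning N A B * (of_bool (mx B = m \<and> peak A B = m) * cube_sum M m B)"])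
           (auto simp: A_def B_def cube_sum_nonneg scanning_cases)
      then show "scanning N (a # xs) (b # ys) * (of_bool (mx (b # ys) = peak (a # xs) (b # ys)) * cube_sum M (peak (a # xs) (b # ys)) (b # ys))
          \<le> (\<Sum>m\<in>{0..int n}. scanning N (a # xs) (b # ys) * (of_bool (mx (b # ys) = m \<and> peak (a # xs) (b # ys) = m) * cube_sum M m (b # ys)))"
        by (simp add: A_def B_def)
    qed
    then have "(1 - scanning N xs ys) * stepE q (\<lambda>a b. scanning N a b * (of_bool (mx b = peak a b) * cube_sum M (peak a b) b)) xs ys
       \<le> (1 - scanning N xs ys) * stepE q (\<lambda>a b. \<Sum>m\<in>{0..int n}. scanning N a b * (of_bool (mx b = m \<and> peak a b = m) * cube_sum M m b)) xs ys"
      using C0 by (intro mult_left_mono)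
    then show "(1 - scanning N (u @ []) (w @ [])) * stepE q (\<lambda>a b. scanning N a b * (of_bool (mx b = peak a b) * cube_sum M (peak a b) b)) (u @ []) (w @ [])
       \<le> (\<Sum>m\<in>{0..int n}. ?C m (u @ []) (w @ []))"
      by (simp only: xs_def ys_def stepE_sum sum_distrib_left)
  qed (use q in \<open>auto simp: band_q\<close>)
  then have "sumE q n (\<lambda>xs ys. (1 - scanning N xs ys) * stepE q (\<lambda>a b. scanning N a b * (of_bool (mx b = peak a b) * cube_sum M (peak a b) b)) xs ys) [] []
     \<le> sumE q n (\<lambda>xs ys. \<Sum>m\<in>{0..int n}. ?C m xs ys) [] []" by (intro sum_mono) auto
  also have "\<dots> = (\<Sum>m\<in>{0..int n}. \<Sum>t<n. pathE q t (?C m) [] [])"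
    unfolding pathE_sum by (rule sum.swap)
  also have "\<dots> \<le> (\<Sum>m\<in>{0..int n}. c0 * (2 / (M + 1)))"
    by (intro sum_mono order_trans[OF end_level[OF q]] cube_bound_sum_bound M) (simp add: c0_def cube_bound_Nil)
  also have "\<dots> = (real n + 1) * (c0 * (2 / (M + 1)))" by simp
  finally show ?thesis .
qed

lemma end_F':
  assumes q: "q \<in> {p0..p1}" and M: "0 \<le> M"
  shows "sumE q n (\<lambda>xs ys. (1 - scanning N xs ys) * stepE q (\<lambda>a b. scanning N a b * (of_bool (mx a = peak a b) * cube_sum M (peak a b) a)) xs ys) [] []
    \<le> (real n + 1) * (c0 * (2 / (M + 1)))"
proof -
  have "pathE q t (\<lambda>xs ys. (1 - scanning N xs ys) * stepE q (\<lambda>a b. scanning N a b * (of_bool (mx a = peak a b) * cube_sum M (peak a b) a)) xs ys) [] []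
    = pathE q t (\<lambda>xs ys. (1 - scanning N xs ys) * stepE q (\<lambda>a b. scanning N a b * (of_bool (mx b = peak a b) * cube_sum M (peak a b) b)) xs ys) [] []" for t
  proof -
    have s: "scanning N a b = scanning N b a" for a b by (simp add: scanning_def run_mode_swap[of N a b])
    have "stepE q (\<lambda>a b. scanning N a b * (of_bool (mx a = peak a b) * cube_sum M (peak a b) a)) ys xs
       = stepE q (\<lambda>a b. scanning N a b * (of_bool (mx b = peak a b) * cube_sum M (peak a b) b)) xs ys" for xs ys
    proof (subst stepE_swap, rule stepE_cong)
      fix a b
      show "scanning N (b # ys) (a # xs) * (of_bool (mx (b # ys) = peak (b # ys) (a # xs)) * cube_sum M (peak (b # ys) (a # xs)) (b # ys))
        = scanning N (a # xs) (b # ys) * (of_bool (mx (b # ys) = peak (a # xs) (b # ys)) * cube_sum M (peak (a # xs) (b # ys)) (b # ys))"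
        by (simp only: s[of "b # ys" "a # xs"] peak_swap[of "b # ys" "a # xs"])
    qed
    moreover have "scanning N b a = scanning N a b" for a b by (rule s)
    ultimately show ?thesis by (subst pathE_swap) (simp only:)
  qed
  then show ?thesis using end_F[OF q M, where n=n and N=N] by simp
qed

lemma end_cost_sum:
  assumes q: "q \<in> {p0..p1}" and e: "0 < e" and M: "0 \<le> M"
  shows "sumE q n (end_cost N q) [] [] \<le> (2 + e * M\<^sup>2 + 3 * e) * run_count N q n + 9 * e * (4 * real n)
     + 2 / e\<^sup>2 * ((real n + 1) * (c0 * (2 / (M + 1))) + (real n + 1) * (c0 * (2 / (M + 1))))"
proof -
  define k where "k = 2 + e * M\<^sup>2 + 3 * e"
  define f1 where "f1 = (\<lambda>xs ys. alive_ind xs ys * ((1 - scanning N xs ys) * stepE q (\<lambda>a b. alive_ind a b * scanning N a b) xs ys))"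
  define f2 where "f2 = (\<lambda>xs ys. alive_ind xs ys * ((1 - scanning N xs ys) * stepE q (\<lambda>a b. alive_ind a b * (scanning N a b * spread a b)) xs ys))"
  define f3 where "f3 = (\<lambda>xs ys. (1 - scanning N xs ys) * stepE q (\<lambda>a b. scanning N a b * (of_bool (mx a = peak a b) * cube_sum M (peak a b) a)) xs ys)"
  define f4 where "f4 = (\<lambda>xs ys. (1 - scanning N xs ys) * stepE q (\<lambda>a b. scanning N a b * (of_bool (mx b = peak a b) * cube_sum M (peak a b) b)) xs ys)"
  have k: "0 \<le> k" "0 \<le> 9 * e" "0 \<le> 2 / e\<^sup>2" using e by (auto simp: k_def)
  have st0: "(\<And>a b. 0 \<le> F a b) \<Longrightarrow> 0 \<le> stepE q F xs ys" for F xs ys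
    using stepE_mono_band[OF q, of "\<lambda>_ _. 0" xs ys F] by simp
  have n34: "0 \<le> f3 xs ys" "0 \<le> f4 xs ys" for xs ys
    using scanning_cases unfolding f3_def f4_def by (auto intro!: mult_nonneg_nonneg st0 cube_sum_nonneg)
  have pw: "end_cost N q xs ys \<le> k * f1 xs ys + 9 * e * f2 xs ys + 2 / e\<^sup>2 * (f3 xs ys + f4 xs ys)" for xs ys
  proof (cases "alive_ind xs ys * (1 - scanning N xs ys) = 1")
    case True
    then have 1: "alive_ind xs ys = 1" "1 - scanning N xs ys = 1" using alive_ind_cases(1)[of xs ys] scanning_cases(1)[of N xs ys] by auto
    have "stepE q (\<lambda>a b. alive_ind a b * (scanning N a b * potential a b)) xs ys
       \<le> stepE q (\<lambda>a b. k * (alive_ind a b * scanning N a b) + 9 * e * (alive_ind a b * (scanning N a b * spread a b))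
         + 2 / e\<^sup>2 * (scanning N a b * (of_bool (mx a = peak a b) * cube_sum M (peak a b) a) + scanning N a b * (of_bool (mx b = peak a b) * cube_sum M (peak a b) b))) xs ys"
    proof (rule stepE_mono_band[OF q])
      fix x y
      define a b where "a = x # xs" and "b = y # ys"
      have nonneg_path: "0 \<le> cube_sum M (peak a b) a" "0 \<le> cube_sum M (peak a b) b" by (rule cube_sum_nonneg)+
      have P: "potential a b \<le> k + 9 * e * spread a b + 2 / e\<^sup>2 * cube_sum M (peak a b) (upper a b)"
        using potential_le_spread[OF e M, of a b] by (simp add: k_def mx_upper)
      have h: "cube_sum M (peak a b) (upper a b) \<le> of_bool (mx a = peak a b) * cube_sum M (peak a b) a + of_bool (mx b = peak a b) * cube_sum M (peak a b) b"
        using nonneg_path by (auto simp: upper_def peak_def)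
      have h': "2 / e\<^sup>2 * cube_sum M (peak a b) (upper a b) \<le> 2 / e\<^sup>2 * (of_bool (mx a = peak a b) * cube_sum M (peak a b) a + of_bool (mx b = peak a b) * cube_sum M (peak a b) b)"
        using h k by (intro mult_left_mono)
      have r: "0 \<le> 2 / e\<^sup>2 * (of_bool (mx a = peak a b) * cube_sum M (peak a b) a + of_bool (mx b = peak a b) * cube_sum M (peak a b) b)"
        using nonneg_path k by (intro mult_nonneg_nonneg add_nonneg_nonneg) auto
      have "alive_ind a b * (scanning N a b * potential a b) \<le> k * (alive_ind a b * scanning N a b) + 9 * e * (alive_ind a b * (scanning N a b * spread a b))
         + 2 / e\<^sup>2 * (scanning N a b * (of_bool (mx a = peak a b) * cube_sum M (peak a b) a) + scanning N a b * (of_bool (mx b = peak a b) * cube_sum M (peak a b) b))"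
      proof -
        define R3 where "R3 = 2 / e\<^sup>2 * (of_bool (mx a = peak a b) * cube_sum M (peak a b) a + of_bool (mx b = peak a b) * cube_sum M (peak a b) b)"
        have e3: "2 / e\<^sup>2 * (scanning N a b * (of_bool (mx a = peak a b) * cube_sum M (peak a b) a) + scanning N a b * (of_bool (mx b = peak a b) * cube_sum M (peak a b) b)) = scanning N a b * R3"
          by (simp only: R3_def distrib_left mult.left_commute)
        have "potential a b \<le> k + 9 * e * spread a b + R3" "0 \<le> R3" using P h' r unfolding R3_def by linarith+
        then show ?thesis unfolding e3 using alive_ind_cases(1)[of a b] scanning_cases(1)[of N a b] by (elim disjE) simp_all
      qed
      then show "alive_ind (x # xs) (y # ys) * (scanning N (x # xs) (y # ys) * potential (x # xs) (y # ys)) \<le> k * (alive_ind (x # xs) (y # ys) * scanning N (x # xs) (y # ys)) + 9 * e * (alive_ind (x # xs) (y # ys) * (scanning N (x # xs) (y # ys) * spread (x # xs) (y # ys)))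
         + 2 / e\<^sup>2 * (scanning N (x # xs) (y # ys) * (of_bool (mx (x # xs) = peak (x # xs) (y # ys)) * cube_sum M (peak (x # xs) (y # ys)) (x # xs)) + scanning N (x # xs) (y # ys) * (of_bool (mx (y # ys) = peak (x # xs) (y # ys)) * cube_sum M (peak (x # xs) (y # ys)) (y # ys)))"
        by (simp only: a_def b_def)
    qed
    also have "\<dots> = k * f1 xs ys + 9 * e * f2 xs ys + 2 / e\<^sup>2 * (f3 xs ys + f4 xs ys)"
      using 1 by (simp only: stepE_add stepE_cmult f1_def f2_def f3_def f4_def mult_1)
    finally show ?thesis using 1 by (simp only: end_cost_def mult_1)
  next
    case False
    then have 0: "alive_ind xs ys = 0 \<or> 1 - scanning N xs ys = 0" using alive_ind_cases(1)[of xs ys] scanning_cases(1)[of N xs ys] by auto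
    then have "end_cost N q xs ys = 0" "f1 xs ys = 0" "f2 xs ys = 0" by (auto simp: end_cost_def f1_def f2_def)
    moreover have "0 \<le> 2 / e\<^sup>2 * (f3 xs ys + f4 xs ys)" using n34[of xs ys] k(3) by (intro mult_nonneg_nonneg) auto
    ultimately show ?thesis by simp
  qed
  have "sumE q n (end_cost N q) [] [] \<le> sumE q n (\<lambda>xs ys. k * f1 xs ys + 9 * e * f2 xs ys + 2 / e\<^sup>2 * (f3 xs ys + f4 xs ys)) [] []"
    by (intro sum_mono pathE_mono_band[OF q] pw)
  also have "\<dots> = k * sumE q n f1 [] [] + 9 * e * sumE q n f2 [] [] + 2 / e\<^sup>2 * (sumE q n f3 [] [] + sumE q n f4 [] [])"
    by (simp only: pathE_add pathE_cmult sum.distrib sum_distrib_left[symmetric])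
  also have "\<dots> \<le> k * run_count N q n + 9 * e * (4 * real n) + 2 / e\<^sup>2 * ((real n + 1) * (c0 * (2 / (M + 1))) + (real n + 1) * (c0 * (2 / (M + 1))))"
    unfolding f1_def f2_def f3_def f4_def
    by (intro add_mono mult_left_mono k end_count[OF q] end_spread[OF q] end_F[OF q M] end_F'[OF q M])
  finally show ?thesis by (simp add: k_def)
qed

lemma run_count_bound:
  assumes q: "q \<in> {p0..p1}" and N: "1 \<le> N" and rho: "0 < rho" "\<And>n. rho \<le> pathE q n alive_ind [] []"
  shows "run_count N q n \<le> 1 / (rho * real N) * (real n + real N)" "rho * real N \<le> drift_sum (\<lambda>_ _. 1) q N"
proof -
  have "(\<Sum>t<N. rho) \<le> sumE q N alive_ind [] []" by (intro sum_mono rho)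
  then show d: "rho * real N \<le> drift_sum (\<lambda>_ _. 1) q N" by (simp add: drift_sum_def mult.commute)
  have "rho * real N * run_count N q n \<le> drift_sum (\<lambda>_ _. 1) q N * run_count N q n"
    using d run_count_nonneg[OF q] by (intro mult_right_mono)
  also have "\<dots> \<le> real n + real N" by (rule run_count_le[OF q N])
  finally show "run_count N q n \<le> 1 / (rho * real N) * (real n + real N)" using rho N by (simp add: field_simps)
qed

section \<open>Choice of the constants\<close>

text \<open>The offset at the ends of runs is \<open>sqrt N\<close>. Its square \<open>N\<close>,
  multiplied by a run density of \<open>1 / (rho * N)\<close>, costs only \<open>e / rho\<close> per
  step, while the third-moment part decays like \<open>1 / sqrt N\<close>.\<close>

lemma scan_le_explicit:
  assumes q: "q \<in> {p0..p1}" and N: "1 \<le> N" and rho: "0 < rho" "\<And>n. rho \<le> pathE q n alive_ind [] []"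
    and e: "0 < e" and A: "0 < A1" "0 < A2" and R: "1 \<le> R"
  defines "K1 \<equiv> 4 + A2 + 2 * A1 * (real R + 1)" and "k0 \<equiv> 1 / A2\<^sup>2 + 2 * (real R + 1)\<^sup>2 / A1\<^sup>2"
    and "K \<equiv> real (2 * R + 1)" and "K3 \<equiv> real (2 * R + 1) / step_min ^ (2 * R + 1)" and "a \<equiv> 1 / (rho * real N)"
    and "s \<equiv> 1 + 2 * sqrt (real R)" and "g1 \<equiv> c0 * (2 / (real R + 1))" and "g2 \<equiv> c0 * (2 / (sqrt (real N) + 1))"
    and "E2 \<equiv> 2 / e\<^sup>2" and "iR \<equiv> 1 / real R" and "r2 \<equiv> 2 / (real R)\<^sup>2"
  shows "scan_time N q n \<le> (K1 * K3 * a + K1 * a + (2 + A2) * s * iR + 12 * e + r2 + 4 * k0 * c0 + 2 * E2 * g1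
      + (2 + e * real N + 3 * e) * a + 36 * e + 2 * E2 * g2) * real n
      + (4 + K1 * K3 * a * (1 + K + real N) + K1 * a * real N + (2 + A2) * s + (2 + e * real N + 3 * e) * a * real N + 2 * E2 * g2)"
proof -
  let ?Z = "\<Sum>t<Suc n. pathE q t (\<lambda>a b. alive_ind a b * scanning N a b * of_bool (near R a b)) [] []"
  have nr: "run_count N q m \<le> a * (real m + real N)" for m unfolding a_def by (rule run_count_bound(1)[OF q N rho])
  have K1: "0 \<le> K1" and kk: "0 \<le> 2 + e * real N + 3 * e" using A e by (auto simp: K1_def)
  have Kc: "0 < step_min ^ (2 * R + 1)" using step_min by simp
  have "step_min ^ (2 * R + 1) * ?Z \<le> real (2 * R + 1) * run_count N q (Suc n + (2 * R + 1))" by (rule near_scan_sum[OF q])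
  also have "\<dots> \<le> real (2 * R + 1) * (a * (real n + 1 + K + real N))"
    using nr[of "Suc n + (2 * R + 1)"] by (intro mult_left_mono) (auto simp: K_def algebra_simps)
  finally have "?Z \<le> real (2 * R + 1) * (a * (real n + 1 + K + real N)) / step_min ^ (2 * R + 1)"
    using Kc by (simp only: pos_le_divide_eq mult.commute)
  then have Z: "?Z \<le> K3 * (a * (real n + 1 + K + real N))" by (simp add: K3_def)
  have "scan_time N q n \<le> 4 + sumE q n (scan_cost N q) [] [] + sumE q n (end_cost N q) [] []" by (rule scan_le[OF q])
  also have "sumE q n (scan_cost N q) [] [] \<le> K1 * (?Z + run_count N q n) + (2 + A2) * ((real n / real R + 1) * s)
      + (12 * e + r2) * real n + (2 * (real n * (k0 * (c0 * 2))) + 2 * (real n * (E2 * g1)))"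
    using scan_cost_sum[OF q e A R, where n=n and N=N] by (simp only: K1_def k0_def s_def r2_def E2_def g1_def)
  also have "K1 * (?Z + run_count N q n) \<le> K1 * (K3 * (a * (real n + 1 + K + real N)) + a * (real n + real N))"
    using Z nr[of n] K1 by (intro mult_left_mono add_mono)
  also have "sumE q n (end_cost N q) [] [] \<le> (2 + e * real N + 3 * e) * run_count N q n + 9 * e * (4 * real n) + E2 * ((real n + 1) * g2 + (real n + 1) * g2)"
    using end_cost_sum[OF q e, of "sqrt (real N)", where n=n and N=N] by (simp add: E2_def g2_def)
  also have "(2 + e * real N + 3 * e) * run_count N q n \<le> (2 + e * real N + 3 * e) * (a * (real n + real N))"
    using kk nr by (intro mult_left_mono)
  also have "real n / real R = real n * iR" by (simp add: iR_def)
  finally show ?thesis by (simp add: algebra_simps)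
qed

lemma scan_bound:
  assumes rho: "0 < rho" "\<And>q n. q \<in> {p0..p1} \<Longrightarrow> rho \<le> pathE q n alive_ind [] []" and eta: "0 < eta"
  obtains N0 where "1 \<le> N0" "\<And>N. N0 \<le> N \<Longrightarrow> \<exists>B. \<forall>q\<in>{p0..p1}. \<forall>n. scan_time N q n \<le> eta * real n + B"
proof -
  \<comment> \<open>Five groups of terms get \<open>et\<close> each. The parameters are fixed in the
    order \<open>e\<close>, \<open>A2\<close>, \<open>R\<close>, \<open>A1\<close>,
    \<open>N\<close>: \<open>R\<close> depends on the first two, \<open>A1\<close> on
    \<open>R\<close>, and \<open>N\<close> comes last because it must outweigh the cost of near
    states, which involves \<open>R\<close>, \<open>A1\<close> and \<open>A2\<close>.\<close>
  define et where "et = eta / 6"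
  have et: "0 < et" using eta by (simp add: et_def)
  \<comment> \<open>The \<open>48\<close> collects \<open>12\<close> from far exchanges and
    \<open>36\<close> from the spread at the ends of runs; \<open>1 / rho\<close> stems from the
    offset \<open>sqrt N\<close>.\<close>
  define e where "e = et / (48 + 1 / rho)"
  have e: "0 < e" using et rho by (simp add: e_def add_pos_pos)
  have "e * (48 + 1 / rho) = et" using rho unfolding e_def by (simp add: add_pos_pos less_imp_neq[symmetric])
  then have G1: "48 * e + e / rho = et" by (simp add: algebra_simps)
  have "((\<lambda>A. 4 * c0 * (1 / A\<^sup>2)) \<longlongrightarrow> 0) at_top" by real_asymp
  then have "eventually (\<lambda>A. 4 * c0 * (1 / A\<^sup>2) < et \<and> 0 < A) at_top"
    using et by (intro eventually_conj order_tendstoD(2) eventually_gt_at_top)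
  then obtain A2 :: real where A2: "4 * c0 * (1 / A2\<^sup>2) < et" "0 < A2" by (auto dest: eventually_happens)
  have "((\<lambda>R::nat. (2 + A2) * ((1 + 2 * sqrt (real R)) * (1 / real R)) + 2 / (real R)\<^sup>2 + 2 * (2 / e\<^sup>2) * c0 * (2 / (real R + 1))) \<longlongrightarrow> (2 + A2) * 0 + 0 + 2 * (2 / e\<^sup>2) * c0 * 0) at_top"
    by (intro tendsto_add tendsto_mult tendsto_const; real_asymp)
  then have "((\<lambda>R::nat. (2 + A2) * ((1 + 2 * sqrt (real R)) * (1 / real R)) + 2 / (real R)\<^sup>2 + 2 * (2 / e\<^sup>2) * c0 * (2 / (real R + 1))) \<longlongrightarrow> 0) at_top"
    by simp
  then have "eventually (\<lambda>R::nat. (2 + A2) * ((1 + 2 * sqrt (real R)) * (1 / real R)) + 2 / (real R)\<^sup>2 + 2 * (2 / e\<^sup>2) * c0 * (2 / (real R + 1)) < et \<and> 1 \<le> R) at_top"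
    using et by (intro eventually_conj order_tendstoD(2) eventually_ge_at_top)
  then obtain R where R: "(2 + A2) * ((1 + 2 * sqrt (real R)) * (1 / real R)) + 2 / (real R)\<^sup>2 + 2 * (2 / e\<^sup>2) * c0 * (2 / (real R + 1)) < et" "1 \<le> R"
    by (auto dest: eventually_happens)
  have "((\<lambda>A. 4 * c0 * 2 * (real R + 1)\<^sup>2 * (1 / A\<^sup>2)) \<longlongrightarrow> 4 * c0 * 2 * (real R + 1)\<^sup>2 * 0) at_top"
    by (intro tendsto_mult tendsto_const; real_asymp)
  then have "((\<lambda>A. 4 * c0 * 2 * (real R + 1)\<^sup>2 * (1 / A\<^sup>2)) \<longlongrightarrow> 0) at_top" by simp
  then have "eventually (\<lambda>A. 4 * c0 * 2 * (real R + 1)\<^sup>2 * (1 / A\<^sup>2) < et \<and> 0 < A) at_top"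
    using et by (intro eventually_conj order_tendstoD(2) eventually_gt_at_top)
  then obtain A1 :: real where A1: "4 * c0 * 2 * (real R + 1)\<^sup>2 * (1 / A1\<^sup>2) < et" "0 < A1" by (auto dest: eventually_happens)
  define K1 where "K1 = 4 + A2 + 2 * A1 * (real R + 1)"
  define K3 where "K3 = real (2 * R + 1) / step_min ^ (2 * R + 1)"
  have "((\<lambda>N::nat. (K1 * K3 + K1 + 2 + 3 * e) * (1 / rho) * (1 / real N) + 2 * (2 / e\<^sup>2) * c0 * (2 / (sqrt (real N) + 1))) \<longlongrightarrow>
      (K1 * K3 + K1 + 2 + 3 * e) * (1 / rho) * 0 + 2 * (2 / e\<^sup>2) * c0 * 0) at_top"
    by (intro tendsto_add tendsto_mult tendsto_const; real_asymp)
  then have "((\<lambda>N::nat. (K1 * K3 + K1 + 2 + 3 * e) * (1 / rho) * (1 / real N) + 2 * (2 / e\<^sup>2) * c0 * (2 / (sqrt (real N) + 1))) \<longlongrightarrow> 0) at_top"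
    by simp
  then have "eventually (\<lambda>N::nat. (K1 * K3 + K1 + 2 + 3 * e) * (1 / rho) * (1 / real N) + 2 * (2 / e\<^sup>2) * c0 * (2 / (sqrt (real N) + 1)) < et) at_top"
    using et by (intro order_tendstoD(2))
  then obtain N1 where N1: "\<And>N::nat. N1 \<le> N \<Longrightarrow> (K1 * K3 + K1 + 2 + 3 * e) * (1 / rho) * (1 / real N) + 2 * (2 / e\<^sup>2) * c0 * (2 / (sqrt (real N) + 1)) < et"
    by (auto simp: eventually_sequentially)
  show ?thesis
  proof (rule that[of "max 1 N1"])
    fix N assume N: "max 1 N1 \<le> N"
    then have N': "1 \<le> N" "N1 \<le> N" by auto
    define k0 where "k0 = 1 / A2\<^sup>2 + 2 * (real R + 1)\<^sup>2 / A1\<^sup>2"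
    define a where "a = 1 / (rho * real N)"
    define s where "s = 1 + 2 * sqrt (real R)"
    define iR where "iR = 1 / real R"
    define C where "C = K1 * K3 * a + K1 * a + (2 + A2) * s * iR + 12 * e + 2 / (real R)\<^sup>2 + 4 * k0 * c0 + 2 * (2 / e\<^sup>2) * (c0 * (2 / (real R + 1)))
      + (2 + e * real N + 3 * e) * a + 36 * e + 2 * (2 / e\<^sup>2) * (c0 * (2 / (sqrt (real N) + 1)))"
    have "e * real N * a = e / rho" using N' rho by (simp add: a_def)
    moreover have "(K1 * K3 + K1 + 2 + 3 * e) * (1 / rho) * (1 / real N) = (K1 * K3 + K1 + 2 + 3 * e) * a" by (simp add: a_def)
    moreover have "4 * k0 * c0 = 4 * c0 * (1 / A2\<^sup>2) + 4 * c0 * 2 * (real R + 1)\<^sup>2 * (1 / A1\<^sup>2)" by (simp add: k0_def algebra_simps)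
    moreover have "(2 + A2) * s * iR = (2 + A2) * ((1 + 2 * sqrt (real R)) * (1 / real R))" by (simp add: s_def iR_def)
    moreover have "C = ((K1 * K3 + K1 + 2 + 3 * e) * a + 2 * (2 / e\<^sup>2) * c0 * (2 / (sqrt (real N) + 1)))
       + ((2 + A2) * s * iR + 2 / (real R)\<^sup>2 + 2 * (2 / e\<^sup>2) * c0 * (2 / (real R + 1))) + 4 * k0 * c0 + (48 * e + e * real N * a)"
      unfolding C_def by (simp add: distrib_right mult.assoc)
    ultimately have C: "C \<le> eta" using N1[OF N'(2)] R(1) A1(1) A2(1) G1 et_def eta by linarith
    define B where "B = 4 + K1 * K3 * a * (1 + real (2 * R + 1) + real N) + K1 * a * real N + (2 + A2) * s + (2 + e * real N + 3 * e) * a * real N + 2 * (2 / e\<^sup>2) * (c0 * (2 / (sqrt (real N) + 1)))"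
    have "scan_time N q n \<le> eta * real n + B" if q: "q \<in> {p0..p1}" for q n
    proof -
      have "scan_time N q n \<le> C * real n + B"
        using scan_le_explicit[OF q N'(1) rho(1) rho(2)[OF q] e A1(2) A2(2) R(2), where n=n]
        by (simp only: C_def B_def K1_def K3_def a_def s_def k0_def iR_def)
      also have "C * real n \<le> eta * real n" using C by (intro mult_right_mono) auto
      finally show ?thesis by simp
    qed
    then show "\<exists>B. \<forall>q\<in>{p0..p1}. \<forall>n. scan_time N q n \<le> eta * real n + B" by blast
  qed simp
qed

end

section \<open>Histories of the random walk\<close>

text \<open>Everything other than a step \<open>+1\<close> is recorded as down, which is correct
  almost surely and makes the list a measurable function defined everywhere.\<close>

primrec step_list :: "(nat \<Rightarrow> 'a \<Rightarrow> int) \<Rightarrow> nat \<Rightarrow> 'a \<Rightarrow> bool list" where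
  "step_list Z 0 \<omega> = []"
| "step_list Z (Suc n) \<omega> = (Z (Suc n) \<omega> = Z n \<omega> + 1) # step_list Z n \<omega>"

lemma length_step_list [simp]: "length (step_list Z n \<omega>) = n"
  by (induction n) auto

lemma step_list_pos:
  assumes "Z 0 \<omega> = 0" "\<And>n. Z (Suc n) \<omega> - Z n \<omega> \<in> {-1, 1}"
  shows "pos (step_list Z n \<omega>) = Z n \<omega>"
proof (induction n)
  case (Suc n)
  then show ?case using assms(2)[of n] by auto
qed (simp add: assms)

lemma step_list_visit_count:
  assumes "Z 0 \<omega> = 0" "\<And>n. Z (Suc n) \<omega> - Z n \<omega> \<in> {-1, 1}"
  shows "visit_count (step_list Z n \<omega>) x = visits Z n x \<omega>"
proof (induction n)
  case 0
  have "{m. m \<le> (0::nat) \<and> Z m \<omega> = x} = (if x = 0 then {0} else {})" using assms by auto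
  then show ?case by (simp add: visits_def)
next
  case (Suc n)
  have e: "{m. m \<le> Suc n \<and> Z m \<omega> = x} = {m. m \<le> n \<and> Z m \<omega> = x} \<union> (if Z (Suc n) \<omega> = x then {Suc n} else {})"
    by (auto simp: le_Suc_eq)
  have "visits Z (Suc n) x \<omega> = visits Z n x \<omega> + (if Z (Suc n) \<omega> = x then 1 else 0)"
    unfolding visits_def e by (subst card_Un_disjoint) auto
  moreover have "pos (step_list Z (Suc n) \<omega>) = Z (Suc n) \<omega>" by (rule step_list_pos[where Z=Z and \<omega>=\<omega>, OF assms])
  ultimately show ?case using Suc by (simp del: pos.simps)
qed

lemma measurable_step_list:
  assumes "\<And>m. m \<le> n \<Longrightarrow> Z m \<in> measurable F (count_space UNIV)"
  shows "step_list Z n \<in> measurable F (count_space UNIV)"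
  using assms
proof (induction n)
  case (Suc n)
  have [measurable]: "step_list Z n \<in> measurable F (count_space UNIV)" "Z (Suc n) \<in> measurable F (count_space UNIV)" "Z n \<in> measurable F (count_space UNIV)"
    using Suc by auto
  show ?case unfolding step_list.simps by measurable
next
  case 0
  have "step_list Z 0 = (\<lambda>_. [])" by auto
  then show ?case by simp
qed

context mutually_excited_random_walk
begin

abbreviation "HX n \<omega> \<equiv> step_list X n \<omega>"
abbreviation "HY n \<omega> \<equiv> step_list Y n \<omega>"
abbreviation "on_hist F n \<omega> \<equiv> F (HX n \<omega>) (HY n \<omega>)"

lemma AE_good: "AE \<omega> in M. X 0 \<omega> = 0 \<and> Y 0 \<omega> = 0 \<and>
    (\<forall>n. X (Suc n) \<omega> - X n \<omega> \<in> {-1, 1} \<and> Y (Suc n) \<omega> - Y n \<omega> \<in> {-1, 1})"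
proof -
  have "AE \<omega> in M. \<forall>n. X (Suc n) \<omega> - X n \<omega> \<in> {-1, 1} \<and> Y (Suc n) \<omega> - Y n \<omega> \<in> {-1, 1}"
    unfolding AE_all_countable using steps by blast
  with start show ?thesis by eventually_elim auto
qed

lemma AE_hist: "AE \<omega> in M. \<forall>n. pos (HX n \<omega>) = X n \<omega> \<and> pos (HY n \<omega>) = Y n \<omega>
    \<and> (\<forall>x. visit_count (HX n \<omega>) x = visits X n x \<omega> \<and> visit_count (HY n \<omega>) x = visits Y n x \<omega>)"
  using AE_good
proof eventually_elim
  case (elim \<omega>)
  then have "X 0 \<omega> = 0" "\<And>n. X (Suc n) \<omega> - X n \<omega> \<in> {-1, 1}" "Y 0 \<omega> = 0" "\<And>n. Y (Suc n) \<omega> - Y n \<omega> \<in> {-1, 1}"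
    by blast+
  then show ?case by (simp add: step_list_pos step_list_visit_count)
qed

lemma sets_history: "space (history M X Y n) = space M"
  "sets (history M X Y n) = sigma_sets (space M) ({X m -` A \<inter> space M | m A. m \<le> n} \<union> {Y m -` A \<inter> space M | m A. m \<le> n})"
proof -
  have s: "{X m -` A \<inter> space M | m A. m \<le> n} \<union> {Y m -` A \<inter> space M | m A. m \<le> n} \<subseteq> Pow (space M)" by auto
  show "space (history M X Y n) = space M" unfolding history_def by (rule space_measure_of[OF s])
  show "sets (history M X Y n) = sigma_sets (space M) ({X m -` A \<inter> space M | m A. m \<le> n} \<union> {Y m -` A \<inter> space M | m A. m \<le> n})"
    unfolding history_def by (rule sets_measure_of[OF s])
qed

lemma subalgebra_history: "subalgebra M (history M X Y n)"
proof -
  have "sigma_sets (space M) ({X m -` A \<inter> space M | m A. m \<le> n} \<union> {Y m -` A \<inter> space M | m A. m \<le> n}) \<subseteq> sets M"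
    using measurable_X measurable_Y by (intro sets.sigma_sets_subset) (auto intro: measurable_sets)
  then show ?thesis unfolding subalgebra_def sets_history by simp
qed

lemma measurable_history:
  assumes "m \<le> n"
  shows "X m \<in> measurable (history M X Y n) (count_space UNIV)" "Y m \<in> measurable (history M X Y n) (count_space UNIV)"
proof -
  have "X m -` A \<inter> space M \<in> sets (history M X Y n)" "Y m -` A \<inter> space M \<in> sets (history M X Y n)" for A
    unfolding sets_history using assms by (intro sigma_sets.Basic; blast)+
  then show "X m \<in> measurable (history M X Y n) (count_space UNIV)" "Y m \<in> measurable (history M X Y n) (count_space UNIV)"
    by (auto simp: measurable_def sets_history(1))
qed

lemma measurable_F_history: "(\<lambda>\<omega>. on_hist (F :: bool list \<Rightarrow> bool list \<Rightarrow> real) n \<omega>) \<in> borel_measurable (history M X Y n)"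
proof -
  have [measurable]: "step_list X n \<in> measurable (history M X Y n) (count_space UNIV)" "step_list Y n \<in> measurable (history M X Y n) (count_space UNIV)"
    by (intro measurable_step_list measurable_history; simp)+
  show ?thesis by measurable
qed

lemma measurable_F: "(\<lambda>\<omega>. on_hist (F :: bool list \<Rightarrow> bool list \<Rightarrow> real) n \<omega>) \<in> borel_measurable M"
  using measurable_from_subalg[OF subalgebra_history measurable_F_history] .

text \<open>At a fixed time there are finitely many step lists, so integrability is never an
  issue.\<close>

lemma bounded_F: "\<exists>B. \<forall>\<omega>. \<bar>on_hist (F :: bool list \<Rightarrow> bool list \<Rightarrow> real) n \<omega>\<bar> \<le> B"
proof -
  define L where "L = {xs :: bool list. length xs = n}"
  have "finite L" using finite_lists_length_eq[of "UNIV :: bool set" n] by (simp add: L_def)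
  then have f: "finite ((\<lambda>(u, w). \<bar>F u w\<bar>) ` (L \<times> L))" by auto
  have "\<bar>on_hist F n \<omega>\<bar> \<in> (\<lambda>(u, w). \<bar>F u w\<bar>) ` (L \<times> L)" for \<omega> by (auto simp: L_def)
  then show ?thesis using Max_ge[OF f] by blast
qed

lemma integrable_F: "integrable M (\<lambda>\<omega>. on_hist (F :: bool list \<Rightarrow> bool list \<Rightarrow> real) n \<omega>)"
proof -
  obtain B where "\<And>\<omega>. \<bar>on_hist F n \<omega>\<bar> \<le> B" using bounded_F by blast
  then show ?thesis by (intro integrable_const_bound[where B=B] measurable_F) auto
qed

lemma cond_integral:
  assumes E: "{\<omega> \<in> space M. E \<omega>} \<in> sets M" and W: "AE \<omega> in M. cond_probability M (history M X Y n) E \<omega> = on_hist W n \<omega>"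
  shows "(\<integral>\<omega>. on_hist C n \<omega> * indicator {\<omega> \<in> space M. E \<omega>} \<omega> \<partial>M) = (\<integral>\<omega>. on_hist C n \<omega> * (on_hist W n \<omega> :: real) \<partial>M)"
proof -
  interpret S: finite_measure_subalgebra M "history M X Y n"
    by unfold_locales (rule subalgebra_history)
  let ?I = "indicator {\<omega> \<in> space M. E \<omega>} :: 'a \<Rightarrow> real"
  have [measurable]: "?I \<in> borel_measurable M" using E by (rule borel_measurable_indicator)
  have [measurable]: "(\<lambda>\<omega>. on_hist C n \<omega>) \<in> borel_measurable M" "(\<lambda>\<omega>. on_hist W n \<omega>) \<in> borel_measurable M"
    by (rule measurable_F)+
  obtain B where B: "\<And>\<omega>. \<bar>on_hist C n \<omega>\<bar> \<le> B" using bounded_F by blast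
  have int: "integrable M (\<lambda>\<omega>. on_hist C n \<omega> * ?I \<omega>)"
  proof (rule integrable_const_bound[where B=B])
    have "0 \<le> B" using B abs_ge_zero order_trans by blast
    then show "AE \<omega> in M. norm (on_hist C n \<omega> * ?I \<omega>) \<le> B" using B by (auto simp: indicator_def)
  qed measurable
  have "(\<integral>\<omega>. on_hist C n \<omega> * ?I \<omega> \<partial>M) = (\<integral>\<omega>. on_hist C n \<omega> * real_cond_exp M (history M X Y n) ?I \<omega> \<partial>M)"
    by (rule S.real_cond_exp_intg(2)[symmetric, OF int measurable_F_history]) measurable
  also have "\<dots> = (\<integral>\<omega>. on_hist C n \<omega> * on_hist W n \<omega> \<partial>M)"
  proof (rule integral_cong_AE)
    show "AE \<omega> in M. on_hist C n \<omega> * real_cond_exp M (history M X Y n) ?I \<omega> = on_hist C n \<omega> * on_hist W n \<omega>"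
      using W by eventually_elim (simp add: cond_probability_def)
  qed measurable
  finally show ?thesis .
qed

text \<open>A function of two binary outcomes is a combination of \<open>1\<close>, the indicators
  of the two up steps and the indicator of both, so conditional independence enters through a single
  pair of events.\<close>

lemma one_step: "(\<integral>\<omega>. on_hist F (Suc n) \<omega> \<partial>M) = (\<integral>\<omega>. on_hist (stepE p F) n \<omega> \<partial>M)"
proof -
  define U where "U = (\<lambda>\<omega>. X (Suc n) \<omega> = X n \<omega> + 1)"
  define V where "V = (\<lambda>\<omega>. Y (Suc n) \<omega> = Y n \<omega> + 1)"
  have [measurable]: "X k \<in> measurable M (count_space UNIV)" "Y k \<in> measurable M (count_space UNIV)" for k
    by (rule measurable_X measurable_Y)+
  have mU: "{\<omega> \<in> space M. U \<omega>} \<in> sets M" and mV: "{\<omega> \<in> space M. V \<omega>} \<in> sets M" and mUV: "{\<omega> \<in> space M. U \<omega> \<and> V \<omega>} \<in> sets M"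
    unfolding U_def V_def by measurable
  let ?Fn = "history M X Y n"
  have wU: "AE \<omega> in M. cond_probability M ?Fn U \<omega> = on_hist (up_prob p) n \<omega>"
    using step_X[of n] AE_hist by eventually_elim (simp add: U_def up_prob_def)
  have wV: "AE \<omega> in M. cond_probability M ?Fn V \<omega> = up_prob p (HY n \<omega>) (HX n \<omega>)"
    using step_Y[of n] AE_hist by eventually_elim (simp add: V_def up_prob_def)
  have eU: "(\<lambda>\<eta>. X (Suc n) \<eta> - X n \<eta> \<in> {1}) = U" "(\<lambda>\<eta>. Y (Suc n) \<eta> - Y n \<eta> \<in> {1}) = V"
    "(\<lambda>\<eta>. X (Suc n) \<eta> - X n \<eta> \<in> {1} \<and> Y (Suc n) \<eta> - Y n \<eta> \<in> {1}) = (\<lambda>\<omega>. U \<omega> \<and> V \<omega>)"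
    by (auto simp: U_def V_def fun_eq_iff)
  have "AE \<omega> in M. cond_probability M ?Fn (\<lambda>\<omega>. U \<omega> \<and> V \<omega>) \<omega> = cond_probability M ?Fn U \<omega> * cond_probability M ?Fn V \<omega>"
    using indep_steps[of n, unfolded cond_indep_int_def, rule_format, of "{1}" "{1}"] unfolding eU .
  then have wUV: "AE \<omega> in M. cond_probability M ?Fn (\<lambda>\<omega>. U \<omega> \<and> V \<omega>) \<omega> = on_hist (up_prob p) n \<omega> * up_prob p (HY n \<omega>) (HX n \<omega>)"
    using wU wV by eventually_elim simp
  define c0 where "c0 = (\<lambda>u w. F (False # u) (False # w))"
  define c1 where "c1 = (\<lambda>u w. F (True # u) (False # w) - F (False # u) (False # w))"
  define c2 where "c2 = (\<lambda>u w. F (False # u) (True # w) - F (False # u) (False # w))"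
  define c3 where "c3 = (\<lambda>u w. F (True # u) (True # w) - F (True # u) (False # w) - F (False # u) (True # w) + F (False # u) (False # w))"
  let ?iU = "indicator {\<omega> \<in> space M. U \<omega>} :: 'a \<Rightarrow> real" and ?iV = "indicator {\<omega> \<in> space M. V \<omega>} :: 'a \<Rightarrow> real"
    and ?iUV = "indicator {\<omega> \<in> space M. U \<omega> \<and> V \<omega>} :: 'a \<Rightarrow> real"
  have int: "integrable M (\<lambda>\<omega>. on_hist C n \<omega> * indicator S \<omega>)" if "S \<in> sets M" for S and C :: "bool list \<Rightarrow> bool list \<Rightarrow> real"
    using integrable_real_mult_indicator[OF that integrable_F[of C n]] by simp
  have "(\<integral>\<omega>. on_hist F (Suc n) \<omega> \<partial>M)
     = (\<integral>\<omega>. on_hist c0 n \<omega> + on_hist c1 n \<omega> * ?iU \<omega> + on_hist c2 n \<omega> * ?iV \<omega> + on_hist c3 n \<omega> * ?iUV \<omega> \<partial>M)"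
  proof (rule Bochner_Integration.integral_cong[OF refl])
    fix \<omega> assume "\<omega> \<in> space M"
    then show "on_hist F (Suc n) \<omega> = on_hist c0 n \<omega> + on_hist c1 n \<omega> * ?iU \<omega> + on_hist c2 n \<omega> * ?iV \<omega> + on_hist c3 n \<omega> * ?iUV \<omega>"
      by (cases "U \<omega>"; cases "V \<omega>") (simp_all add: c0_def c1_def c2_def c3_def U_def[symmetric] V_def[symmetric], simp_all add: U_def V_def)
  qed
  also have "\<dots> = (\<integral>\<omega>. on_hist c0 n \<omega> \<partial>M) + (\<integral>\<omega>. on_hist c1 n \<omega> * ?iU \<omega> \<partial>M) + (\<integral>\<omega>. on_hist c2 n \<omega> * ?iV \<omega> \<partial>M) + (\<integral>\<omega>. on_hist c3 n \<omega> * ?iUV \<omega> \<partial>M)"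
    using int mU mV mUV integrable_F by (simp add: Bochner_Integration.integrable_add)
  also have "\<dots> = (\<integral>\<omega>. on_hist c0 n \<omega> \<partial>M) + (\<integral>\<omega>. on_hist c1 n \<omega> * on_hist (up_prob p) n \<omega> \<partial>M)
     + (\<integral>\<omega>. on_hist c2 n \<omega> * up_prob p (HY n \<omega>) (HX n \<omega>) \<partial>M) + (\<integral>\<omega>. on_hist c3 n \<omega> * (on_hist (up_prob p) n \<omega> * up_prob p (HY n \<omega>) (HX n \<omega>)) \<partial>M)"
    using cond_integral[OF mU, where W="up_prob p" and C=c1, OF wU] cond_integral[OF mV, where W="\<lambda>u w. up_prob p w u" and C=c2, OF wV]
      cond_integral[OF mUV, where W="\<lambda>u w. up_prob p u w * up_prob p w u" and C=c3, OF wUV] by simp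
  also have "\<dots> = (\<integral>\<omega>. on_hist c0 n \<omega> + on_hist c1 n \<omega> * on_hist (up_prob p) n \<omega>
     + on_hist c2 n \<omega> * up_prob p (HY n \<omega>) (HX n \<omega>) + on_hist c3 n \<omega> * (on_hist (up_prob p) n \<omega> * up_prob p (HY n \<omega>) (HX n \<omega>)) \<partial>M)"
    using integrable_F[of c0 n] integrable_F[of "\<lambda>u w. c1 u w * up_prob p u w" n] integrable_F[of "\<lambda>u w. c2 u w * up_prob p w u" n]
      integrable_F[of "\<lambda>u w. c3 u w * (up_prob p u w * up_prob p w u)" n] by simp
  also have "\<dots> = (\<integral>\<omega>. on_hist (stepE p F) n \<omega> \<partial>M)"
    by (rule Bochner_Integration.integral_cong) (simp_all add: stepE_def c0_def c1_def c2_def c3_def algebra_simps)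
  finally show ?thesis .
qed

lemma expectation_pathE: "(\<integral>\<omega>. on_hist F n \<omega> \<partial>M) = pathE p n F [] []"
proof (induction n arbitrary: F)
  case 0
  then show ?case by (simp add: prob_space)
next
  case (Suc n)
  then show ?case unfolding one_step by (simp only: pathE_stepE)
qed

end

section \<open>Limits of the killed drift and bounds for the speed\<close>

lemma stepE_pos: "stepE q (\<lambda>a b. real_of_int (pos a)) u w = real_of_int (pos u) + (2 * up_prob q u w - 1)"
  by (simp add: stepE_fst algebra_simps)

lemma pos_Cons_diff: "\<bar>real_of_int (pos (a # u)) - real_of_int (pos u)\<bar> \<le> 1"
  by simp

context mutually_excited_random_walk
begin

lemma alive_hist_antimono: "alive (HX (s + t) \<omega>) (HY (s + t) \<omega>) \<Longrightarrow> on_hist alive s \<omega>"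
proof (induction t)
  case (Suc t)
  then show ?case using alive_Cons by (metis add_Suc_right step_list.simps(2))
qed simp

lemma killed_drift:
  "sumE p n (\<lambda>a b. of_bool (alive a b) * (2 * up_prob p a b - 1 - v)) [] []
   = (\<integral>\<omega>. (\<Sum>t<n. of_bool (on_hist alive t \<omega>) * (real_of_int (pos (HX (Suc t) \<omega>)) - real_of_int (pos (HX t \<omega>)) - v)) \<partial>M)"
proof -
  \<comment> \<open>The summand at time \<open>t + 1\<close> must know the state before the step; it
    is read off the tails of the lists.\<close>
  define S where "S = (\<lambda>a b. of_bool (alive (tl a) (tl b)) * (real_of_int (pos a) - real_of_int (pos (tl a)) - v))"
  have "pathE p t (\<lambda>a b. of_bool (alive a b) * (2 * up_prob p a b - 1 - v)) [] [] = (\<integral>\<omega>. on_hist S (Suc t) \<omega> \<partial>M)" for t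
  proof -
    have "stepE p S u w = of_bool (alive u w) * (2 * up_prob p u w - 1 - v)" for u w
      by (simp add: S_def stepE_def algebra_simps)
    then have "(\<lambda>a b. of_bool (alive a b) * (2 * up_prob p a b - 1 - v)) = stepE p S" by (intro ext) simp
    then show ?thesis by (simp only: pathE_stepE expectation_pathE)
  qed
  then have "sumE p n (\<lambda>a b. of_bool (alive a b) * (2 * up_prob p a b - 1 - v)) [] []
     = (\<Sum>t<n. \<integral>\<omega>. on_hist S (Suc t) \<omega> \<partial>M)" by simp
  also have "\<dots> = (\<integral>\<omega>. (\<Sum>t<n. on_hist S (Suc t) \<omega>) \<partial>M)"
    by (rule Bochner_Integration.integral_sum[symmetric]) (rule integrable_F)
  finally show ?thesis by (simp add: S_def)
qed

text \<open>On survival the killed sum is \<open>X n - n * v\<close>; otherwise it is eventually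
  constant. By dominated convergence the limit carries the probability \<open>rho'\<close> of
  surviving for ever, one factor for all \<open>v\<close>.\<close>

lemma killed_drift_limit:
  assumes speed: "AE \<omega> in M. (\<lambda>n. real_of_int (X n \<omega>) / real n) \<longlonglongrightarrow> vq"
  obtains rho' where "\<And>v. (\<lambda>n. sumE p n (\<lambda>a b. of_bool (alive a b) * (2 * up_prob p a b - 1 - v)) [] [] / real n)
    \<longlonglongrightarrow> (vq - v) * rho'"
proof -
  define A where "A = (\<lambda>t \<omega>. of_bool (on_hist alive t \<omega>) :: real)"
  define L where "L = (\<lambda>\<omega>. of_bool (\<forall>t. on_hist alive t \<omega>) :: real)"
  have A01: "0 \<le> A t \<omega>" for t \<omega> by (simp add: A_def)
  have mA: "A t \<in> borel_measurable M" for t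
    unfolding A_def by (rule measurable_F[of "\<lambda>a b. of_bool (alive a b)" t])
  have "L = (\<lambda>\<omega>. INF t. A t \<omega>)"
  proof
    fix \<omega>
    show "L \<omega> = (INF t. A t \<omega>)"
    proof (cases "\<forall>t. on_hist alive t \<omega>")
      case True
      then show ?thesis by (simp add: L_def A_def)
    next
      case False
      then obtain t where "A t \<omega> = 0" by (auto simp: A_def)
      moreover have "bdd_below (range (\<lambda>t. A t \<omega>))" by (rule bdd_belowI[of _ 0]) (auto simp: A_def)
      ultimately have "(INF t. A t \<omega>) \<le> 0" by (metis cINF_lower UNIV_I)
      moreover have "0 \<le> (INF t. A t \<omega>)" by (rule cINF_greatest) (auto simp: A_def)
      ultimately show ?thesis using False by (simp add: L_def)
    qed
  qed
  moreover have "(\<lambda>\<omega>. INF t. A t \<omega>) \<in> borel_measurable M"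
    using mA A01 by (intro borel_measurable_cINF) (auto intro!: bdd_belowI[of _ 0])
  ultimately have mL: "L \<in> borel_measurable M" by simp
  define g where "g = (\<lambda>v n \<omega>. (\<Sum>t<n. A t \<omega> * (real_of_int (pos (HX (Suc t) \<omega>)) - real_of_int (pos (HX t \<omega>)) - v)) / real n)"
  have mg: "g v n \<in> borel_measurable M" for v n
  proof -
    have "(\<lambda>\<omega>. real_of_int (pos (HX t \<omega>))) \<in> borel_measurable M" for t
      by (rule measurable_F[of "\<lambda>a b. real_of_int (pos a)" t])
    then show ?thesis unfolding g_def using mA by measurable
  qed
  have lim: "AE \<omega> in M. (\<lambda>n. g v n \<omega>) \<longlonglongrightarrow> (vq - v) * L \<omega>" for v
    using speed AE_hist
  proof eventually_elim
    case (elim \<omega>)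
    show ?case
    proof (cases "\<forall>t. on_hist alive t \<omega>")
      case True
      have "(\<Sum>t<n. A t \<omega> * (real_of_int (pos (HX (Suc t) \<omega>)) - real_of_int (pos (HX t \<omega>)) - v)) = real_of_int (X n \<omega>) - real n * v" for n
      proof -
        have "(\<Sum>t<n. A t \<omega> * (real_of_int (pos (HX (Suc t) \<omega>)) - real_of_int (pos (HX t \<omega>)) - v))
          = (\<Sum>t<n. real_of_int (pos (HX (Suc t) \<omega>)) - real_of_int (pos (HX t \<omega>))) - real n * v"
          using True by (simp add: A_def sum_subtractf)
        also have "(\<Sum>t<n. real_of_int (pos (HX (Suc t) \<omega>)) - real_of_int (pos (HX t \<omega>))) = real_of_int (pos (HX n \<omega>)) - real_of_int (pos (HX 0 \<omega>))"
          by (rule sum_lessThan_telescope)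
        finally show ?thesis using elim by simp
      qed
      then have e: "g v n \<omega> = real_of_int (X n \<omega>) / real n - v" if "1 \<le> n" for n
        using that by (simp add: g_def diff_divide_distrib)
      have "(\<lambda>n. real_of_int (X n \<omega>) / real n - v) \<longlonglongrightarrow> vq - v" using elim by (intro tendsto_diff tendsto_const) auto
      moreover have "eventually (\<lambda>n. real_of_int (X n \<omega>) / real n - v = g v n \<omega>) sequentially"
        using e by (intro eventually_sequentiallyI[of 1]) auto
      ultimately have "(\<lambda>n. g v n \<omega>) \<longlonglongrightarrow> vq - v" by (rule Lim_transform_eventually)
      then show ?thesis using True by (simp add: L_def)
    next
      case False
      then obtain T where T: "\<not> on_hist alive T \<omega>" by auto
      have z: "A t \<omega> = 0" if "T \<le> t" for t
        using alive_hist_antimono[of T "t - T" \<omega>] T that by (auto simp: A_def)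
      define c where "c = (\<Sum>t<T. A t \<omega> * (real_of_int (pos (HX (Suc t) \<omega>)) - real_of_int (pos (HX t \<omega>)) - v))"
      have "g v n \<omega> = c / real n" if "T \<le> n" for n
      proof -
        have "(\<Sum>t<n. A t \<omega> * (real_of_int (pos (HX (Suc t) \<omega>)) - real_of_int (pos (HX t \<omega>)) - v)) = c"
          unfolding c_def using that z by (intro sum.mono_neutral_right) auto
        then show ?thesis by (simp add: g_def)
      qed
      then have "eventually (\<lambda>n. c / real n = g v n \<omega>) sequentially"
        by (intro eventually_sequentiallyI[of T]) auto
      moreover have "(\<lambda>n. c / real n) \<longlonglongrightarrow> 0" by (rule lim_const_over_n)
      ultimately have "(\<lambda>n. g v n \<omega>) \<longlonglongrightarrow> 0" by (rule Lim_transform_eventually[rotated])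
      moreover have "L \<omega> = 0" unfolding L_def of_bool_eq_0_iff by (rule False)
      ultimately show ?thesis by simp
    qed
  qed
  have bound: "norm (g v n \<omega>) \<le> 1 + \<bar>v\<bar>" for v n \<omega>
  proof -
    have "\<bar>\<Sum>t<n. A t \<omega> * (real_of_int (pos (HX (Suc t) \<omega>)) - real_of_int (pos (HX t \<omega>)) - v)\<bar> \<le> (\<Sum>t<n. 1 + \<bar>v\<bar>)"
    proof (intro order_trans[OF sum_abs] sum_mono)
      fix t
      have "\<bar>real_of_int (pos (HX (Suc t) \<omega>)) - real_of_int (pos (HX t \<omega>)) - v\<bar> \<le> 1 + \<bar>v\<bar>"
        using pos_Cons_diff[of "X (Suc t) \<omega> = X t \<omega> + 1" "HX t \<omega>"] unfolding step_list.simps by linarith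
      then show "\<bar>A t \<omega> * (real_of_int (pos (HX (Suc t) \<omega>)) - real_of_int (pos (HX t \<omega>)) - v)\<bar> \<le> 1 + \<bar>v\<bar>"
        by (simp add: A_def del: step_list.simps)
    qed
    then show ?thesis by (cases "n = 0") (simp_all add: g_def divide_le_eq mult.commute del: step_list.simps)
  qed
  have "(\<lambda>n. \<integral>\<omega>. g v n \<omega> \<partial>M) \<longlonglongrightarrow> (\<integral>\<omega>. (vq - v) * L \<omega> \<partial>M)" for v
    by (rule integral_dominated_convergence[where w="\<lambda>_. 1 + \<bar>v\<bar>", OF _ mg _ lim]) (use mL bound in auto)
  moreover have "(\<integral>\<omega>. g v n \<omega> \<partial>M) = sumE p n (\<lambda>a b. of_bool (alive a b) * (2 * up_prob p a b - 1 - v)) [] [] / real n" for v n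
    unfolding g_def A_def killed_drift by simp
  ultimately show ?thesis using that[of "\<integral>\<omega>. L \<omega> \<partial>M"] by simp
qed

text \<open>Each conditional mean step lies between \<open>0\<close> and \<open>2 * p - 1\<close>,
  and since \<open>X n / n\<close> is bounded, the limit passes to expectations.\<close>

lemma speed_bounds:
  assumes speed: "AE \<omega> in M. (\<lambda>n. real_of_int (X n \<omega>) / real n) \<longlonglongrightarrow> vq" and q: "1/2 \<le> p" "p < 1"
  shows "0 \<le> vq" "vq \<le> 2 * p - 1"
proof -
  have u: "0 \<le> 2 * up_prob p a b - 1" "2 * up_prob p a b - 1 \<le> 2 * p - 1" for a b using up_prob_cases[of p a b] q by auto
  have E: "0 \<le> pathE p n (\<lambda>a b. real_of_int (pos a)) [] [] \<and> pathE p n (\<lambda>a b. real_of_int (pos a)) [] [] \<le> real n * (2 * p - 1)" for n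
  proof (induction n)
    case (Suc n)
    have "pathE p (Suc n) (\<lambda>a b. real_of_int (pos a)) [] [] = pathE p n (\<lambda>a b. real_of_int (pos a) + (2 * up_prob p a b - 1)) [] []"
      by (subst pathE_stepE[symmetric], subst stepE_pos[abs_def]) (rule refl)
    also have "\<dots> = pathE p n (\<lambda>a b. real_of_int (pos a)) [] [] + pathE p n (\<lambda>a b. 2 * up_prob p a b - 1) [] []" by (rule pathE_add)
    finally have e: "pathE p (Suc n) (\<lambda>a b. real_of_int (pos a)) [] [] = pathE p n (\<lambda>a b. real_of_int (pos a)) [] [] + pathE p n (\<lambda>a b. 2 * up_prob p a b - 1) [] []" .
    have "0 \<le> pathE p n (\<lambda>a b. 2 * up_prob p a b - 1) [] []" using q u by (intro pathE_nonneg) auto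
    moreover have "pathE p n (\<lambda>a b. 2 * up_prob p a b - 1) [] [] \<le> pathE p n (\<lambda>a b. 2 * p - 1) [] []" using q u(2) by (intro pathE_mono) auto
    ultimately show ?case using Suc unfolding e by (simp add: algebra_simps)
  qed simp
  have "(\<lambda>n. \<integral>\<omega>. real_of_int (pos (HX n \<omega>)) / real n \<partial>M) \<longlonglongrightarrow> (\<integral>\<omega>. vq \<partial>M)"
  proof (rule integral_dominated_convergence[where w="\<lambda>_. 1"])
    show "AE \<omega> in M. (\<lambda>n. real_of_int (pos (HX n \<omega>)) / real n) \<longlonglongrightarrow> vq"
      using speed AE_hist by eventually_elim simp
    show "(\<lambda>\<omega>. real_of_int (pos (HX n \<omega>)) / real n) \<in> borel_measurable M" for n
      by (rule measurable_F[of "\<lambda>a b. real_of_int (pos a) / real n" n])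
    have "\<bar>pos xs\<bar> \<le> int (length xs)" for xs by (induction xs) auto
    then have "\<bar>real_of_int (pos (HX n \<omega>))\<bar> \<le> real n" for n \<omega> by (metis length_step_list of_int_abs of_int_le_iff of_int_of_nat_eq)
    then show "AE \<omega> in M. norm (real_of_int (pos (HX n \<omega>)) / real n) \<le> 1" for n by (cases "n = 0") (auto simp: divide_le_eq)
  qed auto
  then have l: "(\<lambda>n. pathE p n (\<lambda>a b. real_of_int (pos a)) [] [] / real n) \<longlonglongrightarrow> vq"
    using expectation_pathE[of "\<lambda>a b. real_of_int (pos a)"] by (simp add: prob_space)
  show "0 \<le> vq" using E by (intro LIMSEQ_le_const[OF l]) auto
  have "pathE p n (\<lambda>a b. real_of_int (pos a)) [] [] / real n \<le> 2 * p - 1" if "1 \<le> n" for n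
    using E[of n] that by (simp add: divide_le_eq mult.commute)
  then show "vq \<le> 2 * p - 1" by (intro LIMSEQ_le_const2[OF l]) auto
qed

end

lemma pathE_isCont:
  assumes "\<And>a b. isCont (\<lambda>q. F q a b) p"
  shows "isCont (\<lambda>q. pathE q t (F q) xs ys) p"
proof (induction t arbitrary: xs ys)
  case (Suc t)
  have "isCont (\<lambda>q. up_prob q xs ys) p" for xs ys
    by (cases "visit_count ys (pos xs) \<le> 1") (simp_all add: up_prob_def merw_weight_def)
  then show ?case using Suc unfolding funpow.simps comp_def stepE_def
    by (intro continuous_intros)
qed (simp add: assms)

context band
begin

section \<open>Continuity of the speed\<close>

definition drift_dev :: "real \<Rightarrow> real \<Rightarrow> bool list \<Rightarrow> bool list \<Rightarrow> real" where
  "drift_dev v q = (\<lambda>a b. 2 * up_prob q a b - 1 - v)"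

lemma drift_sum_isCont: "isCont (\<lambda>q. drift_sum (drift_dev v q) q N) p"
proof -
  have "isCont (\<lambda>q. up_prob q xs ys) p" for xs ys
    by (cases "visit_count ys (pos xs) \<le> 1") (simp_all add: up_prob_def merw_weight_def)
  then show ?thesis unfolding drift_sum_def drift_dev_def
    by (intro continuous_sum pathE_isCont continuous_intros)
qed

lemma shift_invariant_drift_dev: "shift_invariant (drift_dev v q)"
  using up_prob_append by (auto simp: shift_invariant_def drift_dev_def)

lemma speed_continuous_at:
  fixes vv :: "real \<Rightarrow> real" and M :: "real \<Rightarrow> 'a measure" and X Y :: "real \<Rightarrow> nat \<Rightarrow> 'a \<Rightarrow> int"
  assumes merw: "\<And>q. q \<in> {p0..p1} \<Longrightarrow> mutually_excited_random_walk (M q) q (X q) (Y q)"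
    and speed: "\<And>q. q \<in> {p0..p1} \<Longrightarrow> AE \<omega> in M q. (\<lambda>n. real_of_int (X q n \<omega>) / real n) \<longlonglongrightarrow> vv q"
    and p: "p \<in> {p0..p1}" and eps: "0 < eps"
  obtains d where "0 < d" "\<And>q. q \<in> {p0..p1} \<Longrightarrow> \<bar>q - p\<bar> < d \<Longrightarrow> \<bar>vv q - vv p\<bar> \<le> eps"
proof -
  obtain rho where rho: "0 < rho" "\<And>q n. q \<in> {p0..p1} \<Longrightarrow> rho \<le> pathE q n alive_ind [] []" using survival by blast
  define v where "v = vv p"
  have lim: "\<exists>rho'. rho \<le> rho' \<and> (\<lambda>n. drift_sum (drift_dev v q) q n / real n) \<longlonglongrightarrow> (vv q - v) * rho'" if q: "q \<in> {p0..p1}" for q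
  proof -
    interpret mutually_excited_random_walk "M q" q "X q" "Y q" by (rule merw[OF q])
    obtain rho' where r: "\<And>v. (\<lambda>n. drift_sum (drift_dev v q) q n / real n) \<longlonglongrightarrow> (vv q - v) * rho'"
      using killed_drift_limit[OF speed[OF q]] unfolding drift_sum_def drift_dev_def alive_ind_def by blast
    \<comment> \<open>The difference between the centrings \<open>-1\<close> and \<open>0\<close>
      counts the time alive, which identifies \<open>rho'\<close> as a limiting average of survival
      probabilities, all at least \<open>rho\<close>.\<close>
    have "(\<lambda>n. drift_sum (drift_dev (-1) q) q n / real n - drift_sum (drift_dev 0 q) q n / real n) \<longlonglongrightarrow> (vv q - (-1)) * rho' - (vv q - 0) * rho'"
      by (intro tendsto_diff r)
    moreover have "drift_sum (drift_dev (-1) q) q n / real n - drift_sum (drift_dev 0 q) q n / real n = sumE q n alive_ind [] [] / real n" for n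
    proof -
      have "pathE q t (\<lambda>a b. alive_ind a b * drift_dev (-1) q a b) [] [] - pathE q t (\<lambda>a b. alive_ind a b * drift_dev 0 q a b) [] [] = pathE q t alive_ind [] []" for t
        unfolding pathE_diff[symmetric] by (rule arg_cong[where f="\<lambda>F. pathE q t F [] []"]) (simp add: drift_dev_def fun_eq_iff algebra_simps)
      then show ?thesis unfolding drift_sum_def diff_divide_distrib[symmetric] sum_subtractf[symmetric] by simp
    qed
    ultimately have l: "(\<lambda>n. sumE q n alive_ind [] [] / real n) \<longlonglongrightarrow> rho'" by (simp add: algebra_simps)
    have "rho \<le> sumE q n alive_ind [] [] / real n" if "1 \<le> n" for n
    proof -
      have "(\<Sum>t<n. rho) \<le> sumE q n alive_ind [] []" by (intro sum_mono rho q)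
      then show ?thesis using that by (simp add: le_divide_eq mult.commute)
    qed
    then have "rho \<le> rho'" by (intro LIMSEQ_le_const[OF l]) auto
    then show ?thesis using r by blast
  qed
  \<comment> \<open>The centred drift is bounded by \<open>2 + |v|\<close>, so waiting contributes
    \<open>rho * eps / 2\<close>. The runs contribute as much, and dividing by \<open>rho'\<close>
    leaves at most \<open>eps\<close>.\<close>
  define eta where "eta = rho * eps / (2 * (2 + \<bar>v\<bar>))"
  have eta: "0 < eta" using rho eps by (simp add: eta_def add_pos_nonneg)
  obtain N0 where N0: "1 \<le> N0" "\<And>N. N0 \<le> N \<Longrightarrow> \<exists>B. \<forall>q\<in>{p0..p1}. \<forall>n. scan_time N q n \<le> eta * real n + B"
    using scan_bound[OF rho eta] by blast
  \<comment> \<open>It is used twice, for the value at \<open>p\<close> and for the continuity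
    error; one factor \<open>rho\<close> is lost to the run density
    \<open>1 / (rho * N)\<close>.\<close>
  define e2 where "e2 = rho * rho * eps / 4"
  have e2: "0 < e2" using rho eps by (simp add: e2_def)
  obtain rho' where "(\<lambda>n. drift_sum (drift_dev v p) p n / real n) \<longlonglongrightarrow> (vv p - v) * rho'" using lim[OF p] by blast
  then have "(\<lambda>n. drift_sum (drift_dev v p) p n / real n) \<longlonglongrightarrow> 0" by (simp add: v_def)
  then have "eventually (\<lambda>n. \<bar>drift_sum (drift_dev v p) p n / real n\<bar> < e2) sequentially"
    using e2 by (intro order_tendstoD(2)[OF tendsto_rabs_zero])
  then obtain N1 where N1: "\<And>n. N1 \<le> n \<Longrightarrow> \<bar>drift_sum (drift_dev v p) p n / real n\<bar> < e2" by (auto simp: eventually_sequentially)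
  \<comment> \<open>The horizon is fixed before \<open>q\<close>: \<open>N0\<close> serves the
    waiting time for all parameters at once, \<open>N1\<close> the centred drift at
    \<open>p\<close>; only then is continuity at this horizon invoked.\<close>
  define N where "N = max N0 N1"
  have N: "1 \<le> N" "N0 \<le> N" "N1 \<le> N" using N0 by (auto simp: N_def)
  obtain B where B: "\<And>q n. q \<in> {p0..p1} \<Longrightarrow> scan_time N q n \<le> eta * real n + B" using N0(2)[OF N(2)] by blast
  have "isCont (\<lambda>q. drift_sum (drift_dev v q) q N / real N) p" using N by (intro continuous_divide drift_sum_isCont continuous_const) auto
  then obtain d where d: "0 < d" "\<And>q. \<bar>q - p\<bar> < d \<Longrightarrow> \<bar>drift_sum (drift_dev v q) q N / real N - drift_sum (drift_dev v p) p N / real N\<bar> < e2"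
    using e2 unfolding continuous_at_eps_delta dist_real_def by blast
  show ?thesis
  proof (rule that[OF d(1)])
    fix q assume q: "q \<in> {p0..p1}" and qd: "\<bar>q - p\<bar> < d"
    obtain rho' where r: "rho \<le> rho'" "(\<lambda>n. drift_sum (drift_dev v q) q n / real n) \<longlonglongrightarrow> (vv q - v) * rho'" using lim[OF q] by blast
    define b where "b = 2 + \<bar>v\<bar>"
    have b: "0 < b" by (simp add: b_def add_pos_nonneg)
    have db: "\<bar>drift_dev v q x y\<bar> \<le> b" for x y using up_prob_bounds[OF q, of x y] by (auto simp: drift_dev_def b_def abs_le_iff)
    define D where "D = \<bar>drift_sum (drift_dev v q) q N\<bar>"
    define a where "a = 1 / (rho * real N)"
    have D: "D * a \<le> rho * eps / 2"
    proof -
      have "\<bar>drift_sum (drift_dev v q) q N / real N\<bar> < 2 * e2" using d(2)[OF qd] N1[OF N(3)] by linarith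
      then have "D / real N < 2 * e2" by (simp add: D_def)
      then have "D / real N \<le> rho * rho * eps / 2" unfolding e2_def by linarith
      then have "(D / real N) / rho \<le> (rho * rho * eps / 2) / rho" using rho by (intro divide_right_mono) auto
      then show ?thesis using rho by (simp add: a_def mult.commute)
    qed
    have ub: "\<bar>drift_sum (drift_dev v q) q n / real n\<bar> \<le> (b * real N + b * B + D * a * real N) / real n + (b * eta + D * a)" if n: "1 \<le> n" for n
    proof -
      have "\<bar>drift_sum (drift_dev v q) q n\<bar> \<le> b * real N + b * scan_time N q n + D * run_count N q n"
        unfolding D_def by (rule drift_sum_le[OF q N(1) shift_invariant_drift_dev db])
      also have "\<dots> \<le> b * real N + b * (eta * real n + B) + D * (a * (real n + real N))"
        unfolding a_def using b B[OF q] run_count_bound(1)[OF q N(1) rho(1) rho(2)[OF q]]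
        by (intro add_mono mult_left_mono order_refl) (auto simp: D_def)
      finally have *: "\<bar>drift_sum (drift_dev v q) q n\<bar> \<le> (b * real N + b * B + D * a * real N) + (b * eta + D * a) * real n"
        by (simp add: algebra_simps)
      have "\<bar>drift_sum (drift_dev v q) q n / real n\<bar> = \<bar>drift_sum (drift_dev v q) q n\<bar> / real n" by simp
      also have "\<dots> \<le> ((b * real N + b * B + D * a * real N) + (b * eta + D * a) * real n) / real n"
        by (intro divide_right_mono *) auto
      also have "\<dots> = (b * real N + b * B + D * a * real N) / real n + (b * eta + D * a)"
        using n by (simp add: add_divide_distrib)
      finally show ?thesis .
    qed
    have "(\<lambda>n. (b * real N + b * B + D * a * real N) / real n + (b * eta + D * a)) \<longlonglongrightarrow> 0 + (b * eta + D * a)"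
      by (intro tendsto_add lim_const_over_n tendsto_const)
    then have "\<bar>(vv q - v) * rho'\<bar> \<le> 0 + (b * eta + D * a)"
      using ub by (intro LIMSEQ_le[OF tendsto_rabs[OF r(2)]]) auto
    also have "b * eta = rho * eps / 2" using b by (simp add: eta_def b_def[symmetric])
    finally have "\<bar>vv q - v\<bar> * rho' \<le> eps * rho" using D rho r by (simp add: abs_mult mult.commute)
    moreover have "\<bar>vv q - v\<bar> * rho \<le> \<bar>vv q - v\<bar> * rho'" using r by (intro mult_left_mono) auto
    ultimately have "\<bar>vv q - v\<bar> * rho \<le> eps * rho" by linarith
    then show "\<bar>vv q - vv p\<bar> \<le> eps" using rho by (simp add: v_def)
  qed
qed

end

theorem theorem4p4:
  fixes M :: "real \<Rightarrow> 'a measure"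
    and X Y :: "real \<Rightarrow> nat \<Rightarrow> 'a \<Rightarrow> int"
    and v :: "real \<Rightarrow> real"
  assumes merw: "\<And>p. p \<in> {1/2..<1} \<Longrightarrow> mutually_excited_random_walk (M p) p (X p) (Y p)"
    and speed_X: "\<And>p. p \<in> {1/2..<1} \<Longrightarrow>
      AE \<omega> in M p. (\<lambda>n. real_of_int (X p n \<omega>) / real n) \<longlonglongrightarrow> v p"
    and speed_Y: "\<And>p. p \<in> {1/2..<1} \<Longrightarrow>
      AE \<omega> in M p. (\<lambda>n. real_of_int (Y p n \<omega>) / real n) \<longlonglongrightarrow> v p"
  shows "continuous_on {1/2..<1} v"
  unfolding continuous_on_iff
proof (intro ballI allI impI)
  fix p e :: real assume p: "p \<in> {1/2..<1}" and e: "0 < e"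
  have v: "0 \<le> v q" "v q \<le> 2 * q - 1" if "q \<in> {1/2..<1}" for q
    using mutually_excited_random_walk.speed_bounds[OF merw[OF that] speed_X[OF that]] that by auto
  show "\<exists>d>0. \<forall>q\<in>{1/2..<1}. dist q p < d \<longrightarrow> dist (v q) (v p) < e"
  proof (cases "p = 1/2")
    case True
    have "dist (v q) (v p) < e" if "q \<in> {1/2..<1}" "dist q p < e / 2" for q
    proof -
      have "v (1 / 2) = 0" using v[OF p] unfolding True by simp
      then show ?thesis using v[OF that(1)] that unfolding True by (auto simp: dist_real_def abs_if split: if_splits)
    qed
    then show ?thesis using e by (intro exI[of _ "e / 2"]) auto
  next
    case False
    \<comment> \<open>Midpoints towards \<open>1/2\<close> and \<open>1\<close>: \<open>p\<close>
      becomes an interior point of a band in which the uniform estimates hold.\<close>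
    define p0 p1 where "p0 = (1/2 + p) / 2" and "p1 = (1 + p) / 2"
    have b: "1/2 < p0" "p0 < p" "p < p1" "p1 < 1" using p False by (auto simp: p0_def p1_def)
    interpret band p0 p1 by unfold_locales (use b in auto)
    have sub: "q \<in> {1/2..<1}" if "q \<in> {p0..p1}" for q using that b by auto
    obtain d where d: "0 < d" "\<And>q. q \<in> {p0..p1} \<Longrightarrow> \<bar>q - p\<bar> < d \<Longrightarrow> \<bar>v q - v p\<bar> \<le> e / 2"
      using speed_continuous_at[of M X Y v p "e / 2"] merw[OF sub] speed_X[OF sub] b e by auto
    have "dist (v q) (v p) < e" if "dist q p < min d (min (p - p0) (p1 - p))" for q
      using d(2)[of q] that e by (auto simp: dist_real_def abs_if split: if_splits)
    then show ?thesis using d b by (intro exI[of _ "min d (min (p - p0) (p1 - p))"]) auto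
  qed
qed

end
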